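(* Let $R>0$ and let $k>0$ be a fixed wavenumber. Let $S\in H(B_R)$ (regarded as a source on $\mathbb R^2$ via extension by zero outside $B_R$), and let $u=u(\cdot,k)$ be the radiating solution of the biharmonic wave equation $\Delta^2u-k^4u=S$ in $\mathbb R^2$. Then the Dirichlet boundary measurements $u|_{\Gamma_R}$ and $\Delta u|_{\Gamma_R}$ at the single wavenumber $k$ uniquely determine $S$. That is, if $S_1,S_2\in H(B_R)$ have radiating solutions $u_1,u_2$ (at the same wavenumber $k$) satisfying $u_1=u_2$ and $\Delta u_1=\Delta u_2$ on $\Gamma_R$, then $S_1=S_2$ in $L^2(B_R)$.
   Context: $B_R=\{x\in\mathbb R^2:|x|<R\}$ and $\Gamma_R=\partial B_R$. Functions are complex valued. Radiating solution: for a source $S\in L^2(\mathbb R^2)$ vanishing outside $B_R$, the radiating solution $u$ is the solution of $\Delta^2u-k^4u=S$ in $\mathbb R^2$ satisfying $$\lim_{r\to\infty}\sqrt r\,(\partial_ru-\mathrm i k u)=0,\qquad \lim_{r\to\infty}\sqrt r\,(\partial_r(\Delta u)-\mathrm i k\,\Delta u)=0$$ uniformly in all directions $\hat x=x/|x|$, $r=|x|$. It is given by $$u(x,k)=\int_{\mathbb R^2}G(x,y,k)S(y)\,\mathrm dy,\qquad G(x,y,k)=\frac{\mathrm i}{8k^2}\left(H_0^{(1)}(k|x-y|)-H_0^{(1)}(\mathrm i k|x-y|)\right),$$ where $H_0^{(1)}$ is the Hankel function of the first kind of order zero. Boundary values on $\Gamma_R$ are understood as traces. The space $H(B_R)$: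 a function $v\in H^2(B_R)$ is called a weak solution of $\Delta^2v-k^4v=0$ if $\int_{B_R}(\Delta v\,\Delta\varphi-k^4v\varphi)\,\mathrm dx=0$ for every $\varphi\in C_0^\infty(B_R)$. $\mathcal H(B_R)$ denotes the set of all such weak solutions, and $H(B_R)$ denotes the closure of $\mathcal H(B_R)$ in the $L^2(B_R)$ norm. (Both depend on the fixed $k$.) *)

theory Defs
  imports "HOL-Analysis.Analysis"
begin

text \<open>Functions on the plane stand for their classes modulo Lebesgue-null sets; every such class has a
  Borel representative, so integrals are taken over \<^term>\<open>lborel\<close>.\<close>

definition partial_deriv :: "2 \<Rightarrow> (real^2 \<Rightarrow> complex) \<Rightarrow> real^2 \<Rightarrow> complex" where
  "partial_deriv i f x = frechet_derivative f (at x) (axis i 1)"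

definition laplacian :: "(real^2 \<Rightarrow> complex) \<Rightarrow> real^2 \<Rightarrow> complex" where
  "laplacian f x = (\<Sum>i\<in>UNIV. partial_deriv i (partial_deriv i f) x)"

text \<open>Meaningful for open sets \<open>\<Omega>\<close> only.\<close>

primrec Ck_on :: "nat \<Rightarrow> (real^2) set \<Rightarrow> (real^2 \<Rightarrow> complex) \<Rightarrow> bool" where
  "Ck_on 0 \<Omega> f \<longleftrightarrow> continuous_on \<Omega> f"
| "Ck_on (Suc n) \<Omega> f \<longleftrightarrow> f differentiable_on \<Omega> \<and> (\<forall>i. Ck_on n \<Omega> (partial_deriv i f))"

definition smooth_on :: "(real^2) set \<Rightarrow> (real^2 \<Rightarrow> complex) \<Rightarrow> bool" where
  "smooth_on \<Omega> f \<longleftrightarrow> (\<forall>n. Ck_on n \<Omega> f)"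

definition test_functions :: "(real^2) set \<Rightarrow> (real^2 \<Rightarrow> complex) set" where
  "test_functions \<Omega> =
     {\<phi>. smooth_on UNIV \<phi> \<and> (\<exists>K. compact K \<and> K \<subseteq> \<Omega> \<and> (\<forall>x. x \<notin> K \<longrightarrow> \<phi> x = 0))}"

definition locally_integrable_on :: "(real^2) set \<Rightarrow> (real^2 \<Rightarrow> complex) \<Rightarrow> bool" where
  "locally_integrable_on \<Omega> f \<longleftrightarrow> (\<forall>K. compact K \<and> K \<subseteq> \<Omega> \<longrightarrow> set_integrable lborel K f)"

definition weak_partial :: "(real^2) set \<Rightarrow> 2 \<Rightarrow> (real^2 \<Rightarrow> complex) \<Rightarrow> (real^2 \<Rightarrow> complex) \<Rightarrow> bool" where
  "weak_partial \<Omega> i f g \<longleftrightarrow>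
     locally_integrable_on \<Omega> f \<and> locally_integrable_on \<Omega> g \<and>
     (\<forall>\<phi>\<in>test_functions \<Omega>.
        (LINT x:\<Omega>|lborel. f x * partial_deriv i \<phi> x) = - (LINT x:\<Omega>|lborel. g x * \<phi> x))"

definition weak_laplacian :: "(real^2) set \<Rightarrow> (real^2 \<Rightarrow> complex) \<Rightarrow> (real^2 \<Rightarrow> complex) \<Rightarrow> bool" where
  "weak_laplacian \<Omega> f g \<longleftrightarrow>
     locally_integrable_on \<Omega> f \<and> locally_integrable_on \<Omega> g \<and>
     (\<forall>\<phi>\<in>test_functions \<Omega>.
        (LINT x:\<Omega>|lborel. f x * laplacian \<phi> x) = (LINT x:\<Omega>|lborel. g x * \<phi> x))"

definition L2_on :: "(real^2) set \<Rightarrow> (real^2 \<Rightarrow> complex) \<Rightarrow> bool" where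
  "L2_on \<Omega> f \<longleftrightarrow>
     set_borel_measurable lborel \<Omega> f \<and> set_integrable lborel \<Omega> (\<lambda>x. (cmod (f x))\<^sup>2)"

text \<open>A norm only on functions satisfying \<^const>\<open>L2_on\<close>: Bochner integrals of non-integrable functions
  are 0.\<close>

definition L2_norm_on :: "(real^2) set \<Rightarrow> (real^2 \<Rightarrow> complex) \<Rightarrow> real" where
  "L2_norm_on \<Omega> f = sqrt (LINT x:\<Omega>|lborel. (cmod (f x))\<^sup>2)"

text \<open>The space \<open>H\<^sup>m(\<Omega>)\<close>, \<open>m\<close> a natural number.\<close>

primrec sobolev :: "nat \<Rightarrow> (real^2) set \<Rightarrow> (real^2 \<Rightarrow> complex) \<Rightarrow> bool" where
  "sobolev 0 \<Omega> f \<longleftrightarrow> L2_on \<Omega> f"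
| "sobolev (Suc m) \<Omega> f \<longleftrightarrow> L2_on \<Omega> f \<and> (\<forall>i. \<exists>g. weak_partial \<Omega> i f g \<and> sobolev m \<Omega> g)"

text \<open>\<open>has_trace R f g\<close>: the function \<open>g\<close> (only its values on the circle of radius \<open>R\<close> matter) is the
  image of \<open>f \<in> H\<^sup>1(B\<^sub>R)\<close> under the trace operator, i.e. under the continuous extension of
  restriction to the circle from functions smooth up to the boundary to all of \<open>H\<^sup>1(B\<^sub>R)\<close>.
  The arc length element is \<open>R dt\<close>; the constant factor \<open>R\<close> is irrelevant for convergence.\<close>

definition circle_pt :: "real \<Rightarrow> real \<Rightarrow> real^2" where
  "circle_pt R t = vector [R * cos t, R * sin t]"

definition has_trace :: "real \<Rightarrow> (real^2 \<Rightarrow> complex) \<Rightarrow> (real^2 \<Rightarrow> complex) \<Rightarrow> bool" where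
  "has_trace R f g \<longleftrightarrow>
     sobolev 1 (ball 0 R) f \<and>
     set_borel_measurable lborel {0..2*pi} (\<lambda>t. g (circle_pt R t)) \<and>
     set_integrable lborel {0..2*pi} (\<lambda>t. (cmod (g (circle_pt R t)))\<^sup>2) \<and>
     (\<exists>\<phi>. (\<forall>j. smooth_on UNIV (\<phi> j)) \<and>
        (\<lambda>j. L2_norm_on (ball 0 R) (\<lambda>x. \<phi> j x - f x)) \<longlonglongrightarrow> 0 \<and>
        (\<forall>i. \<exists>d. weak_partial (ball 0 R) i f d \<and> L2_on (ball 0 R) d \<and>
           (\<lambda>j. L2_norm_on (ball 0 R) (\<lambda>x. partial_deriv i (\<phi> j) x - d x)) \<longlonglongrightarrow> 0) \<and>
        (\<lambda>j. LINT t:{0..2*pi}|lborel. (cmod (\<phi> j (circle_pt R t) - g (circle_pt R t)))\<^sup>2) \<longlonglongrightarrow> 0)"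

text \<open>Measurements on the circle of radius \<open>R\<close>: \<open>u\<close> has trace \<open>f\<close> and \<open>\<Delta>u\<close> has trace \<open>g\<close>.\<close>

definition dirichlet_data ::
    "real \<Rightarrow> (real^2 \<Rightarrow> complex) \<Rightarrow> (real^2 \<Rightarrow> complex) \<Rightarrow> (real^2 \<Rightarrow> complex) \<Rightarrow> bool" where
  "dirichlet_data R u f g \<longleftrightarrow>
     has_trace R u f \<and> (\<exists>w. weak_laplacian UNIV u w \<and> has_trace R w g)"

text \<open>The set of weak solutions \<open>v \<in> H\<^sup>2(B\<^sub>R)\<close> of \<open>\<Delta>\<^sup>2 v - k\<^sup>4 v = 0\<close>, and its \<open>L\<^sup>2\<close>-closure.\<close>

definition weak_solutions :: "real \<Rightarrow> real \<Rightarrow> (real^2 \<Rightarrow> complex) set" where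
  "weak_solutions k R =
     {v. sobolev 2 (ball 0 R) v \<and>
         (\<exists>w. weak_laplacian (ball 0 R) v w \<and>
            (\<forall>\<phi>\<in>test_functions (ball 0 R).
               (LINT x:ball 0 R|lborel. w x * laplacian \<phi> x - of_real (k^4) * v x * \<phi> x) = 0))}"

definition source_space :: "real \<Rightarrow> real \<Rightarrow> (real^2 \<Rightarrow> complex) set" where
  "source_space k R =
     {S. L2_on (ball 0 R) S \<and>
         (\<forall>\<epsilon>>0. \<exists>v\<in>weak_solutions k R. L2_norm_on (ball 0 R) (\<lambda>x. S x - v x) < \<epsilon>)}"

definition zero_extension :: "(real^2) set \<Rightarrow> (real^2 \<Rightarrow> complex) \<Rightarrow> real^2 \<Rightarrow> complex" where
  "zero_extension \<Omega> S x = (if x \<in> \<Omega> then S x else 0)"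

text \<open>Both radiation conditions have the form
  \<open>\<surd>r (\<partial>\<^sub>r f - \<i> k f) \<longlonglongrightarrow> 0\<close> for \<open>r \<longlonglongrightarrow> \<infinity>\<close>, uniformly in the direction.\<close>

definition sommerfeld :: "real \<Rightarrow> (real^2 \<Rightarrow> complex) \<Rightarrow> bool" where
  "sommerfeld k f \<longleftrightarrow>
     uniform_limit (sphere 0 1)
       (\<lambda>r e. of_real (sqrt r) *
          (vector_derivative (\<lambda>s. f (s *\<^sub>R e)) (at r) - \<i> * of_real k * f (r *\<^sub>R e)))
       (\<lambda>e. 0) at_top"

text \<open>For a source \<open>S\<close> in \<open>L\<^sup>2\<close> vanishing outside \<open>B\<^sub>R\<close>, the solution is taken in
  \<open>H\<^sup>4\<close> locally, with the equation holding almost everywhere. Outside the closed ball the equation is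
  homogeneous, so by elliptic regularity the class of \<open>u\<close> has a smooth representative there; \<open>u\<close> is
  required to be that representative, which gives the pointwise radiation conditions their meaning.\<close>

definition radiating_solution ::
    "real \<Rightarrow> real \<Rightarrow> (real^2 \<Rightarrow> complex) \<Rightarrow> (real^2 \<Rightarrow> complex) \<Rightarrow> bool" where
  "radiating_solution k R S u \<longleftrightarrow>
     (\<forall>\<rho>>0. sobolev 4 (ball 0 \<rho>) u) \<and>
     (\<exists>w z. weak_laplacian UNIV u w \<and> weak_laplacian UNIV w z \<and>
        (AE x in lborel. z x - of_real (k^4) * u x = S x)) \<and>
     smooth_on {x. R < norm x} u \<and>
     sommerfeld k u \<and> sommerfeld k (laplacian u)"

end

theory Submission
  imports Defs
begin

text \<open>
  Write \<open>S\<close> and \<open>u\<close> for the differences of the two sources and of the two radiating solutions. Outside the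
  ball, each angular Fourier mode of \<open>\<Delta>u - k\<^sup>2 u\<close> and of \<open>\<Delta>u + k\<^sup>2 u\<close> solves a (modified) Bessel equation,
  vanishes on the circle because of the measurements, and inherits the radiation condition. The
  Wronskian shows that such a mode has vanishing energy flux, so the radiation condition becomes decay of
  \<open>r (|A'|\<^sup>2 + k\<^sup>2 |A|\<^sup>2)\<close>, and monotone energies force the mode to vanish; hence \<open>u = 0\<close> outside the ball.
  Mollifying slightly shrunken copies of \<open>u\<close> then gives test functions \<open>\<phi>\<close> in the ball for which
  \<open>\<Delta>\<^sup>2 \<phi> - k\<^sup>4 \<phi>\<close> approximates \<open>S\<close>. Being an \<open>L\<^sup>2\<close> limit of weak solutions, \<open>S\<close> is orthogonal to all these
  functions, hence to itself.
\<close>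

section \<open>Smooth functions on the plane\<close>

text \<open>Two obstacles shape the argument. The data are the traces of \<open>u\<close> and of its
  Laplacian; no normal derivative is measured, and a trace is an L2 limit taken from inside the
  ball. It is read off from outside as a limit of angular modes, which is possible because weak
  derivatives of \<open>u\<close> exist across the circle. There a mode tends to 0 while its
  derivative is merely bounded, and this is enough for the Wronskian to vanish. The operator factors
  as (\<Delta> - k^2)(\<Delta> + k^2); each factor is treated with its own real energy, under the
  same radiation condition.

  The second obstacle is that a source in the closure has no boundary values, so Green's formula on
  the ball cannot be applied to it. It can only be paired with compactly supported functions, hence
  the shrinking. The Laplacians are moved onto the mollifying kernel and from there onto the weak
  Laplacians of \<open>u\<close>, so that only L2 pairings of the source with mollifications of
  \<open>u\<close> and of its bilaplacian have to converge. These pairings are bilinear, so the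
  conjugate of the source is used; the operator has real coefficients, so orthogonality passes to
  the conjugate.\<close>

lemma partial_deriv_eqI:
  assumes "(f has_derivative D) (at x)"
  shows "partial_deriv i f x = D (axis i 1)"
  using frechet_derivative_at[OF assms] by (simp add: partial_deriv_def)

lemma partial_deriv_cong:
  assumes "open \<Omega>" "x \<in> \<Omega>" "\<And>y. y \<in> \<Omega> \<Longrightarrow> f y = g y"
  shows "partial_deriv i f x = partial_deriv i g x"
proof -
  \<comment> \<open>\<open>frechet_derivative\<close> is a choice among all derivatives, so the two
    functions must share every derivative at \<open>x\<close>; this also settles points where
    neither is differentiable.\<close>
  have "(f has_derivative D) (at x) \<longleftrightarrow> (g has_derivative D) (at x)" for D
    using assms has_derivative_transform_within_open[of f D x UNIV \<Omega> g]
      has_derivative_transform_within_open[of g D x UNIV \<Omega> f] by auto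
  then show ?thesis
    by (simp add: partial_deriv_def frechet_derivative_def)
qed

lemma Ck_on_cong:
  assumes "open \<Omega>" "\<And>y. y \<in> \<Omega> \<Longrightarrow> f y = g y"
  shows "Ck_on n \<Omega> f \<longleftrightarrow> Ck_on n \<Omega> g"
  using assms(2)
proof (induction n arbitrary: f g)
  case 0
  then show ?case by (auto cong: continuous_on_cong)
next
  case (Suc n)
  have "Ck_on n \<Omega> (partial_deriv i f) \<longleftrightarrow> Ck_on n \<Omega> (partial_deriv i g)" for i
    by (intro Suc.IH partial_deriv_cong[OF assms(1)] Suc.prems)
  moreover have "f differentiable_on \<Omega> \<longleftrightarrow> g differentiable_on \<Omega>"
    using Suc.prems differentiable_on_def differentiable_transform_within[of f _ \<Omega> 1 g]
      differentiable_transform_within[of g _ \<Omega> 1 f] by (metis zero_less_one)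
  ultimately show ?case by simp
qed

lemma Ck_on_SucD: "Ck_on (Suc n) \<Omega> f \<Longrightarrow> Ck_on n \<Omega> f"
  by (induction n arbitrary: f) (auto intro: differentiable_imp_continuous_on)

lemma Ck_on_subset:
  assumes "open \<Omega>'" "\<Omega>' \<subseteq> \<Omega>" "Ck_on n \<Omega> f"
  shows "Ck_on n \<Omega>' f"
  using assms(3)
  by (induction n arbitrary: f)
     (auto intro: continuous_on_subset[OF _ assms(2)] differentiable_on_subset[OF _ assms(2)])

lemma Ck_on_Un:
  assumes "open A" "open B" "Ck_on n A f" "Ck_on n B f"
  shows "Ck_on n (A \<union> B) f"
  using assms(3,4)
proof (induction n arbitrary: f)
  case 0
  then show ?case by (simp add: continuous_on_open_Un assms(1,2))
next
  case (Suc n)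
  then show ?case
    using assms(1,2)
    by (auto simp: differentiable_on_eq_differentiable_at open_Un)
qed

lemma Ck_on_const [simp]: "Ck_on n \<Omega> (\<lambda>x. c)"
proof (induction n arbitrary: c)
  case (Suc n)
  have "partial_deriv i (\<lambda>x. c) = (\<lambda>x. 0)" for i
    by (rule ext, rule partial_deriv_eqI[THEN trans]) (auto intro!: derivative_eq_intros)
  then show ?case using Suc by simp
qed simp

lemma partial_deriv_add:
  assumes "f differentiable at x" "g differentiable at x"
  shows "partial_deriv i (\<lambda>x. f x + g x) x = partial_deriv i f x + partial_deriv i g x"
proof -
  obtain F G where F: "(f has_derivative F) (at x)" and G: "(g has_derivative G) (at x)"
    using assms by (auto simp: differentiable_def)
  from partial_deriv_eqI[OF has_derivative_add[OF F G]] show ?thesis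
    by (simp add: partial_deriv_eqI[OF F] partial_deriv_eqI[OF G])
qed

lemma partial_deriv_mult:
  assumes "f differentiable at x" "g differentiable at x"
  shows "partial_deriv i (\<lambda>x. f x * g x) x = partial_deriv i f x * g x + f x * partial_deriv i g x"
proof -
  obtain F G where F: "(f has_derivative F) (at x)" and G: "(g has_derivative G) (at x)"
    using assms by (auto simp: differentiable_def)
  from partial_deriv_eqI[OF has_derivative_mult[OF F G]] show ?thesis
    by (simp add: partial_deriv_eqI[OF F] partial_deriv_eqI[OF G])
qed

lemma partial_deriv_linear_compose:
  assumes "bounded_linear L" "f differentiable at x"
  shows "partial_deriv i (\<lambda>x. L (f x)) x = L (partial_deriv i f x)"
proof -
  obtain F where F: "(f has_derivative F) (at x)" 
    using assms by (auto simp: differentiable_def)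
  from partial_deriv_eqI[OF bounded_linear.has_derivative[OF assms(1) F]] show ?thesis
    by (simp add: partial_deriv_eqI[OF F])
qed

lemma partial_deriv_affine:
  assumes "f differentiable at (a + c *\<^sub>R x)"
  shows "partial_deriv i (\<lambda>x. f (a + c *\<^sub>R x)) x = of_real c * partial_deriv i f (a + c *\<^sub>R x)"
proof -
  obtain F where F: "(f has_derivative F) (at (a + c *\<^sub>R x))" 
    using assms by (auto simp: differentiable_def)
  have "((\<lambda>x. f (a + c *\<^sub>R x)) has_derivative (\<lambda>h. F (c *\<^sub>R h))) (at x)"
    using F by (auto intro!: has_derivative_compose[of "\<lambda>x. a + c *\<^sub>R x" "\<lambda>h. c *\<^sub>R h" x UNIV f F] derivative_eq_intros)
  from partial_deriv_eqI[OF this] show ?thesis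
    using linear_cmul[OF has_derivative_linear[OF F]] by (simp add: partial_deriv_eqI[OF F] scaleR_conv_of_real[where 'a=complex])
qed

lemma Ck_on_add:
  assumes "open \<Omega>" "Ck_on n \<Omega> f" "Ck_on n \<Omega> g"
  shows "Ck_on n \<Omega> (\<lambda>x. f x + g x)"
  using assms(2,3)
proof (induction n arbitrary: f g)
  case (Suc n)
  have d: "f differentiable at x" "g differentiable at x" if "x \<in> \<Omega>" for x
    using Suc.prems that assms(1) by (auto simp: differentiable_on_eq_differentiable_at)
  have "Ck_on n \<Omega> (partial_deriv i (\<lambda>x. f x + g x))" for i
    using Suc.IH[of "partial_deriv i f" "partial_deriv i g"] Suc.prems
    by (subst Ck_on_cong[OF assms(1) partial_deriv_add[OF d]]) auto
  then show ?case using Suc.prems by auto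
qed (auto intro: continuous_intros)

lemma Ck_on_mult:
  assumes "open \<Omega>" "Ck_on n \<Omega> f" "Ck_on n \<Omega> g"
  shows "Ck_on n \<Omega> (\<lambda>x. f x * g x)"
  using assms(2,3)
proof (induction n arbitrary: f g)
  case (Suc n)
  have d: "f differentiable at x" "g differentiable at x" if "x \<in> \<Omega>" for x
    using Suc.prems that assms(1) by (auto simp: differentiable_on_eq_differentiable_at)
  have "Ck_on n \<Omega> f" "Ck_on n \<Omega> g" using Suc.prems Ck_on_SucD by blast+
  then have "Ck_on n \<Omega> (partial_deriv i (\<lambda>x. f x * g x))" for i
    using Suc.IH Suc.prems
    by (subst Ck_on_cong[OF assms(1) partial_deriv_mult[OF d]]) (auto intro!: Ck_on_add assms(1))
  moreover have "(\<lambda>x. f x * g x) differentiable_on \<Omega>"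
    using Suc.prems by auto
  ultimately show ?case by simp
qed (auto intro: continuous_intros)

lemma Ck_on_linear_compose:
  assumes "open \<Omega>" "bounded_linear L" "Ck_on n \<Omega> f"
  shows "Ck_on n \<Omega> (\<lambda>x. L (f x))"
  using assms(3)
proof (induction n arbitrary: f)
  case 0
  then show ?case by (simp add: bounded_linear.continuous_on[OF assms(2)])
next
  case (Suc n)
  have d: "f differentiable at x" if "x \<in> \<Omega>" for x
    using Suc.prems that assms(1) by (auto simp: differentiable_on_eq_differentiable_at)
  have "Ck_on n \<Omega> (partial_deriv i (\<lambda>x. L (f x)))" for i
    using Suc.IH[of "partial_deriv i f"] Suc.prems
    by (subst Ck_on_cong[OF assms(1) partial_deriv_linear_compose[OF assms(2) d]]) auto
  moreover have "(\<lambda>x. L (f x)) differentiable_on \<Omega>"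
    using Suc.prems bounded_linear.has_derivative[OF assms(2)]
    unfolding differentiable_on_def differentiable_def Ck_on.simps by blast
  ultimately show ?case by simp
qed

lemma Ck_on_affine_compose:
  assumes "Ck_on n UNIV f"
  shows "Ck_on n UNIV (\<lambda>x. f (a + c *\<^sub>R x))"
  using assms
proof (induction n arbitrary: f)
  case 0
  then show ?case
    by (auto intro!: continuous_on_compose2[of UNIV f] continuous_intros)
next
  case (Suc n)
  have d: "f differentiable at x" for x
    using Suc.prems by (auto simp: differentiable_on_def)
  have "Ck_on n UNIV (partial_deriv i (\<lambda>x. f (a + c *\<^sub>R x)))" for i
    using Ck_on_mult[OF open_UNIV Ck_on_const Suc.IH[of "partial_deriv i f"]] Suc.prems
    by (subst Ck_on_cong[OF open_UNIV partial_deriv_affine[OF d]]) simp_all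
  moreover have "(\<lambda>x. f (a + c *\<^sub>R x)) differentiable_on UNIV"
    by (rule differentiable_at_imp_differentiable_on, rule differentiable_compose[of f], rule d) simp
  ultimately show ?case by simp
qed

lemma Ck_on_coordinate: "Ck_on n \<Omega> (\<lambda>x. of_real (x $ j))"
proof (cases n)
  case (Suc m)
  have h: "((\<lambda>x::real^2. complex_of_real (x $ j)) has_derivative (\<lambda>h. of_real (h $ j))) (at x)" for x
    by (intro bounded_linear_imp_has_derivative bounded_linear_compose[OF bounded_linear_of_real]
          bounded_linear_vec_nth)
  have "partial_deriv i (\<lambda>x. of_real (x $ j)) = (\<lambda>x. of_real (axis i 1 $ j))" for i
    by (rule ext, rule partial_deriv_eqI[OF h])
  moreover have "(\<lambda>x::real^2. complex_of_real (x $ j)) differentiable_on \<Omega>"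
    using h by (meson differentiable_at_imp_differentiable_on differentiable_def)
  ultimately show ?thesis using Suc by simp
qed (auto intro!: continuous_intros)

lemma smooth_on_partial_deriv: "smooth_on \<Omega> f \<Longrightarrow> smooth_on \<Omega> (partial_deriv i f)"
  unfolding smooth_on_def using Ck_on.simps(2) by blast

lemma smooth_on_differentiable: "smooth_on \<Omega> f \<Longrightarrow> open \<Omega> \<Longrightarrow> x \<in> \<Omega> \<Longrightarrow> f differentiable at x"
  unfolding smooth_on_def using Ck_on.simps(2)[of 0 \<Omega> f] differentiable_on_eq_differentiable_at[of \<Omega> f] by blast

lemma smooth_on_continuous_on: "smooth_on \<Omega> f \<Longrightarrow> continuous_on \<Omega> f"
  unfolding smooth_on_def using Ck_on.simps(1) by blast

lemma smooth_on_cong: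
  "open \<Omega> \<Longrightarrow> (\<And>y. y \<in> \<Omega> \<Longrightarrow> f y = g y) \<Longrightarrow> smooth_on \<Omega> f \<longleftrightarrow> smooth_on \<Omega> g"
  unfolding smooth_on_def using Ck_on_cong by blast

lemma smooth_on_subset: "smooth_on \<Omega> f \<Longrightarrow> open \<Omega>' \<Longrightarrow> \<Omega>' \<subseteq> \<Omega> \<Longrightarrow> smooth_on \<Omega>' f"
  unfolding smooth_on_def using Ck_on_subset by blast

lemma smooth_on_Un: "open A \<Longrightarrow> open B \<Longrightarrow> smooth_on A f \<Longrightarrow> smooth_on B f \<Longrightarrow> smooth_on (A \<union> B) f"
  unfolding smooth_on_def using Ck_on_Un by blast

lemma smooth_on_const [simp]: "smooth_on \<Omega> (\<lambda>x. c)"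
  by (simp add: smooth_on_def)

lemma smooth_on_coordinate [simp]: "smooth_on \<Omega> (\<lambda>x. of_real (x $ j))"
  by (simp add: smooth_on_def Ck_on_coordinate)

lemma smooth_on_add:
  "open \<Omega> \<Longrightarrow> smooth_on \<Omega> f \<Longrightarrow> smooth_on \<Omega> g \<Longrightarrow> smooth_on \<Omega> (\<lambda>x. f x + g x)"
  by (simp add: smooth_on_def Ck_on_add)

lemma smooth_on_mult:
  "open \<Omega> \<Longrightarrow> smooth_on \<Omega> f \<Longrightarrow> smooth_on \<Omega> g \<Longrightarrow> smooth_on \<Omega> (\<lambda>x. f x * g x)"
  by (simp add: smooth_on_def Ck_on_mult)

lemma smooth_on_diff:
  assumes "open \<Omega>" "smooth_on \<Omega> f" "smooth_on \<Omega> g"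
  shows "smooth_on \<Omega> (\<lambda>x. f x - g x)"
  using smooth_on_add[OF assms(1,2) smooth_on_mult[OF assms(1) smooth_on_const[of _ "-1"] assms(3)]] by simp

lemma smooth_on_power: "open \<Omega> \<Longrightarrow> smooth_on \<Omega> f \<Longrightarrow> smooth_on \<Omega> (\<lambda>x. f x ^ n)"
  by (induction n) (auto intro: smooth_on_mult)

lemma smooth_on_sum:
  "open \<Omega> \<Longrightarrow> (\<And>i. i \<in> I \<Longrightarrow> smooth_on \<Omega> (f i)) \<Longrightarrow> smooth_on \<Omega> (\<lambda>x. \<Sum>i\<in>I. f i x)"
  by (induction I rule: infinite_finite_induct) (auto intro: smooth_on_add)

lemma smooth_on_prod:
  "open \<Omega> \<Longrightarrow> (\<And>i. i \<in> I \<Longrightarrow> smooth_on \<Omega> (f i)) \<Longrightarrow> smooth_on \<Omega> (\<lambda>x. \<Prod>i\<in>I. f i x)"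
  by (induction I rule: infinite_finite_induct) (auto intro: smooth_on_mult)

lemma smooth_on_linear_compose:
  "open \<Omega> \<Longrightarrow> bounded_linear L \<Longrightarrow> smooth_on \<Omega> f \<Longrightarrow> smooth_on \<Omega> (\<lambda>x. L (f x))"
  by (simp add: smooth_on_def Ck_on_linear_compose)

lemma smooth_on_affine_compose: "smooth_on UNIV f \<Longrightarrow> smooth_on UNIV (\<lambda>x. f (a + c *\<^sub>R x))"
  by (simp add: smooth_on_def Ck_on_affine_compose)

lemma smooth_on_laplacian: "open \<Omega> \<Longrightarrow> smooth_on \<Omega> f \<Longrightarrow> smooth_on \<Omega> (laplacian f)"
  unfolding laplacian_def [abs_def] by (intro smooth_on_sum smooth_on_partial_deriv)

lemma smooth_on_has_derivative:
  assumes "smooth_on \<Omega> f" "open \<Omega>" "x \<in> \<Omega>"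
  shows "(f has_derivative (\<lambda>h. \<Sum>i\<in>UNIV. h $ i *\<^sub>R partial_deriv i f x)) (at x)"
proof -
  obtain F where F: "(f has_derivative F) (at x)"
    using smooth_on_differentiable[OF assms] by (auto simp: differentiable_def)
  have "F h = (\<Sum>i\<in>UNIV. h $ i *\<^sub>R partial_deriv i f x)" for h
  proof -
    have l: "linear F" using F has_derivative_linear by blast
    have "F h = F (\<Sum>i\<in>UNIV. h $ i *\<^sub>R axis i 1)"
      by (metis basis_expansion scalar_mult_eq_scaleR)
    also have "\<dots> = (\<Sum>i\<in>UNIV. h $ i *\<^sub>R F (axis i 1))"
      by (simp add: linear_sum[OF l] linear_cmul[OF l])
    finally show ?thesis by (simp add: partial_deriv_eqI[OF F])
  qed
  then have "F = (\<lambda>h. \<Sum>i\<in>UNIV. h $ i *\<^sub>R partial_deriv i f x)" by blast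
  with F show ?thesis by simp
qed

text \<open>The outer function is given as the whole chain \<open>E m\<close> of its derivatives.
  Differentiating \<open>E m (g x)\<close> yields \<open>E (Suc m) (g x)\<close> times a derivative
  of \<open>g\<close>, so the induction on the order closes with \<open>m\<close> arbitrary.\<close>

lemma smooth_on_compose_real:
  fixes E :: "nat \<Rightarrow> real \<Rightarrow> real" and g :: "real^2 \<Rightarrow> real"
  assumes "open \<Omega>" and E: "\<And>m t. (E m has_real_derivative E (Suc m) t) (at t)"
    and g: "smooth_on \<Omega> (\<lambda>x. of_real (g x))"
  shows "smooth_on \<Omega> (\<lambda>x. of_real (E m (g x)))"
proof -
  have "Ck_on n \<Omega> (\<lambda>x. of_real (E m (g x)))" for n
  proof (induction n arbitrary: m)
    case 0
    have "continuous_on \<Omega> (\<lambda>x. Re (of_real (g x)))"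
      by (intro continuous_intros smooth_on_continuous_on g)
    moreover have "continuous_on UNIV (E m)"
      using E by (meson DERIV_isCont continuous_at_imp_continuous_on)
    ultimately have "continuous_on \<Omega> (\<lambda>x. E m (g x))"
      using continuous_on_compose2[of UNIV "E m" \<Omega> g] by simp
    then show ?case by (simp add: continuous_on_of_real)
  next
    case (Suc n)
    have d: "((\<lambda>x. complex_of_real (E m (g x))) has_derivative
        (\<lambda>h. of_real (E (Suc m) (g x)) * (\<Sum>i\<in>UNIV. h $ i *\<^sub>R partial_deriv i (\<lambda>x. of_real (g x)) x))) (at x)"
      if "x \<in> \<Omega>" for x
    proof -
      let ?D = "\<lambda>h. \<Sum>i\<in>UNIV. h $ i *\<^sub>R partial_deriv i (\<lambda>x. of_real (g x)) x"
      have gd: "((\<lambda>x. complex_of_real (g x)) has_derivative ?D) (at x)"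
        by (rule smooth_on_has_derivative[OF g assms(1) that])
      have g1: "(g has_derivative (\<lambda>h. Re (?D h))) (at x)"
        using has_derivative_compose[OF gd bounded_linear_imp_has_derivative[OF bounded_linear_Re]] by simp
      have "((\<lambda>x. complex_of_real (g x)) has_derivative (\<lambda>h. of_real (Re (?D h)))) (at x)"
        using g1 by (rule has_derivative_of_real)
      \<comment> \<open>By uniqueness of the derivative, the gradient of the complexified
        \<open>g\<close> is real, so the real chain rule carries over.\<close>
      then have re: "?D = (\<lambda>h. of_real (Re (?D h)))"
        using gd has_derivative_unique by blast
      have "((\<lambda>x. E m (g x)) has_derivative (\<lambda>h. E (Suc m) (g x) * Re (?D h))) (at x)"
        using has_derivative_compose[OF g1 E[unfolded has_field_derivative_def]] .
      from has_derivative_of_real[OF this, where 'a=complex]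
      have "((\<lambda>x. complex_of_real (E m (g x))) has_derivative
        (\<lambda>h. of_real (E (Suc m) (g x)) * of_real (Re (?D h)))) (at x)" by simp
      then show ?thesis using re by metis
    qed
    have "partial_deriv i (\<lambda>x. of_real (E m (g x))) x =
        of_real (E (Suc m) (g x)) * partial_deriv i (\<lambda>x. of_real (g x)) x" if "x \<in> \<Omega>" for i x
      unfolding partial_deriv_eqI[OF d[OF that]] by (simp add: axis_def if_distrib[of "\<lambda>c. c *\<^sub>R _"] cong: if_cong)
    then have "Ck_on n \<Omega> (partial_deriv i (\<lambda>x. of_real (E m (g x)))) \<longleftrightarrow>
        Ck_on n \<Omega> (\<lambda>x. of_real (E (Suc m) (g x)) * partial_deriv i (\<lambda>x. of_real (g x)) x)" for i
      by (rule Ck_on_cong[OF assms(1)])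
    moreover have "Ck_on n \<Omega> (\<lambda>x. of_real (E (Suc m) (g x)) * partial_deriv i (\<lambda>x. of_real (g x)) x)" for i
      using smooth_on_partial_deriv[OF g, of i] unfolding smooth_on_def
      by (intro Ck_on_mult assms(1) Suc.IH) simp
    moreover have "(\<lambda>x. complex_of_real (E m (g x))) differentiable_on \<Omega>"
      using d assms(1) by (auto simp: differentiable_on_eq_differentiable_at differentiable_def)
    ultimately show ?case unfolding Ck_on.simps by blast
  qed
  then show ?thesis by (simp add: smooth_on_def)
qed

section \<open>Test functions\<close>

text \<open>With x = 1 / t, the t-derivative of P(x) exp(-x) is x^2 (P(x) - P'(x)) exp(-x). Hence
  \<open>bump_deriv m\<close> is the m-th derivative of exp(-1 / t), extended by 0.\<close>

fun bump_poly :: "nat \<Rightarrow> real poly" where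
  "bump_poly 0 = 1"
| "bump_poly (Suc m) = [:0, 0, 1:] * (bump_poly m - pderiv (bump_poly m))"

definition bump_deriv :: "nat \<Rightarrow> real \<Rightarrow> real" where
  "bump_deriv m t = (if t > 0 then poly (bump_poly m) (1 / t) * exp (- (1 / t)) else 0)"

text \<open>The extra power \<open>x ^ k\<close> absorbs the factor x that \<open>pCons\<close> puts
  in front of the tail, which keeps the induction over the coefficients going.\<close>

lemma poly_exp_tendsto_0:
  fixes p :: "real poly"
  shows "((\<lambda>x. x ^ k * poly p x / exp x) \<longlongrightarrow> 0) at_top"
proof (induction p arbitrary: k)
  case (pCons a p)
  have "((\<lambda>x. a * (x ^ k / exp x) + x ^ Suc k * poly p x / exp x) \<longlongrightarrow> a * 0 + 0) at_top"
    by (intro tendsto_intros tendsto_power_div_exp_0 pCons.IH)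
  then show ?case
    by (simp add: field_simps)
qed simp

lemma bump_deriv_has_derivative: "(bump_deriv m has_real_derivative bump_deriv (Suc m) t) (at t)"
proof -
  consider "t > 0" | "t < 0" | "t = 0" by linarith
  then show ?thesis
  proof cases
    case 1
    have "((\<lambda>t. poly (bump_poly m) (1 / t) * exp (- (1 / t))) has_real_derivative bump_deriv (Suc m) t) (at t)"
      using 1 by (auto intro!: derivative_eq_intros DERIV_chain2[OF poly_DERIV] 
          simp: bump_deriv_def field_simps power2_eq_square)
    then show ?thesis
      by (rule has_field_derivative_transform_within_open[where S="{0<..}"])
         (use 1 in \<open>auto simp: bump_deriv_def\<close>)
  next
    case 2
    have "((\<lambda>t. 0) has_real_derivative bump_deriv (Suc m) t) (at t)"
      using 2 by (simp add: bump_deriv_def)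
    then show ?thesis
      by (rule has_field_derivative_transform_within_open[where S="{..<0}"])
         (use 2 in \<open>auto simp: bump_deriv_def\<close>)
  next
    case 3
    \<comment> \<open>With x = 1 / h the difference quotient at 0 from the right is a polynomial in
      x divided by exp(x); from the left it is 0.\<close>
    have "((\<lambda>h. bump_deriv m h / h) \<longlongrightarrow> 0) (at_right 0)"
    proof (rule Lim_transform_eventually)
      show "((\<lambda>h. inverse h ^ 1 * poly (bump_poly m) (inverse h) / exp (inverse h)) \<longlongrightarrow> 0) (at_right 0)"
        by (rule filterlim_compose[OF poly_exp_tendsto_0 filterlim_inverse_at_top_right])
      show "\<forall>\<^sub>F h in at_right 0. inverse h ^ 1 * poly (bump_poly m) (inverse h) / exp (inverse h)
          = bump_deriv m h / h"
        by (rule eventually_at_right_less[THEN eventually_mono])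
           (auto simp: bump_deriv_def exp_minus field_simps)
    qed
    moreover have "((\<lambda>h. bump_deriv m h / h) \<longlongrightarrow> 0) (at_left 0)"
      by (rule Lim_transform_eventually[OF tendsto_const])
         (auto simp: eventually_at_filter bump_deriv_def)
    ultimately have "((\<lambda>h. bump_deriv m h / h) \<longlongrightarrow> 0) (at 0)"
      by (simp add: filterlim_split_at_real)
    then show ?thesis
      using 3 by (simp add: DERIV_def bump_deriv_def)
  qed
qed

abbreviation bump :: "real \<Rightarrow> real" where
  "bump \<equiv> bump_deriv 0"

lemma bump_eq: "bump t = (if t > 0 then exp (- (1 / t)) else 0)"
  by (simp add: bump_deriv_def)

lemma bump_nonneg [simp]: "bump t \<ge> 0" and bump_le_1 [simp]: "bump t \<le> 1" and bump_pos_iff: "bump t > 0 \<longleftrightarrow> t > 0"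
  by (simp_all add: bump_eq)

lemma smooth_on_bump:
  "open \<Omega> \<Longrightarrow> smooth_on \<Omega> (\<lambda>x. of_real (g x)) \<Longrightarrow> smooth_on \<Omega> (\<lambda>x. of_real (bump (g x)))"
  by (rule smooth_on_compose_real[where E=bump_deriv, OF _ bump_deriv_has_derivative])

text \<open>Dilation sharpens the bump to the indicator of the positive half line; in this way test
  functions reach indicators of boxes.\<close>

lemma bump_tendsto: "(\<lambda>j. bump (real j * t)) \<longlonglongrightarrow> (if t > 0 then 1 else 0)"
proof (cases "t > 0")
  case True
  have "(\<lambda>j. exp (- (1 / t) * (1 / real j))) \<longlonglongrightarrow> exp (- (1 / t) * 0)"
    by (intro tendsto_intros lim_1_over_n)
  then have "(\<lambda>j. exp (- (1 / t) * (1 / real j))) \<longlonglongrightarrow> 1" by simp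
  then have "(\<lambda>j. bump (real j * t)) \<longlonglongrightarrow> 1"
    by (rule Lim_transform_eventually)
       (use True in \<open>auto simp: bump_eq eventually_sequentially intro!: exI[of _ 1]\<close>)
  with True show ?thesis by simp
next
  case False
  then have "bump (real j * t) = 0" for j
    by (simp add: bump_eq mult_le_0_iff not_less zero_less_mult_iff)
  with False show ?thesis by simp
qed

text \<open>The parameter \<open>s\<close> is a steepness: as it grows, the function tends to the
  indicator of the open box while its support stays in the closed one.\<close>

definition box_bump :: "real^2 \<Rightarrow> real^2 \<Rightarrow> real \<Rightarrow> real^2 \<Rightarrow> real" where
  "box_bump a b s x = (\<Prod>i\<in>UNIV. bump (s * (x $ i - a $ i)) * bump (s * (b $ i - x $ i)))"

lemma smooth_on_box_bump: "smooth_on UNIV (\<lambda>x. of_real (box_bump a b s x))"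
proof -
  have 1: "smooth_on UNIV (\<lambda>x. complex_of_real (s * (x $ i - a $ i)))"
    "smooth_on UNIV (\<lambda>x. complex_of_real (s * (b $ i - x $ i)))" for i
    unfolding of_real_mult of_real_diff by (intro smooth_on_mult smooth_on_diff open_UNIV smooth_on_const smooth_on_coordinate)+
  show ?thesis
    unfolding box_bump_def of_real_prod of_real_mult
    by (intro smooth_on_prod smooth_on_mult[OF open_UNIV smooth_on_bump smooth_on_bump] open_UNIV 1)
qed

lemma box_bump_nonneg: "box_bump a b s x \<ge> 0" and box_bump_le_1: "box_bump a b s x \<le> 1"
  unfolding box_bump_def by (auto intro!: prod_nonneg prod_le_1 mult_le_one)

lemma box_bump_eq_0:
  assumes "s \<ge> 0" "x \<notin> box a b"
  shows "box_bump a b s x = 0"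
proof -
  obtain i where "x $ i - a $ i \<le> 0 \<or> b $ i - x $ i \<le> 0"
    using assms(2) by (auto simp: mem_box_cart not_less)
  then have "s * (x $ i - a $ i) \<le> 0 \<or> s * (b $ i - x $ i) \<le> 0"
    using assms(1) mult_nonneg_nonpos by blast
  then have "bump (s * (x $ i - a $ i)) * bump (s * (b $ i - x $ i)) = 0"
    unfolding bump_eq by auto
  then show ?thesis
    unfolding box_bump_def by (intro prod_zero) auto
qed

lemma box_bump_pos: "s > 0 \<Longrightarrow> x \<in> box a b \<Longrightarrow> box_bump a b s x > 0"
  by (auto simp: box_bump_def mem_box_cart bump_eq intro!: prod_pos)

lemma box_bump_tendsto: "(\<lambda>j. box_bump a b (real j) x) \<longlonglongrightarrow> indicator (box a b) x"
proof -
  have "(\<lambda>j. box_bump a b (real j) x) \<longlonglongrightarrow>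
     (\<Prod>i\<in>UNIV. (if x $ i - a $ i > 0 then 1 else 0) * (if b $ i - x $ i > 0 then 1 else 0))"
    unfolding box_bump_def by (intro tendsto_prod tendsto_mult bump_tendsto)
  also have "(\<Prod>i\<in>UNIV. (if x $ i - a $ i > 0 then 1 else 0) * (if b $ i - x $ i > 0 then 1 else 0))
    = (indicator (box a b) x :: real)"
    by (auto simp: indicator_def mem_box_cart)
  finally show ?thesis .
qed

lemma test_functionsI:
  "smooth_on UNIV \<phi> \<Longrightarrow> compact K \<Longrightarrow> K \<subseteq> \<Omega> \<Longrightarrow> (\<And>x. x \<notin> K \<Longrightarrow> \<phi> x = 0) \<Longrightarrow> \<phi> \<in> test_functions \<Omega>"
  by (auto simp: test_functions_def)

lemma test_functions_smooth: "\<phi> \<in> test_functions \<Omega> \<Longrightarrow> smooth_on UNIV \<phi>"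
  by (simp add: test_functions_def)

lemma test_functions_mono: "\<Omega> \<subseteq> \<Omega>' \<Longrightarrow> \<phi> \<in> test_functions \<Omega> \<Longrightarrow> \<phi> \<in> test_functions \<Omega>'"
  by (auto simp: test_functions_def)

lemma test_functions_outside: "\<phi> \<in> test_functions \<Omega> \<Longrightarrow> x \<notin> \<Omega> \<Longrightarrow> \<phi> x = 0"
  by (auto simp: test_functions_def)

lemma partial_deriv_zero_outside:
  assumes "closed K" "\<And>x. x \<notin> K \<Longrightarrow> \<phi> x = 0" "x \<notin> K"
  shows "partial_deriv i \<phi> x = 0"
proof -
  have "partial_deriv i \<phi> x = partial_deriv i (\<lambda>x. 0) x"
    by (rule partial_deriv_cong[of "- K"]) (use assms in auto)
  also have "\<dots> = 0"
    by (rule partial_deriv_eqI[THEN trans, OF has_derivative_const]) simp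
  finally show ?thesis .
qed

lemma test_functions_partial_deriv:
  assumes "\<phi> \<in> test_functions \<Omega>"
  shows "partial_deriv i \<phi> \<in> test_functions \<Omega>"
proof -
  obtain K where K: "smooth_on UNIV \<phi>" "compact K" "K \<subseteq> \<Omega>" "\<And>x. x \<notin> K \<Longrightarrow> \<phi> x = 0"
    using assms(1) unfolding test_functions_def by blast
  show ?thesis
    using partial_deriv_zero_outside[OF compact_imp_closed[OF K(2)] K(4)]
    by (intro test_functionsI[of _ K] smooth_on_partial_deriv K)
qed

lemma test_functions_add:
  assumes "\<phi> \<in> test_functions \<Omega>" "\<psi> \<in> test_functions \<Omega>"
  shows "(\<lambda>x. \<phi> x + \<psi> x) \<in> test_functions \<Omega>"
proof -
  obtain K where K: "smooth_on UNIV \<phi>" "compact K" "K \<subseteq> \<Omega>" "\<And>x. x \<notin> K \<Longrightarrow> \<phi> x = 0"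
    using assms(1) unfolding test_functions_def by blast
  obtain L where L: "smooth_on UNIV \<psi>" "compact L" "L \<subseteq> \<Omega>" "\<And>x. x \<notin> L \<Longrightarrow> \<psi> x = 0"
    using assms(2) unfolding test_functions_def by blast
  show ?thesis
  proof (rule test_functionsI[of _ "K \<union> L"])
    show "smooth_on UNIV (\<lambda>x. \<phi> x + \<psi> x)" by (intro smooth_on_add open_UNIV K L)
  qed (use K L in auto)
qed

lemma test_functions_linear_compose:
  assumes "bounded_linear L" "\<phi> \<in> test_functions \<Omega>"
  shows "(\<lambda>x. L (\<phi> x)) \<in> test_functions \<Omega>"
proof -
  obtain K where K: "smooth_on UNIV \<phi>" "compact K" "K \<subseteq> \<Omega>" "\<And>x. x \<notin> K \<Longrightarrow> \<phi> x = 0"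
    using assms(2) unfolding test_functions_def by blast
  show ?thesis
    by (rule test_functionsI[of _ K, OF smooth_on_linear_compose[OF open_UNIV assms(1) K(1)] K(2,3)])
       (simp add: K(4) linear_0[OF bounded_linear.linear[OF assms(1)]])
qed

lemma test_functions_sum:
  "(\<And>i. i \<in> I \<Longrightarrow> \<phi> i \<in> test_functions \<Omega>) \<Longrightarrow> (\<lambda>x. \<Sum>i\<in>I. \<phi> i x) \<in> test_functions \<Omega>"
  by (induction I rule: infinite_finite_induct) 
     (auto intro: test_functions_add intro: test_functionsI[of _ "{}"])

lemma test_functions_laplacian: "\<phi> \<in> test_functions \<Omega> \<Longrightarrow> laplacian \<phi> \<in> test_functions \<Omega>"
  unfolding laplacian_def [abs_def]
  by (intro test_functions_sum test_functions_partial_deriv)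

text \<open>The factor \<open>f\<close> is uncontrolled off \<Omega>, but the product is 0 there: it
  is smooth on \<Omega> and on the complement of the support, two open sets that cover the
  plane.\<close>

lemma test_functions_mult:
  assumes "open \<Omega>" "smooth_on \<Omega> f" "\<phi> \<in> test_functions \<Omega>"
  shows "(\<lambda>x. f x * \<phi> x) \<in> test_functions \<Omega>"
proof -
  obtain K where K: "smooth_on UNIV \<phi>" "compact K" "K \<subseteq> \<Omega>" "\<And>x. x \<notin> K \<Longrightarrow> \<phi> x = 0"
    using assms(3) unfolding test_functions_def by blast
  have o: "open (- K)" using K(2) by (simp add: compact_imp_closed open_Compl)
  have "smooth_on \<Omega> (\<lambda>x. f x * \<phi> x)"
    by (intro smooth_on_mult assms(1,2) smooth_on_subset[OF K(1)]) auto
  moreover have "smooth_on (- K) (\<lambda>x. f x * \<phi> x)"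
    using K(4) by (subst smooth_on_cong[OF o, of _ "\<lambda>x. 0"]) auto
  ultimately have "smooth_on (\<Omega> \<union> - K) (\<lambda>x. f x * \<phi> x)"
    by (rule smooth_on_Un[OF assms(1) o])
  moreover have "\<Omega> \<union> - K = UNIV" using K(3) by auto
  ultimately show ?thesis
    by (intro test_functionsI[of _ K]) (use K in auto)
qed

lemma box_bump_test:
  assumes "cbox a b \<subseteq> \<Omega>" "s \<ge> 0"
  shows "(\<lambda>x. of_real (box_bump a b s x)) \<in> test_functions \<Omega>"
proof (rule test_functionsI[OF smooth_on_box_bump compact_cbox assms(1)])
  fix x assume "x \<notin> cbox a b"
  then have "x \<notin> box a b" using box_subset_cbox by blast
  then show "of_real (box_bump a b s x) = (0::complex)"
    using box_bump_eq_0[OF assms(2)] by simp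
qed

section \<open>Integrals of test functions\<close>

lemma smooth_on_UNIV_borel_measurable: "smooth_on UNIV f \<Longrightarrow> f \<in> borel_measurable borel"
  by (intro borel_measurable_continuous_onI smooth_on_continuous_on)

lemma integrable_compact_support:
  fixes f :: "real^2 \<Rightarrow> complex"
  assumes "continuous_on UNIV f" "compact K" "\<And>x. x \<notin> K \<Longrightarrow> f x = 0"
  shows "integrable lborel f"
proof -
  have "integrable lborel (\<lambda>x. indicator K x *\<^sub>R f x)"
    using borel_integrable_compact[OF assms(2) continuous_on_subset[OF assms(1)]] by simp
  moreover have "(\<lambda>x. indicator K x *\<^sub>R f x) = f"
    using assms(3) by (auto simp: indicator_def)
  ultimately show ?thesis by simp
qed

lemma test_functions_integrable: "\<phi> \<in> test_functions \<Omega> \<Longrightarrow> integrable lborel \<phi>"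
  unfolding test_functions_def using integrable_compact_support smooth_on_continuous_on by blast

lemma test_functions_bounded:
  assumes "\<phi> \<in> test_functions \<Omega>"
  obtains C where "C > 0" "\<And>x. cmod (\<phi> x) \<le> C"
proof -
  obtain K where K: "smooth_on UNIV \<phi>" "compact K" "K \<subseteq> \<Omega>" "\<And>x. x \<notin> K \<Longrightarrow> \<phi> x = 0"
    using assms(1) unfolding test_functions_def by blast
  have "compact (\<phi> ` K)"
    by (intro compact_continuous_image continuous_on_subset[OF smooth_on_continuous_on[OF K(1)]] K(2)) auto
  then have "bounded (\<phi> ` K)" by (rule compact_imp_bounded)
  then obtain C where "C > 0" "\<forall>x\<in>K. cmod (\<phi> x) \<le> C"
    unfolding bounded_pos by blast
  with K(4) have "cmod (\<phi> x) \<le> C" for x by (cases "x \<in> K") auto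
  with \<open>C > 0\<close> that show ?thesis by blast
qed

lemma integral_translation:
  fixes f :: "real^2 \<Rightarrow> complex"
  assumes "f \<in> borel_measurable borel"
  shows "(LINT x|lborel. f (c + x)) = (LINT x|lborel. f x)"
proof -
  have "(LINT x|lborel. f x) = (LINT x|distr lborel borel ((+) c). f x)"
    by (simp add: lborel_distr_plus)
  also have "\<dots> = (LINT x|lborel. f (c + x))"
    using assms by (subst integral_distr) auto
  finally show ?thesis by simp
qed

text \<open>Difference quotients have integral 0 by translation invariance, and they converge to the
  partial derivative under a uniform Lipschitz bound.\<close>

lemma integral_partial_deriv_test:
  assumes "\<phi> \<in> test_functions \<Omega>"
  shows "(LINT x|lborel. partial_deriv i \<phi> x) = 0"
proof -
  obtain K where K: "smooth_on UNIV \<phi>" "compact K" "K \<subseteq> \<Omega>" "\<And>x. x \<notin> K \<Longrightarrow> \<phi> x = 0"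
    using assms(1) unfolding test_functions_def by blast
  obtain C where C: "C > 0" "\<And>x. cmod (partial_deriv i \<phi> x) \<le> C"
    using test_functions_bounded[OF test_functions_partial_deriv[OF assms]] by metis
  obtain B where B: "\<And>x. x \<in> K \<Longrightarrow> norm x \<le> B"
    using compact_imp_bounded[OF K(2)] by (auto simp: bounded_iff)
  let ?e = "axis i 1 :: real^2"
  \<comment> \<open>Steps of length at most 1 keep the shifted supports in the ball of radius
    \<open>B + 1\<close>, which carries the dominating function.\<close>
  define h where "h n = inverse (real (Suc n))" for n
  have h: "0 < h n" "h n \<le> 1" for n
    by (simp_all add: h_def field_simps)
  have h0: "h \<longlonglongrightarrow> 0" unfolding h_def by (rule LIMSEQ_inverse_real_of_nat)
  let ?q = "\<lambda>n x. (\<phi> (h n *\<^sub>R ?e + x) - \<phi> x) /\<^sub>R h n"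
  have line: "((\<lambda>s. \<phi> (s *\<^sub>R ?e + x)) has_vector_derivative partial_deriv i \<phi> (s *\<^sub>R ?e + x)) (at s within T)" for x s T
  proof -
    have "(\<phi> has_derivative (\<lambda>h. \<Sum>j\<in>UNIV. h $ j *\<^sub>R partial_deriv j \<phi> (s *\<^sub>R ?e + x))) (at (s *\<^sub>R ?e + x))"
      by (rule smooth_on_has_derivative[OF K(1)]) auto
    then have "((\<lambda>s. \<phi> (s *\<^sub>R ?e + x)) has_derivative
       (\<lambda>h. \<Sum>j\<in>UNIV. (h *\<^sub>R ?e) $ j *\<^sub>R partial_deriv j \<phi> (s *\<^sub>R ?e + x))) (at s within T)"
      by (rule has_derivative_compose[rotated]) (auto intro!: derivative_eq_intros)
    moreover have "(\<Sum>j\<in>UNIV. (h *\<^sub>R ?e) $ j *\<^sub>R partial_deriv j \<phi> y) = h *\<^sub>R partial_deriv i \<phi> y" for h y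
    proof -
      have "(\<Sum>j\<in>UNIV. (h *\<^sub>R ?e) $ j *\<^sub>R partial_deriv j \<phi> y) =
          (\<Sum>j\<in>UNIV. if j = i then h *\<^sub>R partial_deriv j \<phi> y else 0)"
        by (intro sum.cong) (auto simp: axis_def)
      then show ?thesis by simp
    qed
    ultimately show ?thesis by (simp add: has_vector_derivative_def)
  qed
  have lip: "cmod (\<phi> (h n *\<^sub>R ?e + x) - \<phi> x) \<le> C * h n" for n x
  proof -
    have "norm (\<phi> (h n *\<^sub>R ?e + x) - \<phi> (0 *\<^sub>R ?e + x)) \<le> C * norm (h n - 0)"
    proof (rule differentiable_bound[of "{0..h n}"])
      show "((\<lambda>s. \<phi> (s *\<^sub>R ?e + x)) has_derivative (\<lambda>t. t *\<^sub>R partial_deriv i \<phi> (s *\<^sub>R ?e + x))) (at s within {0..h n})" for s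
        using line by (simp add: has_vector_derivative_def)
      show "onorm (\<lambda>t. t *\<^sub>R partial_deriv i \<phi> (s *\<^sub>R ?e + x)) \<le> C" for s
        by (rule onorm_le) (use mult_right_mono[OF C(2), of "\<bar>_\<bar>"] in \<open>simp add: mult.commute\<close>)
    qed (use h[of n] in auto)
    then show ?thesis using h[of n] by simp
  qed
  have "(\<lambda>n. LINT x|lborel. ?q n x) \<longlonglongrightarrow> (LINT x|lborel. partial_deriv i \<phi> x)"
  proof (rule integral_dominated_convergence[where w="\<lambda>x. C * indicator (cball 0 (B + 1)) x"])
    show "partial_deriv i \<phi> \<in> borel_measurable lborel" "?q n \<in> borel_measurable lborel" for n
      using smooth_on_continuous_on[OF K(1)] smooth_on_continuous_on[OF smooth_on_partial_deriv[OF K(1)]]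
      by (auto intro!: borel_measurable_continuous_onI continuous_intros continuous_on_compose2[of UNIV \<phi>] simp: h_def)
    show "integrable lborel (\<lambda>x. C * indicator (cball (0::real^2) (B + 1)) x)"
      using emeasure_bounded_finite[OF bounded_cball, of "0::real^2" "B + 1"]
      by (intro integrable_mult_right integrable_real_indicator) auto
    show "AE x in lborel. (\<lambda>n. ?q n x) \<longlonglongrightarrow> partial_deriv i \<phi> x"
    proof (rule AE_I2)
      fix x
      have "((\<lambda>t. (\<phi> (t *\<^sub>R ?e + x) - \<phi> x) /\<^sub>R t) \<longlongrightarrow> partial_deriv i \<phi> x) (at 0)"
      proof (rule LIM_zero_cancel, rule tendsto_norm_zero_cancel, rule Lim_transform_eventually)
        show "((\<lambda>t. norm ((\<phi> (t *\<^sub>R ?e + x) - \<phi> (0 *\<^sub>R ?e + x) - (t - 0) *\<^sub>R partial_deriv i \<phi> x) /\<^sub>R norm (t - 0))) \<longlongrightarrow> 0) (at 0)"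
          using line[of x 0 UNIV] by (intro tendsto_norm_zero) (simp add: has_vector_derivative_def has_derivative_def)
        show "\<forall>\<^sub>F t in at 0. norm ((\<phi> (t *\<^sub>R ?e + x) - \<phi> (0 *\<^sub>R ?e + x) - (t - 0) *\<^sub>R partial_deriv i \<phi> x) /\<^sub>R norm (t - 0))
            = norm ((\<phi> (t *\<^sub>R ?e + x) - \<phi> x) /\<^sub>R t - partial_deriv i \<phi> x)"
          unfolding eventually_at_filter
        proof (rule always_eventually, intro allI impI)
          fix t :: real assume t: "t \<noteq> 0"
          then have "(\<phi> (t *\<^sub>R ?e + x) - \<phi> x) /\<^sub>R t - partial_deriv i \<phi> x =
             (\<phi> (t *\<^sub>R ?e + x) - \<phi> (0 *\<^sub>R ?e + x) - (t - 0) *\<^sub>R partial_deriv i \<phi> x) /\<^sub>R t"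
            by (simp add: scaleR_diff_right)
          then show "norm ((\<phi> (t *\<^sub>R ?e + x) - \<phi> (0 *\<^sub>R ?e + x) - (t - 0) *\<^sub>R partial_deriv i \<phi> x) /\<^sub>R norm (t - 0))
            = norm ((\<phi> (t *\<^sub>R ?e + x) - \<phi> x) /\<^sub>R t - partial_deriv i \<phi> x)"
            by simp
        qed
      qed
      then show "(\<lambda>n. ?q n x) \<longlonglongrightarrow> partial_deriv i \<phi> x"
        by (rule filterlim_compose) (use h0 h(1) in \<open>auto simp: filterlim_at less_imp_neq[symmetric] intro!: always_eventually\<close>)
    qed
    show "AE x in lborel. norm (?q n x) \<le> C * indicator (cball 0 (B + 1)) x" for n
    proof (rule AE_I2)
      fix x
      show "norm (?q n x) \<le> C * indicator (cball 0 (B + 1)) x"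
      proof (cases "x \<in> cball 0 (B + 1)")
        case True
          have "norm (?q n x) = cmod (\<phi> (h n *\<^sub>R ?e + x) - \<phi> x) / h n"
            using h[of n] by (simp add: divide_inverse mult.commute)
          also have "\<dots> \<le> C" using lip[of n x] h[of n] by (simp add: pos_divide_le_eq)
          finally show ?thesis using True by simp
      next
        case False
        have "norm x \<le> norm (h n *\<^sub>R ?e + x) + norm (h n *\<^sub>R ?e)"
          by (metis add.commute add_diff_cancel norm_triangle_ineq4)
        then have "norm (h n *\<^sub>R ?e + x) > B" "norm x > B" using False h[of n] by (auto simp: norm_axis_1)
        then have "h n *\<^sub>R ?e + x \<notin> K" "x \<notin> K" using B by force+
        then show ?thesis using K(4) False by simp
      qed
    qed
  qed
  moreover have "(LINT x|lborel. ?q n x) = 0" for n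
  proof -
    have m: "\<phi> \<in> borel_measurable borel" using smooth_on_UNIV_borel_measurable[OF K(1)] .
    have i: "integrable lborel \<phi>" using test_functions_integrable[OF assms] .
    have i2: "integrable lborel (\<lambda>x. \<phi> (h n *\<^sub>R ?e + x))"
    proof (rule integrable_compact_support[where K="cball 0 (B + 1)"])
      show "continuous_on UNIV (\<lambda>x. \<phi> (h n *\<^sub>R ?e + x))"
        using smooth_on_continuous_on[OF K(1)]
        by (auto intro!: continuous_intros continuous_on_compose2[of UNIV \<phi>])
      fix x assume "x \<notin> cball (0::real^2) (B+1)"
      then have "norm x > B + 1" by simp
      moreover have "norm x \<le> norm (h n *\<^sub>R ?e + x) + norm (h n *\<^sub>R ?e)"
          by (metis add.commute add_diff_cancel norm_triangle_ineq4)
      ultimately have "norm (h n *\<^sub>R ?e + x) > B" using h[of n] by (auto simp: norm_axis_1)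
      then show "\<phi> (h n *\<^sub>R ?e + x) = 0" using B K(4) by force
    qed simp
    have "(LINT x|lborel. ?q n x) = ((LINT x|lborel. \<phi> (h n *\<^sub>R ?e + x)) - (LINT x|lborel. \<phi> x)) /\<^sub>R h n"
      using i i2 by simp
    then show ?thesis using integral_translation[OF m] by simp
  qed
  then have "(\<lambda>n. LINT x|lborel. ?q n x) \<longlonglongrightarrow> 0" by (simp only: tendsto_const)
  ultimately show ?thesis by (rule LIMSEQ_unique)
qed

section \<open>The fundamental lemma of the calculus of variations and mollification\<close>

lemma integrable_mult_bounded:
  fixes f g :: "real^2 \<Rightarrow> complex"
  assumes "integrable lborel f" "g \<in> borel_measurable borel" "\<And>x. cmod (g x) \<le> C"
  shows "integrable lborel (\<lambda>x. g x * f x)"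
proof (rule Bochner_Integration.integrable_bound)
  show "integrable lborel (\<lambda>x. C * cmod (f x))" using assms(1) by auto
  show "(\<lambda>x. g x * f x) \<in> borel_measurable lborel" using assms by auto
  have "C \<ge> 0" using assms(3)[of 0] norm_ge_zero order_trans by blast
  then show "AE x in lborel. norm (g x * f x) \<le> norm (C * cmod (f x))"
    using assms(3) by (auto simp: norm_mult abs_mult intro!: mult_right_mono AE_I2)
qed

text \<open>The Borel sets over which \<open>g\<close> integrates to 0 form a Dynkin system, and the
  boxes are an intersection-stable generator.\<close>

lemma AE_zero_if_box_integrals_zero:
  fixes g :: "real^2 \<Rightarrow> complex"
  assumes g: "integrable lborel g" and box: "\<And>a b. (LINT x:box a b|lborel. g x) = 0"
  shows "AE x in lborel. g x = 0"
proof (rule sigma_finite_measure.density_zero[OF sigma_finite_lborel g])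
  have si: "set_integrable lborel A g" if "A \<in> sets lborel" for A
    using that g by (simp add: set_integrable_def integrable_mult_indicator)
  \<comment> \<open>Needed for complements: the plane is an increasing union of boxes.\<close>
  have total: "(LINT x|lborel. g x) = 0"
  proof -
    let ?B = "\<lambda>n::nat. box (- (real n *\<^sub>R One)) (real n *\<^sub>R One) :: (real^2) set"
    have "(\<lambda>n. LINT x:?B n|lborel. g x) \<longlonglongrightarrow> (LINT x:(\<Union>n. ?B n)|lborel. g x)"
    proof (rule set_integral_cont_up)
      show "incseq ?B"
      proof (rule incseq_SucI)
        fix n show "?B n \<le> ?B (Suc n)"
          by (rule subset_box_imp) (auto simp: algebra_simps)
      qed
    qed (use si in auto)
    moreover have "(LINT x:(\<Union>n. ?B n)|lborel. g x) = (LINT x|lborel. g x)"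
      by (simp add: UN_box_eq_UNIV set_lebesgue_integral_def)
    ultimately show ?thesis
      using box by (simp add: LIMSEQ_const_iff)
  qed
  fix A :: "(real^2) set" assume A: "A \<in> sets lborel"
  have "sigma_sets UNIV (range (\<lambda>(a, b). box a b::(real^2) set)) = sets lborel"
    using borel_eq_box[where 'a="real^2"] by (metis sets_lborel sets_measure_of UNIV_I subset_UNIV Pow_UNIV)
  note sg = this
  have "Int_stable (range (\<lambda>(a, b). box a b::(real^2) set))"
    by (auto simp: Int_stable_def box_Int_box)
  then show "(LINT x:A|lborel. g x) = 0"
  proof (rule sigma_sets_induct_disjoint)
    show "A \<in> sigma_sets UNIV (range (\<lambda>(a, b). box a b))" using A sg by simp
    fix B :: "(real^2) set" assume B: "B \<in> range (\<lambda>(a, b). box a b)"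
    then show "(LINT x:B|lborel. g x) = 0" using box by auto
  next
    fix B :: "(real^2) set" assume "B \<in> sigma_sets UNIV (range (\<lambda>(a, b). box a b))" and z: "(LINT x:B|lborel. g x) = 0"
    then have B: "B \<in> sets lborel" using sg by simp
    then have "(LINT x:B \<union> (UNIV - B)|lborel. g x) = (LINT x:B|lborel. g x) + (LINT x:UNIV - B|lborel. g x)"
      by (intro set_integral_Un si) auto
    with z total show "(LINT x:UNIV - B|lborel. g x) = 0"
      by (simp add: set_lebesgue_integral_def)
  next
    fix B :: "nat \<Rightarrow> (real^2) set" assume d: "disjoint_family B" 
      and "range B \<subseteq> sigma_sets UNIV (range (\<lambda>(a, b). box a b))" and z: "\<And>i. (LINT x:B i|lborel. g x) = 0"
    then have B: "B i \<in> sets lborel" for i using sg by auto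
    have "(LINT x:(\<Union>i. B i)|lborel. g x) = (\<Sum>i. LINT x:B i|lborel. g x)"
      using d B by (intro lebesgue_integral_countable_add si) (auto simp: disjoint_family_on_def)
    with z show "(LINT x:(\<Union>i. B i)|lborel. g x) = 0" by simp
  qed (auto simp: set_lebesgue_integral_def)
qed

text \<open>Box bumps are test functions that tend to the indicator of the open box; |f| on the
  closed box dominates.\<close>

lemma weak_zero_box:
  assumes "locally_integrable_on \<Omega> f"
    and "\<And>\<phi>. \<phi> \<in> test_functions \<Omega> \<Longrightarrow> (LINT x:\<Omega>|lborel. f x * \<phi> x) = 0"
    and "cbox a b \<subseteq> \<Omega>"
  shows "(LINT x:box a b|lborel. f x) = 0"
proof -
  have i: "set_integrable lborel (cbox a b) f"
    using assms(1,3) by (auto simp: locally_integrable_on_def)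
  let ?F = "\<lambda>x. indicat_real (cbox a b) x *\<^sub>R f x"
  have F: "integrable lborel ?F" using i by (simp add: set_integrable_def)
  have "(\<lambda>j. LINT x|lborel. of_real (box_bump a b (real j) x) * ?F x) \<longlonglongrightarrow> (LINT x|lborel. indicator (box a b) x *\<^sub>R f x)"
  proof (rule integral_dominated_convergence[where w="\<lambda>x. norm (?F x)"])
    show "(\<lambda>x. of_real (box_bump a b (real j) x) * ?F x) \<in> borel_measurable lborel" for j
      using borel_measurable_integrable[OF F] smooth_on_UNIV_borel_measurable[OF smooth_on_box_bump]
      by (intro borel_measurable_times) simp_all
    show "(\<lambda>x. indicat_real (box a b) x *\<^sub>R f x) \<in> borel_measurable lborel"
    proof -
      have "integrable lborel (\<lambda>x. indicat_real (box a b) x *\<^sub>R ?F x)"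
        by (intro integrable_mult_indicator F) auto
      moreover have "(\<lambda>x. indicat_real (box a b) x *\<^sub>R ?F x) = (\<lambda>x. indicat_real (box a b) x *\<^sub>R f x)"
        using box_subset_cbox[of a b] by (intro ext) (auto simp: indicator_def)
      ultimately show ?thesis by auto
    qed
    show "integrable lborel (\<lambda>x. norm (?F x))" using F by (rule integrable_norm)
    have "(\<lambda>j. of_real (box_bump a b (real j) x) * ?F x) \<longlonglongrightarrow> of_real (indicat_real (box a b) x) * ?F x" for x
      by (intro tendsto_mult tendsto_of_real box_bump_tendsto tendsto_const)
    moreover have "of_real (indicat_real (box a b) x) * ?F x = indicator (box a b) x *\<^sub>R f x" for x
      using box_subset_cbox[of a b] by (auto simp: indicator_def)
    ultimately show "AE x in lborel. (\<lambda>j. of_real (box_bump a b (real j) x) * ?F x) \<longlonglongrightarrow> indicator (box a b) x *\<^sub>R f x"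
      by simp
    show "AE x in lborel. norm (of_real (box_bump a b (real j) x) * ?F x) \<le> norm (?F x)" for j
      unfolding norm_mult norm_of_real abs_of_nonneg[OF box_bump_nonneg]
      by (intro AE_I2 mult_left_le_one_le norm_ge_zero box_bump_nonneg box_bump_le_1)
  qed
  moreover have "(LINT x|lborel. of_real (box_bump a b (real j) x) * ?F x) = 0" for j
  proof -
    have "of_real (box_bump a b (real j) x) * ?F x = indicator \<Omega> x *\<^sub>R (f x * of_real (box_bump a b (real j) x))" for x
      using box_bump_eq_0[of "real j" x a b] box_subset_cbox[of a b] assms(3) by (auto simp: indicator_def)
    then show ?thesis
      using assms(2)[OF box_bump_test[OF assms(3), of "real j"]] by (simp add: set_lebesgue_integral_def)
  qed
  ultimately show ?thesis by (simp add: LIMSEQ_const_iff set_lebesgue_integral_def)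
qed

lemma fundamental_lemma_of_variations:
  assumes "open \<Omega>" "locally_integrable_on \<Omega> f"
    and "\<And>\<phi>. \<phi> \<in> test_functions \<Omega> \<Longrightarrow> (LINT x:\<Omega>|lborel. f x * \<phi> x) = 0"
  shows "AE x in lborel. x \<in> \<Omega> \<longrightarrow> f x = 0"
proof -
  \<comment> \<open>Cutting \<open>f\<close> down to a box makes it integrable on the plane, and
    integrals over other boxes reduce to intersections, which are again boxes.\<close>
  have box: "AE x in lborel. x \<in> box c d \<longrightarrow> f x = 0" if cd: "cbox c d \<subseteq> \<Omega>" for c d
  proof -
    let ?g = "\<lambda>x. indicat_real (box c d) x *\<^sub>R f x"
    have i: "set_integrable lborel (cbox c d) f"
      using assms(2) cd by (auto simp: locally_integrable_on_def)
    then have "set_integrable lborel (box c d) f"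
      by (rule set_integrable_subset) (simp_all add: box_subset_cbox)
    then have g: "integrable lborel ?g" by (simp add: set_integrable_def)
    have "AE x in lborel. ?g x = 0"
    proof (rule AE_zero_if_box_integrals_zero[OF g])
      fix a b :: "real^2"
      obtain a' b' where ab: "box a b \<inter> box c d = box a' b'" by (rule that[OF box_Int_box])
      have "(LINT x:box a b|lborel. ?g x) = (LINT x:box a' b'|lborel. f x)"
        unfolding ab[symmetric] set_lebesgue_integral_def
        by (intro Bochner_Integration.integral_cong) (auto simp: indicator_def)
      also have "\<dots> = 0"
      proof (cases "box a' b' = {}")
        case False
        have "cbox a' b' \<subseteq> cbox c d"
          using ab closure_box[OF False] closure_mono[of "box a' b'" "cbox c d"] box_subset_cbox[of c d] by auto
        with cd show ?thesis by (intro weak_zero_box[OF assms(2,3)]) auto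
      qed (simp add: set_lebesgue_integral_def)
      finally show "(LINT x:box a b|lborel. ?g x) = 0" .
    qed
    then show ?thesis by eventually_elim (auto simp: indicator_def)
  qed
  \<comment> \<open>Null sets may only be united countably often, so a countable subcover of
    \<Omega> is extracted.\<close>
  let ?F = "{box c d |c d. cbox c d \<subseteq> \<Omega>}"
  obtain F' where F': "F' \<subseteq> ?F" "countable F'" "\<Union>F' = \<Union>?F"
    by (rule Lindelof[of ?F]) (auto simp: open_box)
  have "AE x in lborel. \<forall>B\<in>F'. x \<in> B \<longrightarrow> f x = 0"
    using F'(1) box by (subst AE_ball_countable[OF F'(2)]) blast
  moreover have "\<Omega> \<subseteq> \<Union>?F"
  proof
    fix x assume "x \<in> \<Omega>"
    then obtain a b where "cbox a b \<subseteq> \<Omega>" "x \<in> box a b"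
      using open_contains_cbox[OF assms(1)] by metis
    then show "x \<in> \<Union>?F" by blast
  qed
  ultimately show ?thesis
    using F'(3) by (auto elim!: eventually_mono)
qed

section \<open>Mollification of integrable functions\<close>

lemma uniformly_continuous_compact_support:
  fixes f :: "real^2 \<Rightarrow> complex"
  assumes "continuous_on UNIV f" "compact K" "\<And>x. x \<notin> K \<Longrightarrow> f x = 0"
  shows "uniformly_continuous_on UNIV f"
proof -
  obtain B where B: "\<And>x. x \<in> K \<Longrightarrow> norm x \<le> B"
    using compact_imp_bounded[OF assms(2)] by (auto simp: bounded_iff)
  have u: "uniformly_continuous_on (cball 0 (B + 1)) f"
    by (intro compact_uniformly_continuous continuous_on_subset[OF assms(1)]) auto
  show ?thesis
    unfolding uniformly_continuous_on_def
  proof (intro allI impI)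
    fix e :: real assume "e > 0"
    then obtain d where d: "d > 0" "\<And>x y. x \<in> cball 0 (B + 1) \<Longrightarrow> y \<in> cball 0 (B + 1) \<Longrightarrow> dist y x < d \<Longrightarrow> dist (f y) (f x) < e"
      using u unfolding uniformly_continuous_on_def by metis
    have "dist (f y) (f x) < e" if "dist y x < min d 1" for x y
    proof (cases "x \<in> cball 0 (B + 1) \<and> y \<in> cball 0 (B + 1)")
      case True
      then show ?thesis using d(2) that by auto
    next
      case False
      have "norm x \<le> norm y + dist y x" "norm y \<le> norm x + dist y x"
        by (metis dist_norm norm_triangle_sub add.commute dist_commute)+
      with False that have "norm x > B" "norm y > B" by auto
      then have "f x = 0" "f y = 0" using B assms(3) by force+
      then show ?thesis using \<open>e > 0\<close> by simp
    qed
    then show "\<exists>d>0. \<forall>x\<in>UNIV. \<forall>y\<in>UNIV. dist y x < d \<longrightarrow> dist (f y) (f x) < e"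
      using d(1) by (intro exI[of _ "min d 1"]) auto
  qed
qed

text \<open>The first-order Taylor remainder is small uniformly in the base point, so it may be
  integrated against any integrable function.\<close>

lemma test_functions_uniform_derivative:
  assumes "\<eta> \<in> test_functions \<Omega>" "e > 0"
  shows "\<exists>d>0. \<forall>x h. norm h < d \<longrightarrow>
    cmod (\<eta> (x + h) - \<eta> x - (\<Sum>i\<in>UNIV. h $ i *\<^sub>R partial_deriv i \<eta> x)) \<le> e * norm h"
proof -
  have "uniformly_continuous_on UNIV (partial_deriv i \<eta>)" for i
    using test_functions_partial_deriv[OF assms(1), of i] unfolding test_functions_def
    using uniformly_continuous_compact_support smooth_on_continuous_on by blast
  \<comment> \<open>Each of the two partial derivatives may use up half of \<open>e\<close>.\<close>
  then have "\<forall>i. \<exists>d>0. \<forall>x y. dist y x < d \<longrightarrow> dist (partial_deriv i \<eta> y) (partial_deriv i \<eta> x) < e / 2"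
    using assms(2) by (metis uniformly_continuous_on_def UNIV_I half_gt_zero)
  then obtain d where d: "\<And>i. d i > 0" "\<And>i x y. dist y x < d i \<Longrightarrow> dist (partial_deriv i \<eta> y) (partial_deriv i \<eta> x) < e / 2"
    by metis
  define D where "D = Min (range d)"
  have D: "D > 0" "\<And>i. D \<le> d i" using d(1) by (auto simp: D_def)
  have sm: "smooth_on UNIV \<eta>" using test_functions_smooth[OF assms(1)] .
  have "cmod (\<eta> (x + h) - \<eta> x - (\<Sum>i\<in>UNIV. h $ i *\<^sub>R partial_deriv i \<eta> x)) \<le> e * norm h"
    if h: "norm h < D" for x h
  proof -
    let ?f' = "\<lambda>y h. \<Sum>i\<in>UNIV. h $ i *\<^sub>R partial_deriv i \<eta> y"
    have "norm (\<eta> (x + h) - \<eta> x - ?f' x (x + h - x)) \<le> norm (x + h - x) * e"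
    proof (rule differentiable_bound_linearization[of x "x + h" "ball x D"])
      show "x + t *\<^sub>R (x + h - x) \<in> ball x D" if "t \<in> {0..1}" for t
      proof -
        have "\<bar>t\<bar> * norm h \<le> 1 * norm h" using that by (intro mult_right_mono) auto
        with h show ?thesis by (simp add: dist_norm)
      qed
      show "(\<eta> has_derivative ?f' y) (at y within ball x D)" for y
        by (rule has_derivative_at_withinI, rule smooth_on_has_derivative[OF sm]) auto
      show "x \<in> ball x D" using D by simp
      show "onorm (?f' y - ?f' x) \<le> e" if y: "y \<in> ball x D" for y
      proof (rule onorm_le)
        fix k :: "real^2"
        have "cmod (?f' y k - ?f' x k) = cmod (\<Sum>i\<in>UNIV. k $ i *\<^sub>R (partial_deriv i \<eta> y - partial_deriv i \<eta> x))"
          by (simp add: sum_subtractf scaleR_diff_right)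
        also have "\<dots> \<le> (\<Sum>i\<in>(UNIV::2 set). norm k * (e / 2))"
        proof (rule sum_norm_le)
          fix i :: 2
          have "dist y x < d i" using y D(2)[of i] by (simp add: dist_commute)
          then have "cmod (partial_deriv i \<eta> y - partial_deriv i \<eta> x) \<le> e / 2" using d(2) by (auto simp: dist_norm less_imp_le)
          then show "norm (k $ i *\<^sub>R (partial_deriv i \<eta> y - partial_deriv i \<eta> x)) \<le> norm k * (e / 2)"
            unfolding norm_scaleR real_norm_def
            by (intro mult_mono component_le_norm_cart) auto
        qed
        also have "\<dots> = e * norm k" by simp
        finally show "cmod ((?f' y - ?f' x) k) \<le> e * norm k" by simp
      qed
    qed
    then show ?thesis by (simp add: mult.commute)
  qed
  with D(1) show ?thesis by blast
qed

lemma mollify_integrable: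
  assumes "\<eta> \<in> test_functions \<Omega>" "integrable lborel f"
  shows "integrable lborel (\<lambda>y. \<eta> (x - c *\<^sub>R y) * f y)"
proof -
  obtain C where C: "C > 0" "\<And>x. cmod (\<eta> x) \<le> C" using test_functions_bounded[OF assms(1)] by metis
  show ?thesis
  proof (rule integrable_mult_bounded[OF assms(2) _ C(2)])
    have "continuous_on UNIV (\<lambda>y. \<eta> (x - c *\<^sub>R y))"
      using smooth_on_continuous_on[OF test_functions_smooth[OF assms(1)]]
      by (auto intro!: continuous_on_compose2[of UNIV \<eta>] continuous_intros)
    then show "(\<lambda>y. \<eta> (x - c *\<^sub>R y)) \<in> borel_measurable borel"
      by (rule borel_measurable_continuous_onI)
  qed
qed

text \<open>Differentiation under the integral sign: the remainder of the kernel is uniformly small,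
  so its integral against \<open>f\<close> is at most this bound times the L1 norm of
  \<open>f\<close>.\<close>

lemma mollify_has_derivative:
  assumes \<eta>: "\<eta> \<in> test_functions \<Omega>" and f: "integrable lborel f"
  shows "((\<lambda>x. LINT y|lborel. \<eta> (x - c *\<^sub>R y) * f y) has_derivative
     (\<lambda>h. \<Sum>i\<in>UNIV. h $ i *\<^sub>R (LINT y|lborel. partial_deriv i \<eta> (x - c *\<^sub>R y) * f y))) (at x)"
  unfolding has_derivative_at_alt
proof (intro conjI allI impI)
  show "bounded_linear (\<lambda>h::real^2. \<Sum>i\<in>UNIV. h $ i *\<^sub>R (LINT y|lborel. partial_deriv i \<eta> (x - c *\<^sub>R y) * f y))"
    by (intro bounded_linear_sum bounded_linear_scaleR_const bounded_linear_vec_nth)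
  fix e :: real assume e: "e > 0"
  \<comment> \<open>Dividing by \<open>I + 1\<close> instead of \<open>I\<close> covers an
    \<open>f\<close> that vanishes almost everywhere.\<close>
  define I where "I = (LINT y|lborel. cmod (f y))"
  have I: "I \<ge> 0" by (simp add: I_def)
  then have e': "e / (I + 1) > 0" using e by simp
  obtain d where d: "d > 0" "\<And>x h. norm h < d \<Longrightarrow>
      cmod (\<eta> (x + h) - \<eta> x - (\<Sum>i\<in>UNIV. h $ i *\<^sub>R partial_deriv i \<eta> x)) \<le> e / (I + 1) * norm h"
    using test_functions_uniform_derivative[OF \<eta> e'] by blast
  note ii = mollify_integrable[OF \<eta> f] mollify_integrable[OF test_functions_partial_deriv[OF \<eta>] f]
  have "norm ((LINT y|lborel. \<eta> (z - c *\<^sub>R y) * f y) - (LINT y|lborel. \<eta> (x - c *\<^sub>R y) * f y) -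
          (\<Sum>i\<in>UNIV. (z - x) $ i *\<^sub>R (LINT y|lborel. partial_deriv i \<eta> (x - c *\<^sub>R y) * f y))) \<le> e * norm (z - x)"
    if z: "norm (z - x) < d" for z
  proof -
    let ?r = "\<lambda>y. \<eta> (z - c *\<^sub>R y) - \<eta> (x - c *\<^sub>R y) - (\<Sum>i\<in>UNIV. (z - x) $ i *\<^sub>R partial_deriv i \<eta> (x - c *\<^sub>R y))"
    have "(LINT y|lborel. \<eta> (z - c *\<^sub>R y) * f y) - (LINT y|lborel. \<eta> (x - c *\<^sub>R y) * f y) -
          (\<Sum>i\<in>UNIV. (z - x) $ i *\<^sub>R (LINT y|lborel. partial_deriv i \<eta> (x - c *\<^sub>R y) * f y))
       = (LINT y|lborel. \<eta> (z - c *\<^sub>R y) * f y - \<eta> (x - c *\<^sub>R y) * f y -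
          (\<Sum>i\<in>UNIV. (z - x) $ i *\<^sub>R (partial_deriv i \<eta> (x - c *\<^sub>R y) * f y)))"
      using ii by (simp add: Bochner_Integration.integral_diff Bochner_Integration.integral_sum)
    also have "\<dots> = (LINT y|lborel. ?r y * f y)"
      by (intro Bochner_Integration.integral_cong refl) (simp add: algebra_simps sum_distrib_right sum_distrib_left)
    also have "norm \<dots> \<le> (LINT y|lborel. (e / (I + 1) * norm (z - x)) * cmod (f y))"
    proof (rule order_trans[OF integral_norm_bound integral_mono])
      have "integrable lborel (\<lambda>y. \<eta> (z - c *\<^sub>R y) * f y - \<eta> (x - c *\<^sub>R y) * f y -
          (\<Sum>i\<in>UNIV. (z - x) $ i *\<^sub>R (partial_deriv i \<eta> (x - c *\<^sub>R y) * f y)))"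
        using ii by (intro Bochner_Integration.integrable_diff Bochner_Integration.integrable_sum integrable_scaleR_right) auto
      moreover have "(\<lambda>y. \<eta> (z - c *\<^sub>R y) * f y - \<eta> (x - c *\<^sub>R y) * f y -
          (\<Sum>i\<in>UNIV. (z - x) $ i *\<^sub>R (partial_deriv i \<eta> (x - c *\<^sub>R y) * f y))) = (\<lambda>y. ?r y * f y)"
        by (simp add: algebra_simps sum_distrib_right sum_distrib_left)
      ultimately show "integrable lborel (\<lambda>y. norm (?r y * f y))" by simp
      show "integrable lborel (\<lambda>y. (e / (I + 1) * norm (z - x)) * cmod (f y))" using f by simp
      show "norm (?r y * f y) \<le> (e / (I + 1) * norm (z - x)) * cmod (f y)" for y
      proof -
        have "x - c *\<^sub>R y + (z - x) = z - c *\<^sub>R y" by simp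
        then have "cmod (?r y) \<le> e / (I + 1) * norm (z - x)"
          using d(2)[OF z, of "x - c *\<^sub>R y"] by simp
        then show ?thesis unfolding norm_mult by (intro mult_right_mono) auto
      qed
    qed
    also have "\<dots> = (e / (I + 1) * norm (z - x)) * I" by (simp add: I_def)
    also have "\<dots> = (I / (I + 1)) * (e * norm (z - x))" by simp
    also have "\<dots> \<le> 1 * (e * norm (z - x))"
      using I e by (intro mult_right_mono) auto
    finally show ?thesis by simp
  qed
  with d(1) show "\<exists>d>0. \<forall>z. norm (z - x) < d \<longrightarrow>
     norm ((LINT y|lborel. \<eta> (z - c *\<^sub>R y) * f y) - (LINT y|lborel. \<eta> (x - c *\<^sub>R y) * f y) -
          (\<Sum>i\<in>UNIV. (z - x) $ i *\<^sub>R (LINT y|lborel. partial_deriv i \<eta> (x - c *\<^sub>R y) * f y))) \<le> e * norm (z - x)"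
    by blast
qed

lemma mollify_partial_deriv:
  assumes \<eta>: "\<eta> \<in> test_functions \<Omega>" and f: "integrable lborel f"
  shows "partial_deriv i (\<lambda>x. LINT y|lborel. \<eta> (x - c *\<^sub>R y) * f y)
     = (\<lambda>x. LINT y|lborel. partial_deriv i \<eta> (x - c *\<^sub>R y) * f y)"
proof
  fix x
  have "partial_deriv i (\<lambda>x. LINT y|lborel. \<eta> (x - c *\<^sub>R y) * f y) x =
      (\<Sum>j\<in>UNIV. if j = i then LINT y|lborel. partial_deriv j \<eta> (x - c *\<^sub>R y) * f y else 0)"
    unfolding partial_deriv_eqI[OF mollify_has_derivative[OF assms]]
    by (intro sum.cong) (auto simp: axis_def)
  then show "partial_deriv i (\<lambda>x. LINT y|lborel. \<eta> (x - c *\<^sub>R y) * f y) x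
     = (LINT y|lborel. partial_deriv i \<eta> (x - c *\<^sub>R y) * f y)" by simp
qed

lemma mollify_smooth:
  assumes \<eta>: "\<eta> \<in> test_functions \<Omega>" and f: "integrable lborel f"
  shows "smooth_on UNIV (\<lambda>x. LINT y|lborel. \<eta> (x - c *\<^sub>R y) * f y)"
proof -
  have diff: "(\<lambda>x. LINT y|lborel. \<eta> (x - c *\<^sub>R y) * f y) differentiable_on UNIV"
    if "\<eta> \<in> test_functions \<Omega>" for \<eta>
    using mollify_has_derivative[OF that f]
    by (meson differentiable_at_imp_differentiable_on differentiable_def)
  have "Ck_on n UNIV (\<lambda>x. LINT y|lborel. \<eta> (x - c *\<^sub>R y) * f y)" for n
    using \<eta>
  proof (induction n arbitrary: \<eta>)
    case 0
    then show ?case using diff differentiable_imp_continuous_on by auto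
  next
    case (Suc n)
    show ?case
      unfolding Ck_on.simps mollify_partial_deriv[OF Suc.prems f]
      using diff[OF Suc.prems] Suc.IH[OF test_functions_partial_deriv[OF Suc.prems]] by simp
  qed
  then show ?thesis by (simp add: smooth_on_def)
qed

lemma mollify_laplacian:
  assumes \<eta>: "\<eta> \<in> test_functions \<Omega>" and f: "integrable lborel f"
  shows "laplacian (\<lambda>x. LINT y|lborel. \<eta> (x - c *\<^sub>R y) * f y)
     = (\<lambda>x. LINT y|lborel. laplacian \<eta> (x - c *\<^sub>R y) * f y)"
proof
  fix x
  have "laplacian (\<lambda>x. LINT y|lborel. \<eta> (x - c *\<^sub>R y) * f y) x =
     (\<Sum>i\<in>UNIV. LINT y|lborel. partial_deriv i (partial_deriv i \<eta>) (x - c *\<^sub>R y) * f y)"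
    unfolding laplacian_def mollify_partial_deriv[OF \<eta> f]
      mollify_partial_deriv[OF test_functions_partial_deriv[OF \<eta>] f] ..
  also have "\<dots> = (LINT y|lborel. laplacian \<eta> (x - c *\<^sub>R y) * f y)"
    unfolding laplacian_def sum_distrib_right
    by (rule Bochner_Integration.integral_sum[symmetric]) 
       (intro mollify_integrable[OF _ f, of _ \<Omega>] test_functions_partial_deriv \<eta>)
  finally show "laplacian (\<lambda>x. LINT y|lborel. \<eta> (x - c *\<^sub>R y) * f y) x
     = (LINT y|lborel. laplacian \<eta> (x - c *\<^sub>R y) * f y)" .
qed

section \<open>Polar coordinates\<close>

lemma vector2_eq: "(vector [x, y] :: real^2) = x *\<^sub>R axis 1 1 + y *\<^sub>R axis 2 1"
  by (simp add: vec_eq_iff forall_2 axis_def)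

lemma vector2_scaleR: "(c *\<^sub>R vector [x, y] :: real^2) = vector [c * x, c * y]"
  by (simp add: vec_eq_iff forall_2)

lemma circle_pt_nth [simp]: "circle_pt r t $ 1 = r * cos t" "circle_pt r t $ 2 = r * sin t"
  by (simp_all add: circle_pt_def)

lemma norm_circle_pt [simp]: "norm (circle_pt r t) = \<bar>r\<bar>"
proof -
  have "norm (circle_pt r t) = sqrt ((r * cos t)\<^sup>2 + (r * sin t)\<^sup>2)"
    by (simp add: norm_vec_def L2_set_def sum_2)
  also have "(r * cos t)\<^sup>2 + (r * sin t)\<^sup>2 = r\<^sup>2 * ((cos t)\<^sup>2 + (sin t)\<^sup>2)"
    by (simp add: power_mult_distrib algebra_simps del: sin_cos_squared_add sin_cos_squared_add2)
  finally show ?thesis by simp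
qed

lemma continuous_on_circle_pt [continuous_intros]:
  fixes S :: "'a::t2_space set"
  shows "continuous_on S f \<Longrightarrow> continuous_on S g \<Longrightarrow> continuous_on S (\<lambda>x. circle_pt (f x) (g x))"
  unfolding circle_pt_def vector2_eq by (intro continuous_intros)

lemma AE_not_negligible:
  assumes "negligible N"
  shows "AE x in lborel. x \<notin> N"
proof -
  have "AE x in lebesgue. x \<notin> N"
    using assms by (intro AE_not_in) (simp add: negligible_iff_null_sets)
  then show ?thesis by (simp only: AE_completion_iff)
qed

lemma AE_not_sphere: "AE x in lborel. norm (x::real^2) \<noteq> R"
  using AE_not_negligible[OF negligible_sphere, of "0::real^2" R] by simp

lemma circle_pt_surj: obtains t where "0 \<le> t" "t < 2 * pi" "x = circle_pt (norm x) t"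
proof (cases "x = 0")
  case True
  then show ?thesis using that[of 0] by (simp add: circle_pt_def vector2_eq)
next
  case False
  then have n: "norm x > 0" by simp
  have "(norm x)\<^sup>2 = (x $ 1)\<^sup>2 + (x $ 2)\<^sup>2"
    by (simp add: norm_vec_def L2_set_def sum_2)
  then have "(x $ 1 / norm x)\<^sup>2 + (x $ 2 / norm x)\<^sup>2 = (norm x)\<^sup>2 / (norm x)\<^sup>2"
    by (simp only: power_divide add_divide_distrib)
  then have "(x $ 1 / norm x)\<^sup>2 + (x $ 2 / norm x)\<^sup>2 = 1"
    using n by simp
  then obtain t where t: "0 \<le> t" "t < 2 * pi" "x $ 1 / norm x = cos t" "x $ 2 / norm x = sin t"
    by (rule sincos_total_2pi)
  have "x $ 1 = norm x * cos t" "x $ 2 = norm x * sin t"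
    using n by (simp_all flip: t(3,4))
  then have "x = circle_pt (norm x) t"
    by (simp only: vec_eq_iff forall_2 circle_pt_nth)
  with t that show ?thesis by blast
qed

lemma circle_pt_eqD:
  assumes "circle_pt r t = circle_pt r' t'" "r > 0" "r' > 0" "0 < t" "t < 2 * pi" "0 < t'" "t' < 2 * pi"
  shows "r = r' \<and> t = t'"
proof -
  have r: "r = r'" using assms(1-3) norm_circle_pt[of r t] norm_circle_pt[of r' t'] by simp
  have "sin t = sin t' \<and> cos t = cos t'"
    using assms(1,2) r circle_pt_nth[of r t] circle_pt_nth[of r t'] by auto
  then obtain n :: int where n: "t = t' + 2 * pi * n" using sin_cos_eq_iff by blast
  have "2 * pi * real_of_int n = t - t'" using n by linarith
  then have "2 * pi * real_of_int n < 2 * pi * 1" "2 * pi * (- 1) < 2 * pi * real_of_int n"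
    using assms(4-7) by linarith+
  then have "real_of_int n < 1" "- 1 < real_of_int n"
    by (simp_all only: mult_less_cancel_left_pos pi_gt_zero mult_pos_pos zero_less_numeral)
  then have "n = 0" by linarith
  with n r show ?thesis by simp
qed

text \<open>Transports Lebesgue measure from \<open>real \<times> real\<close>, where Fubini
  applies; it is determined by its values on boxes.\<close>

lemma lborel_vec2: "(lborel :: (real^2) measure) = distr lborel borel (\<lambda>(x, y). vector [x, y])"
proof (rule lborel_eqI)
  have m: "(\<lambda>(x, y). vector [x, y] :: real^2) \<in> borel_measurable (lborel :: (real \<times> real) measure)"
    unfolding vector2_eq case_prod_beta by (auto intro!: borel_measurable_continuous_onI continuous_intros)
  fix l u :: "real^2" assume "\<And>b. b \<in> Basis \<Longrightarrow> l \<bullet> b \<le> u \<bullet> b"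
  then have lu: "l $ i \<le> u $ i" for i by (auto simp: cart_eq_inner_axis Basis_vec_def)
  have "emeasure (distr lborel borel (\<lambda>(x, y). vector [x, y])) (box l u) =
     emeasure (lborel :: (real \<times> real) measure) (box (l $ 1, l $ 2) (u $ 1, u $ 2))"
  proof -
    have "(\<lambda>(x, y). vector [x, y] :: real^2) -` box l u = box (l $ 1, l $ 2) (u $ 1, u $ 2)"
      by (auto simp: mem_box_cart forall_2 mem_box Basis_prod_def)
    then show ?thesis by (subst emeasure_distr[OF m]) auto
  qed
  also have "\<dots> = ennreal ((u $ 1 - l $ 1) * (u $ 2 - l $ 2))"
    using lu by (subst emeasure_lborel_box) (auto simp: Basis_prod_def)
  also have "(u $ 1 - l $ 1) * (u $ 2 - l $ 2) = (\<Prod>b\<in>Basis. (u - l) \<bullet> b)"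
    by (simp add: Basis_vec_def cart_eq_inner_axis axis_eq_axis prod.UNION_disjoint prod_2 UNIV_2 inner_diff_left)
  finally show "emeasure (distr lborel borel (\<lambda>(x, y). vector [x, y])) (box l u) = (\<Prod>b\<in>Basis. (u - l) \<bullet> b)"
    by simp
qed simp

text \<open>The values lie in \<open>real^2\<close> to fit the Jacobian theorem for Cartesian
  powers; \<open>polar_integral\<close> transfers the result to complex values.\<close>

lemma polar_change_of_variables:
  fixes f :: "real^2 \<Rightarrow> real^2"
  assumes ab: "0 < a" "a \<le> b" and f: "continuous_on {x. a \<le> norm x \<and> norm x \<le> b} f"
  shows "integral {x. a < norm x \<and> norm x < b} f =
     integral (box (vector [a, 0]) (vector [b, 2 * pi])) (\<lambda>p::real^2. p $ 1 *\<^sub>R f (circle_pt (p $ 1) (p $ 2)))"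
proof -
  let ?S = "box (vector [a, 0]) (vector [b, 2 * pi]) :: (real^2) set"
  let ?C = "cbox (vector [a, 0]) (vector [b, 2 * pi]) :: (real^2) set"
  let ?g = "\<lambda>p :: real^2. circle_pt (p $ 1) (p $ 2)"
  let ?g' = "\<lambda>p h :: real^2. (h $ 1 * cos (p $ 2) - p $ 1 * (sin (p $ 2) * h $ 2)) *\<^sub>R axis 1 1
      + (h $ 1 * sin (p $ 2) + p $ 1 * (cos (p $ 2) * h $ 2)) *\<^sub>R (axis 2 1 :: real^2)"
  have S: "p \<in> ?S \<longleftrightarrow> a < p $ 1 \<and> p $ 1 < b \<and> 0 < p $ 2 \<and> p $ 2 < 2 * pi" for p
    by (auto simp: mem_box_cart forall_2)
  have C: "p \<in> ?C \<longleftrightarrow> a \<le> p $ 1 \<and> p $ 1 \<le> b \<and> 0 \<le> p $ 2 \<and> p $ 2 \<le> 2 * pi" for p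
    by (auto simp: mem_box_cart forall_2)
  have der: "(?g has_derivative ?g' p) (at p within ?S)" for p
  proof -
    have g: "?g = (\<lambda>p. (p $ 1 * cos (p $ 2)) *\<^sub>R axis 1 1 + (p $ 1 * sin (p $ 2)) *\<^sub>R axis 2 1)"
      by (simp add: circle_pt_def vector2_eq)
    show ?thesis
      unfolding g
      by (auto intro!: derivative_eq_intros bounded_linear_imp_has_derivative[OF bounded_linear_vec_nth] simp: algebra_simps)
  qed
  have inj: "inj_on ?g ?S"
  proof (rule inj_onI)
    fix p q assume "p \<in> ?S" "q \<in> ?S" "?g p = ?g q"
    then have "p $ 1 = q $ 1 \<and> p $ 2 = q $ 2"
      using ab by (intro circle_pt_eqD) (auto simp: S)
    then show "p = q" by (simp add: vec_eq_iff forall_2)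
  qed
  have det: "\<bar>det (matrix (?g' p))\<bar> = p $ 1" if "p \<in> ?S" for p
  proof -
    have "det (matrix (?g' p)) = cos (p $ 2) * (p $ 1 * cos (p $ 2)) + p $ 1 * sin (p $ 2) * sin (p $ 2)"
      by (simp add: det_2 matrix_def axis_def)
    also have "\<dots> = p $ 1 * ((cos (p $ 2))\<^sup>2 + (sin (p $ 2))\<^sup>2)"
      by (simp only: power2_eq_square algebra_simps)
    finally have "det (matrix (?g' p)) = p $ 1 * ((cos (p $ 2))\<^sup>2 + (sin (p $ 2))\<^sup>2)" .
    then show ?thesis using that ab by (simp add: S)
  qed
  have co: "continuous_on ?C (\<lambda>p. p $ 1 *\<^sub>R f (?g p))"
    using ab by (intro continuous_intros continuous_on_compose2[OF f]) (auto simp: C)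
  then have "(\<lambda>p. p $ 1 *\<^sub>R f (?g p)) absolutely_integrable_on ?C"
    by (rule absolutely_integrable_continuous)
  then have "(\<lambda>p. p $ 1 *\<^sub>R f (?g p)) absolutely_integrable_on ?S"
    by (rule set_integrable_subset) (simp_all add: box_subset_cbox)
  then have "(\<lambda>p. \<bar>det (matrix (?g' p))\<bar> *\<^sub>R f (?g p)) absolutely_integrable_on ?S"
    by (subst set_integrable_cong[OF refl refl, of ?S _ "\<lambda>p. p $ 1 *\<^sub>R f (?g p)"]) (simp_all add: det)
  then have "integral (?g ` ?S) f = integral ?S (\<lambda>p. \<bar>det (matrix (?g' p))\<bar> *\<^sub>R f (?g p))"
    using has_absolute_integral_change_of_variables[where f=f and S="?S" and g="?g" and g'="?g'", OF _ der inj] by auto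
  also have "\<dots> = integral ?S (\<lambda>p. p $ 1 *\<^sub>R f (?g p))"
    by (intro Henstock_Kurzweil_Integration.integral_cong) (simp add: det)
  also have "integral (?g ` ?S) f = integral {x. a < norm x \<and> norm x < b} f"
  proof (rule integral_spike_set)
    have "?g ` ?S \<subseteq> {x. a < norm x \<and> norm x < b}"
      using ab by (auto simp: S)
    then have e: "{x \<in> ?g ` ?S - {x. a < norm x \<and> norm x < b}. f x \<noteq> 0} = {}" by blast
    show "negligible {x \<in> ?g ` ?S - {x. a < norm x \<and> norm x < b}. f x \<noteq> 0}" unfolding e by simp
    \<comment> \<open>The open range of angles omits only angle 0, which lies on the null line
      \<open>x $ 2 = 0\<close>.\<close>
    have "{x. a < norm x \<and> norm x < b} - ?g ` ?S \<subseteq> {x. x $ 2 = 0}"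
    proof
      fix x :: "real^2" assume x: "x \<in> {x. a < norm x \<and> norm x < b} - ?g ` ?S"
      obtain t where t: "0 \<le> t" "t < 2 * pi" "x = circle_pt (norm x) t" by (rule circle_pt_surj)
      have "t = 0"
      proof (rule ccontr)
        assume "t \<noteq> 0"
        then have m: "vector [norm x, t] \<in> ?S" using x t by (auto simp: S)
        have e: "x = ?g (vector [norm x, t])" using t(3) by simp
        show False using x image_eqI[where f="?g", OF e m] by blast
      qed
      then show "x \<in> {x. x $ 2 = 0}" using t(3) circle_pt_nth(2)[of "norm x" t] by simp
    qed
    then show "negligible {x \<in> {x. a < norm x \<and> norm x < b} - ?g ` ?S. f x \<noteq> 0}"
      by (intro negligible_subset[OF negligible_standard_hyperplane_cart[of 2]]) auto
  qed
  finally show ?thesis .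
qed

lemma integral_box_vec2:
  fixes q :: "real^2 \<Rightarrow> complex"
  assumes q: "continuous_on (cbox (vector [a, c]) (vector [b, d])) q" and "a \<le> b" "c \<le> d"
  shows "(LINT p:box (vector [a, c]) (vector [b, d])|lborel. q p) =
    (LINT t:{c..d}|lborel. (LINT r:{a..b}|lborel. q (vector [r, t])))"
proof -
  let ?C = "cbox (a, c) (b, d)"
  let ?v = "\<lambda>(x, y). vector [x, y] :: real^2"
  have cv: "continuous_on T ?v" for T
    unfolding vector2_eq case_prod_beta by (intro continuous_intros)
  have v: "?v \<in> borel_measurable lborel"
    using borel_measurable_continuous_onI[OF cv] by simp
  have cq: "continuous_on ?C (\<lambda>p. q (?v p))"
    by (rule continuous_on_compose2[OF q cv]) (auto simp: mem_box_cart forall_2 mem_box Basis_prod_def)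
  have i: "integrable lborel (\<lambda>p. indicator ?C p *\<^sub>R q (?v p))"
    using borel_integrable_compact[OF compact_cbox cq] .
  have "(LINT p:box (vector [a, c]) (vector [b, d])|lborel. q p) = (LINT p:cbox (vector [a, c]) (vector [b, d])|lborel. q p)"
  proof (unfold set_lebesgue_integral_def, rule integral_cong_AE)
    have i2: "integrable lborel (\<lambda>p. indicator (cbox (vector [a, c]) (vector [b, d])) p *\<^sub>R q p)"
      using borel_integrable_compact[OF compact_cbox q] .
    then show "(\<lambda>p. indicat_real (cbox (vector [a, c]) (vector [b, d])) p *\<^sub>R q p) \<in> borel_measurable lborel"
      by auto
    show "(\<lambda>p. indicat_real (box (vector [a, c]) (vector [b, d])) p *\<^sub>R q p) \<in> borel_measurable lborel"
      using borel_measurable_continuous_on_indicator[OF _ continuous_on_subset[OF q box_subset_cbox]] by simp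
    have "negligible (frontier (cbox (vector [a, c]) (vector [b, d]) :: (real^2) set))"
      by (intro negligible_convex_frontier convex_box)
    then have "AE p in lborel. p \<notin> frontier (cbox (vector [a, c]) (vector [b, d]) :: (real^2) set)"
      by (rule AE_not_negligible)
    then show "AE p in lborel. indicat_real (box (vector [a, c]) (vector [b, d])) p *\<^sub>R q p =
      indicat_real (cbox (vector [a, c]) (vector [b, d])) p *\<^sub>R q p"
    proof eventually_elim
      case (elim p)
      then show ?case
        using box_subset_cbox[of "vector [a, c] :: real^2" "vector [b, d]"]
        by (auto simp: indicator_def frontier_cbox)
    qed
  qed
  also have "\<dots> = (LINT p|lborel. indicator (cbox (vector [a, c]) (vector [b, d])) (?v p) *\<^sub>R q (?v p))"
    unfolding set_lebesgue_integral_def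
    by (subst lborel_vec2, subst integral_distr[OF v])
       (use borel_integrable_compact[OF compact_cbox q] in auto)
  also have "\<dots> = (LINT p|lborel. indicator ?C p *\<^sub>R q (?v p))"
    by (intro Bochner_Integration.integral_cong) 
       (auto simp: indicator_def mem_box_cart forall_2 mem_box Basis_prod_def)
  also have "\<dots> = (LINT t|lborel. LINT r|lborel. indicator ?C (r, t) *\<^sub>R q (vector [r, t]))"
  proof -
    let ?P = "\<lambda>p. indicat_real ?C p *\<^sub>R q (?v p)"
    have e: "case_prod (\<lambda>r t. ?P (r, t)) = ?P" by (auto simp: fun_eq_iff)
    show ?thesis
      using lborel_pair.integral_snd[of "\<lambda>r t. ?P (r, t)"] i unfolding e lborel_prod by simp
  qed
  also have "\<dots> = (LINT t:{c..d}|lborel. (LINT r:{a..b}|lborel. q (vector [r, t])))"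
    unfolding set_lebesgue_integral_def integral_scaleR_right[symmetric]
    by (intro Bochner_Integration.integral_cong refl)
       (auto simp: indicator_def mem_box Basis_prod_def)
  finally show ?thesis .
qed

lemma polar_integral:
  fixes f :: "real^2 \<Rightarrow> complex"
  assumes ab: "0 < a" "a \<le> b" and f: "continuous_on {x. a \<le> norm x \<and> norm x \<le> b} f"
  shows "(LINT x:{x. a < norm x \<and> norm x < b}|lborel. f x) =
     (LINT t:{0..2*pi}|lborel. (LINT r:{a..b}|lborel. r *\<^sub>R f (circle_pt r t)))"
proof -
  let ?A = "{x. a < norm x \<and> norm x < b} :: (real^2) set"
  let ?A' = "{x. a \<le> norm x \<and> norm x \<le> b} :: (real^2) set"
  let ?S = "box (vector [a, 0]) (vector [b, 2 * pi]) :: (real^2) set"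
  let ?C = "cbox (vector [a, 0]) (vector [b, 2 * pi]) :: (real^2) set"
  let ?q = "\<lambda>p :: real^2. p $ 1 *\<^sub>R f (circle_pt (p $ 1) (p $ 2))"
  \<comment> \<open>\<open>?V\<close> and \<open>?W\<close> identify the complex numbers with
    \<open>real^2\<close>; being bounded and linear, they commute with the integral.\<close>
  let ?V = "\<lambda>z. vector [Re z, Im z] :: real^2"
  let ?W = "\<lambda>v :: real^2. Complex (v $ 1) (v $ 2)"
  have bV: "bounded_linear ?V"
    unfolding vector2_eq by (intro bounded_linear_add bounded_linear_scaleR_const bounded_linear_Re bounded_linear_Im)
  have W: "?W v = of_real (v $ 1) + \<i> * of_real (v $ 2)" for v
    by (simp add: complex_eq_iff)
  have bW: "bounded_linear ?W"
    unfolding W by (intro bounded_linear_add bounded_linear_mult_const bounded_linear_const_mult 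
        bounded_linear_compose[OF bounded_linear_of_real] bounded_linear_vec_nth)
  have cA: "compact ?A'"
  proof -
    have "?A' = cball 0 b - ball 0 a" by auto
    then show ?thesis by (simp add: compact_diff)
  qed
  have oA: "open ?A"
    by (intro open_Collect_conj open_Collect_less continuous_intros)
  have C: "p \<in> ?C \<longleftrightarrow> a \<le> p $ 1 \<and> p $ 1 \<le> b \<and> 0 \<le> p $ 2 \<and> p $ 2 \<le> 2 * pi" for p
    by (auto simp: mem_box_cart forall_2)
  have co: "continuous_on ?C ?q"
    using ab by (intro continuous_intros continuous_on_compose2[OF f]) (auto simp: C)
  have iA: "set_integrable lborel ?A f"
  proof (rule set_integrable_subset)
    show "set_integrable lborel ?A' f"
      using borel_integrable_compact[OF cA f] by (simp add: set_integrable_def)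
  qed (use oA in auto)
  have iS: "set_integrable lborel ?S ?q"
  proof (rule set_integrable_subset)
    show "set_integrable lborel ?C ?q"
      using borel_integrable_compact[OF compact_cbox co] by (simp add: set_integrable_def)
  qed (auto simp: box_subset_cbox)
  have cV: "continuous_on ?A' (\<lambda>x. ?V (f x))"
    by (intro bounded_linear.continuous_on[OF bV] f)
  have "(LINT x:?A|lborel. f x) = integral ?A f"
    using set_borel_integral_eq_integral[OF iA] by simp
  also have "\<dots> = integral ?A (?W \<circ> (?V \<circ> f))"
    by (intro Henstock_Kurzweil_Integration.integral_cong) simp
  also have "\<dots> = ?W (integral ?A (?V \<circ> f))"
    using set_borel_integral_eq_integral(1)[OF iA]
    by (intro integral_linear integrable_linear bV bW)
  also have "integral ?A (?V \<circ> f) = integral ?S (?V \<circ> ?q)"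
    using polar_change_of_variables[OF ab cV] by (simp add: o_def vec_eq_iff forall_2 vector2_scaleR)
  also have "?W (integral ?S (?V \<circ> ?q)) = integral ?S (?W \<circ> (?V \<circ> ?q))"
    using set_borel_integral_eq_integral(1)[OF iS]
    by (intro integral_linear[symmetric] integrable_linear bV bW)
  also have "\<dots> = integral ?S ?q"
    by (intro Henstock_Kurzweil_Integration.integral_cong) (simp add: complex_eq_iff)
  also have "\<dots> = (LINT p:?S|lborel. ?q p)"
    using set_borel_integral_eq_integral[OF iS] by simp
  also have "\<dots> = (LINT t:{0..2*pi}|lborel. (LINT r:{a..b}|lborel. r *\<^sub>R f (circle_pt r t)))"
    using ab integral_box_vec2[OF co] by simp
  finally show ?thesis .
qed

lemma circle_pt_radial_derivative:
  assumes F: "smooth_on \<Omega> F" "open \<Omega>" "circle_pt r t \<in> \<Omega>"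
  shows "((\<lambda>r. F (circle_pt r t)) has_vector_derivative
     (cos t *\<^sub>R partial_deriv 1 F (circle_pt r t) + sin t *\<^sub>R partial_deriv 2 F (circle_pt r t))) (at r within T)"
proof -
  have "((\<lambda>r. circle_pt r t) has_derivative (\<lambda>h. circle_pt h t)) (at r within T)"
    unfolding circle_pt_def vector2_eq by (auto intro!: derivative_eq_intros)
  from has_derivative_compose[OF this smooth_on_has_derivative[OF F]]
  show ?thesis
    by (simp add: has_vector_derivative_def sum_2 scaleR_add_right)
qed

text \<open>The integrand is the divergence of the field x F(x). In polar coordinates, r times it is
  the r-derivative of r^2 F, so the fundamental theorem of calculus applies on every ray.\<close>

lemma divergence_annulus:
  assumes F: "smooth_on \<Omega> F" "open \<Omega>" and ab: "0 < a" "a \<le> b"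
    and sub: "{x. a \<le> norm x \<and> norm x \<le> b} \<subseteq> \<Omega>"
  shows "(LINT x:{x. a < norm x \<and> norm x < b}|lborel. 2 * F x + (\<Sum>i\<in>UNIV. x $ i *\<^sub>R partial_deriv i F x)) =
    (LINT t:{0..2*pi}|lborel. b\<^sup>2 *\<^sub>R F (circle_pt b t) - a\<^sup>2 *\<^sub>R F (circle_pt a t))"
proof -
  let ?G = "\<lambda>x. 2 * F x + (\<Sum>i\<in>UNIV. x $ i *\<^sub>R partial_deriv i F x)"
  have cG: "continuous_on \<Omega> ?G"
    by (intro continuous_intros smooth_on_continuous_on[OF F(1)] smooth_on_continuous_on[OF smooth_on_partial_deriv[OF F(1)]])
  have "(LINT r:{a..b}|lborel. r *\<^sub>R ?G (circle_pt r t)) = b\<^sup>2 *\<^sub>R F (circle_pt b t) - a\<^sup>2 *\<^sub>R F (circle_pt a t)" for t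
    unfolding set_lebesgue_integral_def
  proof (rule integral_FTC_atLeastAtMost[OF ab(2)])
    fix r assume r: "a \<le> r" "r \<le> b"
    have "circle_pt r t \<in> \<Omega>" using r ab sub by auto
    note d = circle_pt_radial_derivative[OF F this]
    have "((\<lambda>r. r\<^sup>2 *\<^sub>R F (circle_pt r t)) has_vector_derivative
       (r\<^sup>2 *\<^sub>R (cos t *\<^sub>R partial_deriv 1 F (circle_pt r t) + sin t *\<^sub>R partial_deriv 2 F (circle_pt r t))
        + (2 * r) *\<^sub>R F (circle_pt r t))) (at r within {a..b})"
      by (rule has_vector_derivative_scaleR[OF _ d]) (auto intro!: derivative_eq_intros)
    moreover have "r\<^sup>2 *\<^sub>R (cos t *\<^sub>R partial_deriv 1 F (circle_pt r t) + sin t *\<^sub>R partial_deriv 2 F (circle_pt r t))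
        + (2 * r) *\<^sub>R F (circle_pt r t) = r *\<^sub>R ?G (circle_pt r t)"
      by (simp add: sum_2 scaleR_conv_of_real power2_eq_square algebra_simps)
    ultimately show "((\<lambda>r. r\<^sup>2 *\<^sub>R F (circle_pt r t)) has_vector_derivative r *\<^sub>R ?G (circle_pt r t)) (at r within {a..b})"
      by simp
  next
    show "continuous_on {a..b} (\<lambda>r. r *\<^sub>R ?G (circle_pt r t))"
      using ab sub by (intro continuous_intros continuous_on_compose2[OF cG]) auto
  qed
  then show ?thesis
    using polar_integral[OF ab continuous_on_subset[OF cG sub]] by simp
qed

section \<open>Weak derivatives and square-integrable functions\<close>

lemma locally_integrable_on_subset: "locally_integrable_on \<Omega> f \<Longrightarrow> \<Omega>' \<subseteq> \<Omega> \<Longrightarrow> locally_integrable_on \<Omega>' f"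
  unfolding locally_integrable_on_def by blast

lemma locally_integrable_on_continuous: "continuous_on \<Omega> f \<Longrightarrow> locally_integrable_on \<Omega> f"
  unfolding locally_integrable_on_def set_integrable_def
  by (blast intro: borel_integrable_compact continuous_on_subset)

lemma locally_integrable_on_add:
  "locally_integrable_on \<Omega> f \<Longrightarrow> locally_integrable_on \<Omega> g \<Longrightarrow> locally_integrable_on \<Omega> (\<lambda>x. f x + g x)"
  unfolding locally_integrable_on_def by (blast intro: set_integral_add)

lemma locally_integrable_on_diff:
  "locally_integrable_on \<Omega> f \<Longrightarrow> locally_integrable_on \<Omega> g \<Longrightarrow> locally_integrable_on \<Omega> (\<lambda>x. f x - g x)"
  unfolding locally_integrable_on_def by (blast intro: set_integral_diff)

lemma integrable_mult_test:
  assumes "locally_integrable_on \<Omega> f" "\<psi> \<in> test_functions \<Omega>"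
  shows "integrable lborel (\<lambda>x. f x * \<psi> x)"
proof -
  obtain K where K: "smooth_on UNIV \<psi>" "compact K" "K \<subseteq> \<Omega>" "\<And>x. x \<notin> K \<Longrightarrow> \<psi> x = 0"
    using assms(2) unfolding test_functions_def by blast
  obtain C where C: "C > 0" "\<And>x. cmod (\<psi> x) \<le> C"
    using test_functions_bounded[OF assms(2)] by metis
  have i: "integrable lborel (\<lambda>x. indicat_real K x *\<^sub>R f x)"
    using assms(1) K(2,3) by (auto simp: locally_integrable_on_def set_integrable_def)
  have "integrable lborel (\<lambda>x. \<psi> x * (indicat_real K x *\<^sub>R f x))"
    by (rule integrable_mult_bounded[OF i smooth_on_UNIV_borel_measurable[OF K(1)] C(2)])
  moreover have "(\<lambda>x. \<psi> x * (indicat_real K x *\<^sub>R f x)) = (\<lambda>x. f x * \<psi> x)"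
    using K(4) by (auto simp: fun_eq_iff indicator_def)
  ultimately show ?thesis by simp
qed

lemma set_integral_test:
  assumes "\<psi> \<in> test_functions \<Omega>"
  shows "(LINT x:\<Omega>|lborel. f x * \<psi> x) = (LINT x|lborel. f x * \<psi> x)"
  unfolding set_lebesgue_integral_def
  by (intro Bochner_Integration.integral_cong refl)
     (auto simp: indicator_def test_functions_outside[OF assms])

lemma weak_partial_alt:
  "weak_partial \<Omega> i f g \<longleftrightarrow>
     locally_integrable_on \<Omega> f \<and> locally_integrable_on \<Omega> g \<and>
     (\<forall>\<phi>\<in>test_functions \<Omega>. (LINT x|lborel. f x * partial_deriv i \<phi> x) = - (LINT x|lborel. g x * \<phi> x))"
  unfolding weak_partial_def by (simp add: set_integral_test test_functions_partial_deriv)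

lemma weak_laplacian_alt:
  "weak_laplacian \<Omega> f g \<longleftrightarrow>
     locally_integrable_on \<Omega> f \<and> locally_integrable_on \<Omega> g \<and>
     (\<forall>\<phi>\<in>test_functions \<Omega>. (LINT x|lborel. f x * laplacian \<phi> x) = (LINT x|lborel. g x * \<phi> x))"
  unfolding weak_laplacian_def by (simp add: set_integral_test test_functions_laplacian)

lemma weak_partial_subset: "weak_partial \<Omega> i f g \<Longrightarrow> \<Omega>' \<subseteq> \<Omega> \<Longrightarrow> weak_partial \<Omega>' i f g"
  unfolding weak_partial_alt using locally_integrable_on_subset test_functions_mono by blast

lemma weak_laplacian_subset: "weak_laplacian \<Omega> f g \<Longrightarrow> \<Omega>' \<subseteq> \<Omega> \<Longrightarrow> weak_laplacian \<Omega>' f g"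
  unfolding weak_laplacian_alt using locally_integrable_on_subset test_functions_mono by blast

lemma integral_cong_AE_test:
  assumes "locally_integrable_on \<Omega> f" "locally_integrable_on \<Omega> g"
    and "AE x in lborel. x \<in> \<Omega> \<longrightarrow> f x = g x" "\<psi> \<in> test_functions \<Omega>"
  shows "(LINT x|lborel. f x * \<psi> x) = (LINT x|lborel. g x * \<psi> x)"
proof (rule integral_cong_AE)
  show "AE x in lborel. f x * \<psi> x = g x * \<psi> x"
    using assms(3) by eventually_elim (use test_functions_outside[OF assms(4)] in auto)
qed (use integrable_mult_test[OF assms(1,4)] integrable_mult_test[OF assms(2,4)] in auto)

lemma AE_eq_if_test_integrals_eq:
  assumes "open \<Omega>" "locally_integrable_on \<Omega> f" "locally_integrable_on \<Omega> g"
    and "\<And>\<phi>. \<phi> \<in> test_functions \<Omega> \<Longrightarrow> (LINT x|lborel. f x * \<phi> x) = (LINT x|lborel. g x * \<phi> x)"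
  shows "AE x in lborel. x \<in> \<Omega> \<longrightarrow> f x = g x"
proof -
  have "AE x in lborel. x \<in> \<Omega> \<longrightarrow> f x - g x = 0"
  proof (rule fundamental_lemma_of_variations[OF assms(1) locally_integrable_on_diff[OF assms(2,3)]])
    fix \<phi> assume \<phi>: "\<phi> \<in> test_functions \<Omega>"
    then have "(LINT x|lborel. (f x - g x) * \<phi> x) = (LINT x|lborel. f x * \<phi> x) - (LINT x|lborel. g x * \<phi> x)"
      using integrable_mult_test[OF assms(2) \<phi>] integrable_mult_test[OF assms(3) \<phi>]
      by (simp add: left_diff_distrib)
    with assms(4)[OF \<phi>] show "(LINT x:\<Omega>|lborel. (f x - g x) * \<phi> x) = 0"
      by (simp only: set_integral_test[OF \<phi>] diff_self)
  qed
  then show ?thesis by simp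
qed

lemma weak_partial_unique:
  assumes "open \<Omega>" "weak_partial \<Omega> i f g" "weak_partial \<Omega> i f' g'" "AE x in lborel. x \<in> \<Omega> \<longrightarrow> f x = f' x"
  shows "AE x in lborel. x \<in> \<Omega> \<longrightarrow> g x = g' x"
proof (rule AE_eq_if_test_integrals_eq[OF assms(1)])
  fix \<phi> assume \<phi>: "\<phi> \<in> test_functions \<Omega>"
  have "(LINT x|lborel. f x * partial_deriv i \<phi> x) = (LINT x|lborel. f' x * partial_deriv i \<phi> x)"
    using assms \<phi> by (intro integral_cong_AE_test[of \<Omega>] test_functions_partial_deriv) (auto simp: weak_partial_alt)
  moreover have "(LINT x|lborel. f x * partial_deriv i \<phi> x) = - (LINT x|lborel. g x * \<phi> x)"
      "(LINT x|lborel. f' x * partial_deriv i \<phi> x) = - (LINT x|lborel. g' x * \<phi> x)"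
    using assms(2,3) \<phi> by (simp_all add: weak_partial_alt)
  ultimately show "(LINT x|lborel. g x * \<phi> x) = (LINT x|lborel. g' x * \<phi> x)" by simp
qed (use assms in \<open>auto simp: weak_partial_alt\<close>)

lemma weak_laplacian_unique:
  assumes "open \<Omega>" "weak_laplacian \<Omega> f g" "weak_laplacian \<Omega> f' g'" "AE x in lborel. x \<in> \<Omega> \<longrightarrow> f x = f' x"
  shows "AE x in lborel. x \<in> \<Omega> \<longrightarrow> g x = g' x"
proof (rule AE_eq_if_test_integrals_eq[OF assms(1)])
  fix \<phi> assume \<phi>: "\<phi> \<in> test_functions \<Omega>"
  have "(LINT x|lborel. f x * laplacian \<phi> x) = (LINT x|lborel. f' x * laplacian \<phi> x)"
    using assms \<phi> by (intro integral_cong_AE_test[of \<Omega>] test_functions_laplacian) (auto simp: weak_laplacian_alt)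
  moreover have "(LINT x|lborel. f x * laplacian \<phi> x) = (LINT x|lborel. g x * \<phi> x)"
      "(LINT x|lborel. f' x * laplacian \<phi> x) = (LINT x|lborel. g' x * \<phi> x)"
    using assms(2,3) \<phi> by (simp_all add: weak_laplacian_alt)
  ultimately show "(LINT x|lborel. g x * \<phi> x) = (LINT x|lborel. g' x * \<phi> x)" by simp
qed (use assms in \<open>auto simp: weak_laplacian_alt\<close>)

text \<open>The product of \<open>H\<close> and \<open>\<phi>\<close> is itself a test function, so
  its partial derivatives have integral 0.\<close>

lemma integration_by_parts_test:
  assumes "open \<Omega>" "smooth_on \<Omega> H" "\<phi> \<in> test_functions \<Omega>"
  shows "(LINT x|lborel. H x * partial_deriv i \<phi> x) = - (LINT x|lborel. partial_deriv i H x * \<phi> x)"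
proof -
  have "(LINT x|lborel. partial_deriv i (\<lambda>x. H x * \<phi> x) x) = 0"
    by (rule integral_partial_deriv_test[OF test_functions_mult[OF assms]])
  moreover have "partial_deriv i (\<lambda>x. H x * \<phi> x) x = partial_deriv i H x * \<phi> x + H x * partial_deriv i \<phi> x" for x
  proof (cases "x \<in> \<Omega>")
    case True
    then show ?thesis
      using smooth_on_differentiable[OF assms(2,1)] smooth_on_differentiable[OF test_functions_smooth[OF assms(3)]]
      by (intro partial_deriv_mult) auto
  next
    case False
    then show ?thesis
      using test_functions_outside[OF test_functions_partial_deriv[OF test_functions_mult[OF assms]] False]
        test_functions_outside[OF test_functions_partial_deriv[OF assms(3)] False] test_functions_outside[OF assms(3) False]
      by simp
  qed
  moreover have "integrable lborel (\<lambda>x. partial_deriv i H x * \<phi> x)" "integrable lborel (\<lambda>x. H x * partial_deriv i \<phi> x)"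
    by (intro integrable_mult_test[of \<Omega>] locally_integrable_on_continuous smooth_on_continuous_on
        smooth_on_partial_deriv test_functions_partial_deriv assms)+
  ultimately show ?thesis by (simp add: add_eq_0_iff)
qed

lemma smooth_on_weak_partial:
  assumes "open \<Omega>" "smooth_on \<Omega> H"
  shows "weak_partial \<Omega> i H (partial_deriv i H)"
  unfolding weak_partial_alt
  by (intro conjI ballI integration_by_parts_test[OF assms] assms locally_integrable_on_continuous
      smooth_on_continuous_on smooth_on_partial_deriv)

lemma weak_laplacian_of_partials:
  assumes "open \<Omega>" "\<And>i. weak_partial \<Omega> i f (g i)" "\<And>i. weak_partial \<Omega> i (g i) (h i)"
  shows "weak_laplacian \<Omega> f (\<lambda>x. \<Sum>i\<in>UNIV. h i x)"
proof -
  have f: "locally_integrable_on \<Omega> f" and h: "locally_integrable_on \<Omega> (h i)" for i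
    using assms(2,3) by (auto simp: weak_partial_alt)
  have "(LINT x|lborel. f x * laplacian \<phi> x) = (LINT x|lborel. (\<Sum>i\<in>UNIV. h i x) * \<phi> x)"
    if \<phi>: "\<phi> \<in> test_functions \<Omega>" for \<phi>
  proof -
    note d\<phi> = test_functions_partial_deriv[OF \<phi>]
    have "(LINT x|lborel. f x * laplacian \<phi> x) = (LINT x|lborel. (\<Sum>i\<in>UNIV. f x * partial_deriv i (partial_deriv i \<phi>) x))"
      by (simp add: laplacian_def sum_distrib_left)
    also have "\<dots> = (\<Sum>i\<in>UNIV. LINT x|lborel. f x * partial_deriv i (partial_deriv i \<phi>) x)"
      by (intro Bochner_Integration.integral_sum integrable_mult_test[OF f] test_functions_partial_deriv \<phi>)
    also have "\<dots> = (\<Sum>i\<in>UNIV. LINT x|lborel. h i x * \<phi> x)"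
      using assms(2,3) \<phi> d\<phi> by (intro sum.cong refl) (simp add: weak_partial_alt)
    also have "\<dots> = (LINT x|lborel. (\<Sum>i\<in>UNIV. h i x * \<phi> x))"
      by (intro Bochner_Integration.integral_sum[symmetric] integrable_mult_test[OF h] \<phi>)
    finally show ?thesis by (simp add: sum_distrib_right)
  qed
  moreover have "locally_integrable_on \<Omega> (\<lambda>x. \<Sum>i\<in>UNIV. h i x)"
    unfolding sum_2 by (intro locally_integrable_on_add h)
  ultimately show ?thesis using f by (simp add: weak_laplacian_alt)
qed

lemma smooth_on_weak_laplacian:
  assumes "open \<Omega>" "smooth_on \<Omega> H"
  shows "weak_laplacian \<Omega> H (laplacian H)"
  unfolding laplacian_def [abs_def]
  by (intro weak_laplacian_of_partials[where g="\<lambda>i. partial_deriv i H"] smooth_on_weak_partial smooth_on_partial_deriv assms)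

lemma weak_partial_sum2:
  assumes "\<And>j::2. weak_partial \<Omega> i (f j) (g j)"
  shows "weak_partial \<Omega> i (\<lambda>x. \<Sum>j\<in>UNIV. f j x) (\<lambda>x. \<Sum>j\<in>UNIV. g j x)"
proof -
  have f: "locally_integrable_on \<Omega> (f j)" and g: "locally_integrable_on \<Omega> (g j)" for j
    using assms by (auto simp: weak_partial_alt)
  have "(LINT x|lborel. (\<Sum>j\<in>UNIV. f j x) * partial_deriv i \<phi> x) = - (LINT x|lborel. (\<Sum>j\<in>UNIV. g j x) * \<phi> x)"
    if \<phi>: "\<phi> \<in> test_functions \<Omega>" for \<phi>
    using assms \<phi> integrable_mult_test[OF f test_functions_partial_deriv[OF \<phi>]] integrable_mult_test[OF g \<phi>]
    by (simp add: weak_partial_alt sum_2 distrib_right)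
  then show ?thesis
    unfolding weak_partial_alt sum_2 by (auto intro: locally_integrable_on_add f g)
qed

lemma weak_laplacian_diff:
  assumes "weak_laplacian \<Omega> f f'" "weak_laplacian \<Omega> g g'"
  shows "weak_laplacian \<Omega> (\<lambda>x. f x - g x) (\<lambda>x. f' x - g' x)"
proof -
  have *: "locally_integrable_on \<Omega> f" "locally_integrable_on \<Omega> g" "locally_integrable_on \<Omega> f'" "locally_integrable_on \<Omega> g'"
    using assms by (auto simp: weak_laplacian_alt)
  have "(LINT x|lborel. (f x - g x) * laplacian \<phi> x) = (LINT x|lborel. (f' x - g' x) * \<phi> x)"
    if \<phi>: "\<phi> \<in> test_functions \<Omega>" for \<phi>
    using assms \<phi> *[THEN integrable_mult_test, OF test_functions_laplacian[OF \<phi>]] *[THEN integrable_mult_test, OF \<phi>]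
    by (simp add: weak_laplacian_alt left_diff_distrib)
  with * show ?thesis
    unfolding weak_laplacian_alt by (auto intro: locally_integrable_on_diff)
qed

text \<open>\<open>L2_on\<close> over an arbitrary Euclidean space: boundary values are square
  integrable over an interval of angles.\<close>

definition square_integrable_on :: "'a::euclidean_space set \<Rightarrow> ('a \<Rightarrow> complex) \<Rightarrow> bool" where
  "square_integrable_on B f \<longleftrightarrow> set_borel_measurable lborel B f \<and> set_integrable lborel B (\<lambda>x. (cmod (f x))\<^sup>2)"

lemma L2_on_iff: "L2_on B f \<longleftrightarrow> square_integrable_on B f"
  by (simp add: L2_on_def square_integrable_on_def)

lemma cmod_add_sq: "(cmod (a + b))\<^sup>2 \<le> 2 * (cmod a)\<^sup>2 + 2 * (cmod b)\<^sup>2"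
proof -
  have "(cmod (a + b))\<^sup>2 \<le> (cmod a + cmod b)\<^sup>2"
    by (intro power_mono norm_triangle_ineq) simp
  also have "\<dots> \<le> 2 * (cmod a)\<^sup>2 + 2 * (cmod b)\<^sup>2"
    using zero_le_power2[of "cmod a - cmod b"] by (simp add: power2_sum power2_diff)
  finally show ?thesis .
qed

lemma square_integrable_on_add:
  assumes "square_integrable_on B f" "square_integrable_on B g"
  shows "square_integrable_on B (\<lambda>x. f x + g x)"
proof -
  have m: "set_borel_measurable lborel B (\<lambda>x. f x + g x)"
    using assms unfolding square_integrable_on_def set_borel_measurable_def by (auto simp: scaleR_add_right)
  have "integrable lborel (\<lambda>x. indicat_real B x *\<^sub>R (cmod (f x + g x))\<^sup>2)"
  proof (rule Bochner_Integration.integrable_bound)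
    show "integrable lborel (\<lambda>x. 2 * (indicat_real B x *\<^sub>R (cmod (f x))\<^sup>2) + 2 * (indicat_real B x *\<^sub>R (cmod (g x))\<^sup>2))"
      using assms unfolding square_integrable_on_def set_integrable_def by (intro Bochner_Integration.integrable_add integrable_mult_right) auto
    have "(\<lambda>x. (cmod (indicat_real B x *\<^sub>R (f x + g x)))\<^sup>2) \<in> borel_measurable lborel"
      using m unfolding set_borel_measurable_def by measurable
    moreover have "(\<lambda>x. (cmod (indicat_real B x *\<^sub>R (f x + g x)))\<^sup>2) = (\<lambda>x. indicat_real B x *\<^sub>R (cmod (f x + g x))\<^sup>2)"
      by (auto simp: indicator_def)
    ultimately show "(\<lambda>x. indicat_real B x *\<^sub>R (cmod (f x + g x))\<^sup>2) \<in> borel_measurable lborel" by simp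
    show "AE x in lborel. norm (indicat_real B x *\<^sub>R (cmod (f x + g x))\<^sup>2)
        \<le> norm (2 * (indicat_real B x *\<^sub>R (cmod (f x))\<^sup>2) + 2 * (indicat_real B x *\<^sub>R (cmod (g x))\<^sup>2))"
      using cmod_add_sq by (intro AE_I2) (auto simp: indicator_def)
  qed
  with m show ?thesis by (simp add: square_integrable_on_def set_integrable_def)
qed

lemma square_integrable_on_uminus: "square_integrable_on B f \<Longrightarrow> square_integrable_on B (\<lambda>x. - f x)"
  unfolding square_integrable_on_def set_borel_measurable_def by simp

lemma square_integrable_on_diff:
  "square_integrable_on B f \<Longrightarrow> square_integrable_on B g \<Longrightarrow> square_integrable_on B (\<lambda>x. f x - g x)"
  using square_integrable_on_add[OF _ square_integrable_on_uminus] by fastforce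

lemma square_integrable_on_continuous:
  assumes "continuous_on K f" "compact K" "B \<subseteq> K" "B \<in> sets borel"
  shows "square_integrable_on B f"
  unfolding square_integrable_on_def
proof
  show "set_borel_measurable lborel B f"
    unfolding set_borel_measurable_def
    using borel_measurable_continuous_on_indicator[OF assms(4) continuous_on_subset[OF assms(1,3)]] by simp
  have "set_integrable lborel K (\<lambda>x. (cmod (f x))\<^sup>2)"
    unfolding set_integrable_def
    by (intro borel_integrable_compact assms(2) continuous_intros assms(1))
  then show "set_integrable lborel B (\<lambda>x. (cmod (f x))\<^sup>2)"
    by (rule set_integrable_subset) (use assms in auto)
qed

lemma square_integrable_imp_integrable:
  assumes "square_integrable_on B f" "B \<in> sets borel" "emeasure lborel B < \<infinity>"
  shows "set_integrable lborel B f"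
  unfolding set_integrable_def
proof (rule Bochner_Integration.integrable_bound)
  show "integrable lborel (\<lambda>x. indicat_real B x + indicat_real B x *\<^sub>R (cmod (f x))\<^sup>2)"
    using assms by (auto simp: square_integrable_on_def set_integrable_def)
  show "(\<lambda>x. indicat_real B x *\<^sub>R f x) \<in> borel_measurable lborel"
    using assms(1) by (simp add: square_integrable_on_def set_borel_measurable_def)
  have "a \<le> 1 + a\<^sup>2" for a :: real
  proof -
    have "2 * a \<le> a\<^sup>2 + 1" using zero_le_power2[of "a - 1"] by (simp add: power2_diff)
    moreover have "0 \<le> a\<^sup>2" by simp
    ultimately show ?thesis by linarith
  qed
  then show "AE x in lborel. norm (indicat_real B x *\<^sub>R f x) \<le> norm (indicat_real B x + indicat_real B x *\<^sub>R (cmod (f x))\<^sup>2)"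
    by (intro AE_I2) (auto simp: indicator_def)
qed

text \<open>The integral of (|f| - a)^2 is a nonnegative quadratic polynomial in \<open>a\<close>;
  its value at the minimum a = ?I / ?m gives the inequality.\<close>

lemma Cauchy_Schwarz_set_integral:
  assumes f: "square_integrable_on B f" and B: "B \<in> sets borel" "emeasure lborel B < \<infinity>"
  shows "(LINT x:B|lborel. cmod (f x)) \<le> sqrt (measure lborel B) * sqrt (LINT x:B|lborel. (cmod (f x))\<^sup>2)"
proof -
  let ?m = "measure lborel B" and ?I = "LINT x:B|lborel. cmod (f x)" and ?J = "LINT x:B|lborel. (cmod (f x))\<^sup>2"
  have i: "set_integrable lborel B (\<lambda>x. cmod (f x))"
    using square_integrable_imp_integrable[OF assms] by (rule set_integrable_norm)
  have j: "set_integrable lborel B (\<lambda>x. (cmod (f x))\<^sup>2)" using f by (simp add: square_integrable_on_def)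
  have c: "set_integrable lborel B (\<lambda>x. a)" for a :: real
    using B by (simp add: set_integrable_def)
  have "0 \<le> ?J - 2 * a * ?I + a\<^sup>2 * ?m" for a
  proof -
    have "0 \<le> (LINT x:B|lborel. (cmod (f x) - a)\<^sup>2)"
      by (simp add: set_lebesgue_integral_def)
    also have "\<dots> = (LINT x:B|lborel. (cmod (f x))\<^sup>2 - (2 * a) * cmod (f x) + a\<^sup>2)"
      by (simp add: power2_diff algebra_simps)
    also have "\<dots> = ?J - 2 * a * ?I + a\<^sup>2 * ?m"
      using i j c[of "a\<^sup>2"] B
      by (simp add: set_integral_add set_integral_diff set_integrable_mult_right)
         (simp add: set_lebesgue_integral_def)
    finally show ?thesis .
  qed
  note q = this
  have I: "?I \<ge> 0" by (simp add: set_lebesgue_integral_def)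
  have "?I\<^sup>2 \<le> ?m * ?J"
  proof (cases "?m = 0")
    case True
    \<comment> \<open>For measure 0 the polynomial is linear and nonnegative, so its slope vanishes:
      this choice of \<open>a\<close> would give the negative value
      \<open>?J - 2 * (?J + 1)\<close>.\<close>
    have "2 * (?J + 1) * ?I \<le> ?J * ?I" if "?I > 0"
      using q[of "(?J + 1) / ?I"] True that by (simp add: field_simps)
    moreover have "?J \<ge> 0" by (simp add: set_lebesgue_integral_def)
    ultimately have "?I = 0"
      using I by (smt (verit) mult_right_less_imp_less mult_left_mono mult_le_cancel_right)
    with True show ?thesis by simp
  next
    case False
    then have m: "?m > 0" by (simp add: zero_less_measure_iff)
    have "?J - 2 * (?I / ?m) * ?I + (?I / ?m)\<^sup>2 * ?m = ?J - ?I\<^sup>2 / ?m"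
      using m by (simp add: field_simps power2_eq_square)
    with q[of "?I / ?m"] have "?I\<^sup>2 / ?m \<le> ?J" by simp
    then show ?thesis using m by (simp add: field_simps)
  qed
  then have "?I \<le> sqrt (?m * ?J)" by (rule real_le_rsqrt)
  then show ?thesis by (simp add: real_sqrt_mult)
qed

lemma set_integral_mult_bound:
  assumes f: "square_integrable_on B f" and B: "B \<in> sets borel" "emeasure lborel B < \<infinity>"
    and \<psi>: "\<psi> \<in> borel_measurable borel" "\<And>x. x \<in> B \<Longrightarrow> cmod (\<psi> x) \<le> C" and C: "C \<ge> 0"
  shows "set_integrable lborel B (\<lambda>x. f x * \<psi> x)"
    and "cmod (LINT x:B|lborel. f x * \<psi> x) \<le> C * (sqrt (measure lborel B) * sqrt (LINT x:B|lborel. (cmod (f x))\<^sup>2))"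
proof -
  have i: "set_integrable lborel B f" by (rule square_integrable_imp_integrable[OF f B])
  have n: "norm (indicat_real B x *\<^sub>R (f x * \<psi> x)) \<le> C * (indicat_real B x *\<^sub>R cmod (f x))" for x
    using \<psi>(2)[of x] C by (auto simp: indicator_def norm_mult mult.commute intro!: mult_right_mono)
  have i2: "integrable lborel (\<lambda>x. C * (indicat_real B x *\<^sub>R cmod (f x)))"
    using set_integrable_norm[OF i] by (simp add: set_integrable_def)
  show s: "set_integrable lborel B (\<lambda>x. f x * \<psi> x)"
    unfolding set_integrable_def
  proof (rule Bochner_Integration.integrable_bound[OF i2])
    have "(\<lambda>x. (indicat_real B x *\<^sub>R f x) * \<psi> x) \<in> borel_measurable lborel"
      using i \<psi>(1) unfolding set_integrable_def by (intro borel_measurable_times) auto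
    then show "(\<lambda>x. indicat_real B x *\<^sub>R (f x * \<psi> x)) \<in> borel_measurable lborel" by simp
    show "AE x in lborel. norm (indicat_real B x *\<^sub>R (f x * \<psi> x)) \<le> norm (C * (indicat_real B x *\<^sub>R cmod (f x)))"
      using n order_trans[OF _ abs_ge_self] by (intro AE_I2) auto
  qed
  have "cmod (LINT x:B|lborel. f x * \<psi> x) \<le> (LINT x|lborel. norm (indicat_real B x *\<^sub>R (f x * \<psi> x)))"
    unfolding set_lebesgue_integral_def by (rule integral_norm_bound)
  also have "\<dots> \<le> (LINT x|lborel. C * (indicat_real B x *\<^sub>R cmod (f x)))"
    using s i2 n by (intro integral_mono integrable_norm) (simp_all add: set_integrable_def)
  also have "\<dots> = C * (LINT x:B|lborel. cmod (f x))" by (simp add: set_lebesgue_integral_def)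
  also have "\<dots> \<le> C * (sqrt (measure lborel B) * sqrt (LINT x:B|lborel. (cmod (f x))\<^sup>2))"
    using Cauchy_Schwarz_set_integral[OF f B] C by (rule mult_left_mono)
  finally show "cmod (LINT x:B|lborel. f x * \<psi> x) \<le> C * (sqrt (measure lborel B) * sqrt (LINT x:B|lborel. (cmod (f x))\<^sup>2))" .
qed

lemma set_integral_L2_convergence:
  assumes f: "\<And>j. square_integrable_on B (f j)" "square_integrable_on B g" and B: "B \<in> sets borel" "emeasure lborel B < \<infinity>"
    and \<psi>: "\<psi> \<in> borel_measurable borel" "\<And>x. x \<in> B \<Longrightarrow> cmod (\<psi> x) \<le> C" and C: "C \<ge> 0"
    and lim: "(\<lambda>j. sqrt (LINT x:B|lborel. (cmod (f j x - g x))\<^sup>2)) \<longlonglongrightarrow> 0"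
  shows "(\<lambda>j. LINT x:B|lborel. f j x * \<psi> x) \<longlonglongrightarrow> (LINT x:B|lborel. g x * \<psi> x)"
proof (rule LIM_zero_cancel, rule Lim_null_comparison)
  show "(\<lambda>j. C * (sqrt (measure lborel B) * sqrt (LINT x:B|lborel. (cmod (f j x - g x))\<^sup>2))) \<longlonglongrightarrow> 0"
    by (intro tendsto_mult_right_zero lim)
  have "(LINT x:B|lborel. f j x * \<psi> x) - (LINT x:B|lborel. g x * \<psi> x) = (LINT x:B|lborel. (f j x - g x) * \<psi> x)" for j
    using set_integral_mult_bound(1)[OF f(1) B \<psi> C] set_integral_mult_bound(1)[OF f(2) B \<psi> C]
    by (simp add: left_diff_distrib set_integral_diff)
  then show "\<forall>\<^sub>F j in sequentially. norm ((LINT x:B|lborel. f j x * \<psi> x) - (LINT x:B|lborel. g x * \<psi> x))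
      \<le> C * (sqrt (measure lborel B) * sqrt (LINT x:B|lborel. (cmod (f j x - g x))\<^sup>2))"
    using set_integral_mult_bound(2)[OF square_integrable_on_diff[OF f] B \<psi> C] by simp
qed

section \<open>Traces and angular modes\<close>

text \<open>This is r^|m| exp(i m t), written as a power of z or of its conjugate; as a polynomial
  in the coordinates it is smooth at the origin too, where there is no angle.\<close>

definition ang :: "int \<Rightarrow> real^2 \<Rightarrow> complex" where
  "ang m x = (if m \<ge> 0 then (of_real (x $ 1) + \<i> * of_real (x $ 2)) ^ nat m
     else (of_real (x $ 1) - \<i> * of_real (x $ 2)) ^ nat (- m))"

lemma smooth_on_ang: "open \<Omega> \<Longrightarrow> smooth_on \<Omega> (ang m)"
  unfolding ang_def [abs_def]
  by (cases "m \<ge> 0") (simp_all add: smooth_on_power smooth_on_add smooth_on_diff smooth_on_mult)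

lemma ang_circle_pt: "ang m (circle_pt r t) = of_real (r ^ nat \<bar>m\<bar>) * cis (of_int m * t)"
proof -
  have p: "of_real (r * cos t) + \<i> * of_real (r * sin t) = of_real r * cis t"
    "of_real (r * cos t) - \<i> * of_real (r * sin t) = of_real r * cis (- t)"
    by (simp_all add: complex_eq_iff)
  have q: "cis t ^ nat m = cis (of_int m * t)" if "m \<ge> 0"
    using Complex.DeMoivre[of t "nat m"] that by simp
  have q': "cis (- t) ^ nat (- m) = cis (of_int m * t)" if "\<not> m \<ge> 0"
    using Complex.DeMoivre[of "- t" "nat (- m)"] that by simp
  show ?thesis
    unfolding ang_def circle_pt_nth p
    by (cases "m \<ge> 0") (simp_all add: power_mult_distrib q q')
qed

lemma norm_sq_vec2: "(norm x)\<^sup>2 = (x $ 1)\<^sup>2 + (x $ 2)\<^sup>2" for x :: "real^2"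
  by (simp add: norm_vec_def L2_set_def sum_2)

text \<open>The radial profile of \<open>cutoff\<close>: positive strictly between R / 2 and 2 R,
  zero at all other nonnegative radii, and including the factor r^|m| of \<open>ang\<close>.\<close>

definition cutoff_weight :: "real \<Rightarrow> int \<Rightarrow> real \<Rightarrow> real" where
  "cutoff_weight R m r = bump (r\<^sup>2 - (R / 2)\<^sup>2) * bump ((2 * R)\<^sup>2 - r\<^sup>2) * r ^ nat \<bar>m\<bar>"

text \<open>The squared norm is used because it is a polynomial and hence smooth.\<close>

definition cutoff :: "real \<Rightarrow> int \<Rightarrow> real^2 \<Rightarrow> complex" where
  "cutoff R m x = of_real (bump ((norm x)\<^sup>2 - (R / 2)\<^sup>2)) * of_real (bump ((2 * R)\<^sup>2 - (norm x)\<^sup>2)) * ang m x"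

lemma cutoff_circle_pt: "cutoff R m (circle_pt r t) = of_real (cutoff_weight R m r) * cis (of_int m * t)"
  by (simp add: cutoff_def cutoff_weight_def ang_circle_pt)

lemma continuous_on_bump: "continuous_on S bump"
  using bump_deriv_has_derivative DERIV_isCont continuous_at_imp_continuous_on by blast

lemma cutoff_weight_isCont: "isCont (cutoff_weight R m) r"
proof -
  have "continuous_on UNIV (cutoff_weight R m)"
    unfolding cutoff_weight_def [abs_def]
    by (intro continuous_intros continuous_on_compose2[OF continuous_on_bump[of UNIV]]) auto
  then show ?thesis by (simp add: continuous_on_eq_continuous_at)
qed

lemma cutoff_weight_pos:
  assumes "0 < R" "R / 2 < r" "r < 2 * R"
  shows "cutoff_weight R m r > 0"
proof -
  have "(R / 2)\<^sup>2 < r\<^sup>2" "r\<^sup>2 < (2 * R)\<^sup>2"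
    using assms by (intro power_strict_mono; simp)+
  then have "bump (r\<^sup>2 - (R / 2)\<^sup>2) > 0" "bump ((2 * R)\<^sup>2 - r\<^sup>2) > 0"
    unfolding bump_pos_iff by linarith+
  then show ?thesis
    unfolding cutoff_weight_def using assms by (intro mult_pos_pos zero_less_power) auto
qed

lemma cutoff_test:
  assumes "R > 0"
  shows "cutoff R m \<in> test_functions {x. R / 4 < norm x \<and> norm x < 3 * R}"
proof (rule test_functionsI)
  let ?K = "cball 0 (2 * R) - ball 0 (R / 2) :: (real^2) set"
  show "compact ?K" by (simp add: compact_diff)
  show "?K \<subseteq> {x. R / 4 < norm x \<and> norm x < 3 * R}" using assms by auto
  have "smooth_on UNIV (\<lambda>x. complex_of_real ((norm x)\<^sup>2 - (R / 2)\<^sup>2))"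
    "smooth_on UNIV (\<lambda>x. complex_of_real ((2 * R)\<^sup>2 - (norm x)\<^sup>2))"
    unfolding norm_sq_vec2 of_real_diff of_real_add of_real_power
    by (intro smooth_on_diff smooth_on_add smooth_on_power smooth_on_const smooth_on_coordinate open_UNIV)+
  then show "smooth_on UNIV (cutoff R m)"
    unfolding cutoff_def [abs_def]
    by (intro smooth_on_mult[OF open_UNIV smooth_on_mult[OF open_UNIV smooth_on_bump smooth_on_bump]] smooth_on_ang open_UNIV)
  fix x :: "real^2" assume "x \<notin> ?K"
  then have "norm x > 2 * R \<or> norm x < R / 2" by auto
  then have "(norm x)\<^sup>2 > (2 * R)\<^sup>2 \<or> (norm x)\<^sup>2 < (R / 2)\<^sup>2"
    using assms power_strict_mono[of "2 * R" "norm x" 2] power_strict_mono[of "norm x" "R / 2" 2] by force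
  then show "cutoff R m x = 0"
    unfolding cutoff_def bump_eq by auto
qed

text \<open>An unnormalised Fourier coefficient; the sign in the exponent is immaterial because
  \<open>m\<close> ranges over all integers.\<close>

definition mode :: "int \<Rightarrow> (real^2 \<Rightarrow> complex) \<Rightarrow> real \<Rightarrow> complex" where
  "mode m F r = (LINT t:{0..2*pi}|lborel. F (circle_pt r t) * cis (of_int m * t))"

text \<open>Both sides expand the divergence of the field x \<phi>(x) \<beta>(x); the left one has
  the shape that arises when weak derivatives of \<phi> are tested with the field x
  \<beta>(x).\<close>

lemma radial_field_divergence:
  fixes \<phi> \<beta> :: "real^2 \<Rightarrow> complex"
  assumes "\<phi> differentiable at x" "\<beta> differentiable at x"
  shows "(\<Sum>i\<in>UNIV. \<phi> x * partial_deriv i (\<lambda>x. of_real (x $ i) * \<beta> x) x + partial_deriv i \<phi> x * (of_real (x $ i) * \<beta> x))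
    = 2 * (\<phi> x * \<beta> x) + (\<Sum>i\<in>UNIV. x $ i *\<^sub>R partial_deriv i (\<lambda>x. \<phi> x * \<beta> x) x)"
proof -
  have c: "((\<lambda>x::real^2. complex_of_real (x $ i)) has_derivative (\<lambda>h. of_real (h $ i))) (at x)" for i
    by (intro bounded_linear_imp_has_derivative bounded_linear_compose[OF bounded_linear_of_real]
          bounded_linear_vec_nth)
  have "partial_deriv i (\<lambda>x. of_real (x $ i) * \<beta> x) x = \<beta> x + of_real (x $ i) * partial_deriv i \<beta> x" for i
    using c[of i] assms(2) by (subst partial_deriv_mult) (auto simp: partial_deriv_eqI[OF c] differentiable_def)
  moreover have "partial_deriv i (\<lambda>x. \<phi> x * \<beta> x) x = partial_deriv i \<phi> x * \<beta> x + \<phi> x * partial_deriv i \<beta> x" for i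
    by (rule partial_deriv_mult[OF assms])
  ultimately show ?thesis
    by (simp add: sum_2 scaleR_conv_of_real algebra_simps)
qed

lemma open_norm_greater: "open {x::real^2. r < norm x}"
  by (intro open_Collect_less continuous_intros)

text \<open>Divergence theorem for the field x \<phi> \<open>cutoff\<close>: on the circle of radius
  r its normal component carries a factor r and the arc length another one, whence r^2.\<close>

lemma mode_integral_annulus:
  assumes "smooth_on \<Omega> \<phi>" "open \<Omega>" "0 < a" "a \<le> b" "{x. a \<le> norm x \<and> norm x \<le> b} \<subseteq> \<Omega>" "R > 0"
  shows "(LINT x:{x. a < norm x \<and> norm x < b}|lborel.
      (\<Sum>i\<in>UNIV. \<phi> x * partial_deriv i (\<lambda>x. of_real (x $ i) * cutoff R m x) x + partial_deriv i \<phi> x * (of_real (x $ i) * cutoff R m x)))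
    = of_real (b\<^sup>2 * cutoff_weight R m b) * mode m \<phi> b - of_real (a\<^sup>2 * cutoff_weight R m a) * mode m \<phi> a"
proof -
  let ?F = "\<lambda>x. \<phi> x * cutoff R m x"
  have sc: "smooth_on UNIV (cutoff R m)" using test_functions_smooth[OF cutoff_test[OF assms(6)]] .
  have sF: "smooth_on \<Omega> ?F"
    by (intro smooth_on_mult assms smooth_on_subset[OF sc]) auto
  have "(LINT x:{x. a < norm x \<and> norm x < b}|lborel.
      (\<Sum>i\<in>UNIV. \<phi> x * partial_deriv i (\<lambda>x. of_real (x $ i) * cutoff R m x) x + partial_deriv i \<phi> x * (of_real (x $ i) * cutoff R m x)))
    = (LINT x:{x. a < norm x \<and> norm x < b}|lborel. 2 * ?F x + (\<Sum>i\<in>UNIV. x $ i *\<^sub>R partial_deriv i ?F x))"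
    unfolding set_lebesgue_integral_def
  proof (intro Bochner_Integration.integral_cong refl)
    fix x :: "real^2"
    show "indicat_real {x. a < norm x \<and> norm x < b} x *\<^sub>R (\<Sum>i\<in>UNIV. \<phi> x * partial_deriv i (\<lambda>x. of_real (x $ i) * cutoff R m x) x + partial_deriv i \<phi> x * (of_real (x $ i) * cutoff R m x))
      = indicat_real {x. a < norm x \<and> norm x < b} x *\<^sub>R (2 * ?F x + (\<Sum>i\<in>UNIV. x $ i *\<^sub>R partial_deriv i ?F x))"
    proof (cases "a < norm x \<and> norm x < b")
      case True
      then have "x \<in> \<Omega>" using assms(5) by auto
      then show ?thesis
        using smooth_on_differentiable[OF assms(1,2)] smooth_on_differentiable[OF sc]
        by (subst radial_field_divergence) auto
    qed simp
  qed
  also have "\<dots> = (LINT t:{0..2*pi}|lborel. b\<^sup>2 *\<^sub>R ?F (circle_pt b t) - a\<^sup>2 *\<^sub>R ?F (circle_pt a t))"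
    by (rule divergence_annulus[OF sF assms(2-5)])
  also have "\<dots> = (LINT t:{0..2*pi}|lborel. of_real (b\<^sup>2 * cutoff_weight R m b) * (\<phi> (circle_pt b t) * cis (of_int m * t))
     - of_real (a\<^sup>2 * cutoff_weight R m a) * (\<phi> (circle_pt a t) * cis (of_int m * t)))"
    by (simp add: cutoff_circle_pt scaleR_conv_of_real mult_ac)
  also have "\<dots> = of_real (b\<^sup>2 * cutoff_weight R m b) * mode m \<phi> b - of_real (a\<^sup>2 * cutoff_weight R m a) * mode m \<phi> a"
  proof -
    have "set_integrable lborel {0..2*pi} (\<lambda>t. \<phi> (circle_pt r t) * cis (of_int m * t))" if "a \<le> r" "r \<le> b" for r
      unfolding set_integrable_def
      using that assms(3,5)
      by (intro borel_integrable_compact compact_Icc continuous_intros continuous_on_compose2[OF smooth_on_continuous_on[OF assms(1)]]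
           ) auto
    from this[of a] this[of b] assms(4) show ?thesis
      by (simp add: mode_def set_integral_diff)
  qed
  finally show ?thesis .
qed

text \<open>The weak derivatives of \<open>h\<close> are tested with the radial field \<open>x \<mapsto> x \<cdot> cutoff R m x\<close>. Inside the disc
  the divergence theorem applies to the smooth approximations defining the trace, outside to \<open>H\<close> on
  annuli of inner radius tending to \<open>R\<close>; the two boundary terms cancel.\<close>

lemma trace_mode_limit:
  assumes R: "R > 0" and tr: "has_trace R h g"
    and wp: "\<And>i. weak_partial (ball 0 (3 * R)) i h (d i)"
    and H: "smooth_on {x. R < norm x} H" "AE x in lborel. R < norm x \<longrightarrow> h x = H x"
  shows "(mode m H \<longlongrightarrow> mode m g R) (at_right R)"
proof -
  let ?A = "{x. R / 4 < norm x \<and> norm x < 3 * R} :: (real^2) set"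
  let ?B = "ball 0 R :: (real^2) set"
  let ?X = "{x. R < norm x} :: (real^2) set"
  define \<Psi> where "\<Psi> i x = complex_of_real (x $ i) * cutoff R m x" for i x
  have ctest: "cutoff R m \<in> test_functions ?A" by (rule cutoff_test[OF R])
  have oA: "open ?A" by (intro open_Collect_conj open_Collect_less continuous_intros)
  have test: "\<Psi> i \<in> test_functions ?A" for i
    unfolding \<Psi>_def [abs_def] by (intro test_functions_mult[OF oA _ ctest]) simp
  have A3: "?A \<subseteq> ball 0 (3 * R)" by auto
  have test3: "\<Psi> i \<in> test_functions (ball 0 (3 * R))" for i by (rule test_functions_mono[OF A3 test])
  \<comment> \<open>When \<open>d\<close> are the derivatives of \<open>h\<close>, this is the
    divergence of the field x h(x) \<open>cutoff R m x\<close>.\<close>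
  define E where "E h d x = (\<Sum>i\<in>UNIV. h x * partial_deriv i (\<Psi> i) x + d i x * \<Psi> i x)" 
    for h :: "real^2 \<Rightarrow> complex" and d :: "2 \<Rightarrow> real^2 \<Rightarrow> complex" and x
  have E0: "E h' d' x = 0" if "x \<notin> ?A" for h' d' x
    using test_functions_outside[OF test that] test_functions_outside[OF test_functions_partial_deriv[OF test] that]
    by (simp add: E_def)
  have lh: "locally_integrable_on (ball 0 (3 * R)) h" "locally_integrable_on (ball 0 (3 * R)) (d i)" for i
    using wp by (auto simp: weak_partial_alt)
  have Ei: "integrable lborel (E h d)"
    unfolding E_def
    by (intro Bochner_Integration.integrable_sum Bochner_Integration.integrable_add
        integrable_mult_test[OF lh(1)] integrable_mult_test[OF lh(2)] test_functions_partial_deriv test3)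
  \<comment> \<open>The definition of weak derivatives, tested with \<open>\<Psi>\<close>. Their
    existence across the circle is what links the two sides.\<close>
  have total: "(LINT x|lborel. E h d x) = 0"
  proof -
    have "(LINT x|lborel. E h d x) = (\<Sum>i\<in>UNIV. (LINT x|lborel. h x * partial_deriv i (\<Psi> i) x) + (LINT x|lborel. d i x * \<Psi> i x))"
      unfolding E_def
      using integrable_mult_test[OF lh(1) test_functions_partial_deriv[OF test3]] integrable_mult_test[OF lh(2) test3]
      by (subst Bochner_Integration.integral_sum) auto
    also have "\<dots> = 0"
      using wp test3 by (simp add: weak_partial_alt)
    finally show ?thesis .
  qed
  have Es: "set_integrable lborel S (E h d)" if "S \<in> sets borel" for S
    using Ei that by (simp add: set_integrable_def integrable_mult_indicator)
  from tr obtain \<phi> where \<phi>: "\<And>j. smooth_on UNIV (\<phi> j)"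
      "(\<lambda>j. L2_norm_on ?B (\<lambda>x. \<phi> j x - h x)) \<longlonglongrightarrow> 0"
      "\<And>i. \<exists>d. weak_partial ?B i h d \<and> L2_on ?B d \<and>
           (\<lambda>j. L2_norm_on ?B (\<lambda>x. partial_deriv i (\<phi> j) x - d x)) \<longlonglongrightarrow> 0"
      "(\<lambda>j. LINT t:{0..2*pi}|lborel. (cmod (\<phi> j (circle_pt R t) - g (circle_pt R t)))\<^sup>2) \<longlonglongrightarrow> 0"
    unfolding has_trace_def by blast
  then have "\<forall>i. \<exists>d. weak_partial ?B i h d \<and> L2_on ?B d \<and>
           (\<lambda>j. L2_norm_on ?B (\<lambda>x. partial_deriv i (\<phi> j) x - d x)) \<longlonglongrightarrow> 0" by blast
  from choice[OF this] obtain d' where "\<forall>i. weak_partial ?B i h (d' i) \<and> L2_on ?B (d' i) \<and>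
      (\<lambda>j. L2_norm_on ?B (\<lambda>x. partial_deriv i (\<phi> j) x - d' i x)) \<longlonglongrightarrow> 0" ..
  then have d': "\<And>i. weak_partial ?B i h (d' i)" "\<And>i. L2_on ?B (d' i)"
      "\<And>i. (\<lambda>j. L2_norm_on ?B (\<lambda>x. partial_deriv i (\<phi> j) x - d' i x)) \<longlonglongrightarrow> 0"
    by simp_all
  have hL2: "square_integrable_on ?B h"
    using tr by (simp add: has_trace_def L2_on_iff)
  have gL2: "square_integrable_on {0..2*pi} (\<lambda>t. g (circle_pt R t))"
    using tr by (simp add: has_trace_def square_integrable_on_def)
  have Bm: "?B \<in> sets borel" "emeasure lborel ?B < \<infinity>"
    using emeasure_bounded_finite[OF bounded_ball] by auto
  \<comment> \<open>One limit is computed twice: by L2 convergence of the smooth approximations on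
    the disc, and from their boundary terms.\<close>
  have inside: "(LINT x:?B|lborel. E h d x) = of_real (R\<^sup>2 * cutoff_weight R m R) * mode m g R"
  proof (rule LIMSEQ_unique)
    have bd: "\<exists>C\<ge>0. \<forall>x. cmod (\<psi> x) \<le> C" if "\<psi> \<in> test_functions ?A" for \<psi>
      using test_functions_bounded[OF that] by (metis less_imp_le)
    have L2s: "square_integrable_on ?B f" if "smooth_on UNIV f" for f
      by (rule square_integrable_on_continuous[OF continuous_on_subset[OF smooth_on_continuous_on[OF that]], of "cball 0 R"]) auto
    have conv: "(\<lambda>j. LINT x:?B|lborel. f j x * \<psi> x) \<longlonglongrightarrow> (LINT x:?B|lborel. f' x * \<psi> x)"
        "set_integrable lborel ?B (\<lambda>x. f j x * \<psi> x)" "set_integrable lborel ?B (\<lambda>x. f' x * \<psi> x)"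
      if cf: "\<And>j. smooth_on UNIV (f j)" "square_integrable_on ?B f'" "\<psi> \<in> test_functions ?A"
        "(\<lambda>j. L2_norm_on ?B (\<lambda>x. f j x - f' x)) \<longlonglongrightarrow> 0" for f f' \<psi> j
    proof -
      obtain C where C: "C \<ge> 0" "\<And>x. cmod (\<psi> x) \<le> C" using bd[OF cf(3)] by blast
      have m: "\<psi> \<in> borel_measurable borel"
        using smooth_on_UNIV_borel_measurable[OF test_functions_smooth[OF cf(3)]] .
      show "(\<lambda>j. LINT x:?B|lborel. f j x * \<psi> x) \<longlonglongrightarrow> (LINT x:?B|lborel. f' x * \<psi> x)"
        using cf(4) C m L2s[OF cf(1)] cf(2) unfolding L2_norm_on_def
        by (intro set_integral_L2_convergence[OF _ _ Bm]) auto
      show "set_integrable lborel ?B (\<lambda>x. f j x * \<psi> x)" "set_integrable lborel ?B (\<lambda>x. f' x * \<psi> x)"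
        using C m L2s[OF cf(1)] cf(2) by (auto intro!: set_integral_mult_bound(1)[OF _ Bm])
    qed
    note c1 = conv[OF \<phi>(1) hL2 test_functions_partial_deriv[OF test] \<phi>(2)]
    note c2 = conv[OF smooth_on_partial_deriv[OF \<phi>(1)] d'(2)[unfolded L2_on_iff] test d'(3)]
    have sp: "(LINT x:?B|lborel. E f e x) =
       (\<Sum>i\<in>UNIV. (LINT x:?B|lborel. f x * partial_deriv i (\<Psi> i) x) + (LINT x:?B|lborel. e i x * \<Psi> i x))"
      if "\<And>i. set_integrable lborel ?B (\<lambda>x. f x * partial_deriv i (\<Psi> i) x)" "\<And>i. set_integrable lborel ?B (\<lambda>x. e i x * \<Psi> i x)" for f e
      unfolding E_def sum_2 by (simp add: set_integral_add that)
    have "(\<lambda>j. LINT x:?B|lborel. E (\<phi> j) (\<lambda>i. partial_deriv i (\<phi> j)) x) \<longlonglongrightarrow> (LINT x:?B|lborel. E h d' x)"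
      unfolding sp[OF c1(2) c2(2)] sp[OF c1(3) c2(3)]
      by (intro tendsto_sum tendsto_add c1(1) c2(1))
    also have "(LINT x:?B|lborel. E h d' x) = (LINT x:?B|lborel. E h d x)"
    proof (unfold set_lebesgue_integral_def, rule integral_cong_AE)
      \<comment> \<open>The derivatives supplied by the trace agree with those on the larger
        disc.\<close>
      have "AE x in lborel. x \<in> ?B \<longrightarrow> d' i x = d i x" for i
      proof (rule weak_partial_unique[OF _ d'(1)])
        show "weak_partial ?B i h (d i)" using wp by (rule weak_partial_subset) (use R in auto)
      qed auto
      then have "AE x in lborel. \<forall>i\<in>UNIV. x \<in> ?B \<longrightarrow> d' i x = d i x"
        by (subst AE_ball_countable) auto
      then show "AE x in lborel. indicat_real ?B x *\<^sub>R E h d' x = indicat_real ?B x *\<^sub>R E h d x"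
        by eventually_elim (auto simp: indicator_def E_def)
      have "set_integrable lborel ?B (E h d')"
        unfolding E_def sum_2 by (intro set_integral_add(1) c1(3) c2(3))
      then show "(\<lambda>x. indicat_real ?B x *\<^sub>R E h d' x) \<in> borel_measurable lborel"
        by (auto simp: set_integrable_def)
      show "(\<lambda>x. indicat_real ?B x *\<^sub>R E h d x) \<in> borel_measurable lborel"
        using Es[OF Bm(1)] by (auto simp: set_integrable_def)
    qed
    finally show "(\<lambda>j. LINT x:?B|lborel. E (\<phi> j) (\<lambda>i. partial_deriv i (\<phi> j)) x) \<longlonglongrightarrow> (LINT x:?B|lborel. E h d x)" .
    have "(LINT x:?B|lborel. E (\<phi> j) (\<lambda>i. partial_deriv i (\<phi> j)) x) = of_real (R\<^sup>2 * cutoff_weight R m R) * mode m (\<phi> j) R" for j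
    proof -
      have "(LINT x:?B|lborel. E (\<phi> j) (\<lambda>i. partial_deriv i (\<phi> j)) x) =
        (LINT x:{x. R / 4 < norm x \<and> norm x < R}|lborel. E (\<phi> j) (\<lambda>i. partial_deriv i (\<phi> j)) x)"
        unfolding set_lebesgue_integral_def
        by (intro Bochner_Integration.integral_cong refl) (auto simp: indicator_def E0)
      also have "\<dots> = of_real (R\<^sup>2 * cutoff_weight R m R) * mode m (\<phi> j) R - of_real ((R / 4)\<^sup>2 * cutoff_weight R m (R / 4)) * mode m (\<phi> j) (R / 4)"
        unfolding E_def \<Psi>_def using R
        by (intro mode_integral_annulus[OF \<phi>(1) open_UNIV]) auto
      also have "cutoff_weight R m (R / 4) = 0"
      proof -
        have "(R / 4)\<^sup>2 - (R / 2)\<^sup>2 \<le> 0" by (simp add: power2_eq_square)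
        then show ?thesis by (simp only: cutoff_weight_def bump_eq) auto
      qed
      finally show ?thesis by simp
    qed
    moreover have "(\<lambda>j. mode m (\<phi> j) R) \<longlonglongrightarrow> mode m g R"
      unfolding mode_def
    proof (rule set_integral_L2_convergence[where C=1])
      have cp: "continuous_on S (\<lambda>t. \<phi> j (circle_pt R t))" for S j
        by (intro continuous_on_compose2[OF smooth_on_continuous_on[OF \<phi>(1)]] continuous_intros) auto
      show "square_integrable_on {0..2*pi} (\<lambda>t. \<phi> j (circle_pt R t))" for j
        by (rule square_integrable_on_continuous[OF cp]) auto
      show "(\<lambda>t. cis (of_int m * t)) \<in> borel_measurable borel"
        by (intro borel_measurable_continuous_onI continuous_intros)
      show "(\<lambda>j. sqrt (LINT t:{0..2*pi}|lborel. (cmod (\<phi> j (circle_pt R t) - g (circle_pt R t)))\<^sup>2)) \<longlonglongrightarrow> 0"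
        using tendsto_real_sqrt[OF \<phi>(4)] by simp
    qed (use gL2 in auto)
    ultimately show "(\<lambda>j. LINT x:?B|lborel. E (\<phi> j) (\<lambda>i. partial_deriv i (\<phi> j)) x) \<longlonglongrightarrow> of_real (R\<^sup>2 * cutoff_weight R m R) * mode m g R"
      by (simp only:) (intro tendsto_mult tendsto_const)
  qed
  let ?E = "E H (\<lambda>i. partial_deriv i H)"
  have AE_E: "AE x in lborel. R < norm x \<longrightarrow> E h d x = ?E x"
  proof -
    have o: "open (?X \<inter> ball 0 (3 * R))" by (intro open_Int open_norm_greater open_ball)
    have "AE x in lborel. x \<in> ?X \<inter> ball 0 (3 * R) \<longrightarrow> d i x = partial_deriv i H x" for i
    proof (rule weak_partial_unique[OF o])
      show "weak_partial (?X \<inter> ball 0 (3 * R)) i h (d i)" using wp by (rule weak_partial_subset) auto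
      show "weak_partial (?X \<inter> ball 0 (3 * R)) i H (partial_deriv i H)"
        by (intro smooth_on_weak_partial o smooth_on_subset[OF H(1)]) auto
    qed (use H(2) in auto)
    then have "AE x in lborel. \<forall>i\<in>UNIV. x \<in> ?X \<inter> ball 0 (3 * R) \<longrightarrow> d i x = partial_deriv i H x"
      by (subst AE_ball_countable) auto
    with H(2) show ?thesis
    proof eventually_elim
      case (elim x)
      show ?case
      proof (cases "x \<in> ?A")
        case True
        with elim show ?thesis by (auto simp: E_def)
      qed (simp add: E0)
    qed
  qed
  have Xm: "?X \<in> sets borel" using open_norm_greater by simp
  have cE: "continuous_on ?X ?E"
    unfolding E_def sum_2
    by (intro continuous_intros smooth_on_continuous_on smooth_on_partial_deriv H(1)
        smooth_on_subset[OF test_functions_smooth[OF test]] 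
        smooth_on_subset[OF smooth_on_partial_deriv[OF test_functions_smooth[OF test]]] open_norm_greater subset_UNIV)
  have AE_ind: "AE x in lborel. indicat_real ?X x *\<^sub>R E h d x = indicat_real ?X x *\<^sub>R ?E x"
    using AE_E by eventually_elim (auto simp: indicator_def)
  have mX: "(\<lambda>x. indicat_real ?X x *\<^sub>R ?E x) \<in> borel_measurable lborel"
    using borel_measurable_continuous_on_indicator[OF Xm cE] by simp
  \<comment> \<open>Nothing is known about \<open>H\<close> near the circle; integrability up to it
    is inherited from \<open>E h d\<close>, which agrees almost everywhere.\<close>
  have XE: "set_integrable lborel ?X ?E" "(LINT x:?X|lborel. ?E x) = (LINT x:?X|lborel. E h d x)"
  proof -
    show "set_integrable lborel ?X ?E"
      using Es[OF Xm] unfolding set_integrable_def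
      by (rule integrable_cong_AE_imp[OF _ mX]) (use AE_ind in \<open>auto elim: eventually_mono\<close>)
    show "(LINT x:?X|lborel. ?E x) = (LINT x:?X|lborel. E h d x)"
      unfolding set_lebesgue_integral_def
      by (rule integral_cong_AE[OF mX]) (use AE_ind Es[OF Xm] in \<open>auto simp: set_integrable_def elim: eventually_mono\<close>)
  qed
  have split: "(LINT x:?B|lborel. E h d x) + (LINT x:?X|lborel. ?E x) = 0"
  proof -
    have "AE x in lborel. x \<notin> sphere (0::real^2) R"
      by (rule AE_not_negligible[OF negligible_sphere])
    then have "(LINT x|lborel. E h d x) = (LINT x:?B \<union> ?X|lborel. E h d x)"
      unfolding set_lebesgue_integral_def
      using Ei Es[of "?B \<union> ?X"] Xm Bm
      by (intro integral_cong_AE) (auto simp: set_integrable_def indicator_def elim!: eventually_mono)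
    also have "\<dots> = (LINT x:?B|lborel. E h d x) + (LINT x:?X|lborel. E h d x)"
      using Xm Bm by (intro set_integral_Un Es) auto
    finally show ?thesis using total XE(2) by simp
  qed
  let ?w = "\<lambda>r. of_real (r\<^sup>2 * cutoff_weight R m r) :: complex"
  \<comment> \<open>As the inner radius decreases to R, the annuli up to 3 R exhaust the exterior
    part of the support of \<open>?E\<close>; at radius 3 R the cutoff is already 0.\<close>
  have lim: "((\<lambda>r. ?w r * mode m H r) \<longlongrightarrow> ?w R * mode m g R) (at_right R)"
  proof (rule tendsto_at_right_sequentially[where b="2 * R"])
    fix s :: "nat \<Rightarrow> real" assume s: "\<And>n. R < s n" "\<And>n. s n < 2 * R" "decseq s" "s \<longlonglongrightarrow> R"
    have "(LINT x:{x. s n < norm x \<and> norm x < 3 * R}|lborel. ?E x) = - (?w (s n) * mode m H (s n))" for n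
    proof -
      have "(LINT x:{x. s n < norm x \<and> norm x < 3 * R}|lborel. ?E x) = ?w (3 * R) * mode m H (3 * R) - ?w (s n) * mode m H (s n)"
        unfolding E_def \<Psi>_def using R s(1)[of n] s(2)[of n]
        by (intro mode_integral_annulus[OF H(1) open_norm_greater]) auto
      also have "cutoff_weight R m (3 * R) = 0"
      proof -
        have "(2 * R)\<^sup>2 - (3 * R)\<^sup>2 \<le> 0" by (simp add: power2_eq_square)
        then show ?thesis by (simp only: cutoff_weight_def bump_eq) auto
      qed
      finally show ?thesis by simp
    qed
    moreover have "(\<lambda>n. LINT x:{x. s n < norm x \<and> norm x < 3 * R}|lborel. ?E x) \<longlonglongrightarrow> (LINT x:?X|lborel. ?E x)"
      unfolding set_lebesgue_integral_def
    proof (rule integral_dominated_convergence[where w="\<lambda>x. norm (indicat_real ?X x *\<^sub>R ?E x)"])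
      show "integrable lborel (\<lambda>x. norm (indicat_real ?X x *\<^sub>R ?E x))"
        using XE(1) unfolding set_integrable_def by (rule integrable_norm)
      show "(\<lambda>x. indicat_real {x. s n < norm x \<and> norm x < 3 * R} x *\<^sub>R ?E x) \<in> borel_measurable lborel" for n
      proof -
        have "open {x::real^2. s n < norm x \<and> norm x < 3 * R}"
          by (intro open_Collect_conj open_Collect_less continuous_intros)
        moreover have "{x::real^2. s n < norm x \<and> norm x < 3 * R} \<subseteq> ?X" using s(1)[of n] by auto
        ultimately show ?thesis
          using borel_measurable_continuous_on_indicator[OF _ continuous_on_subset[OF cE]] by simp
      qed
      show "AE x in lborel. (\<lambda>n. indicat_real {x. s n < norm x \<and> norm x < 3 * R} x *\<^sub>R ?E x) \<longlonglongrightarrow> indicat_real ?X x *\<^sub>R ?E x"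
      proof (rule AE_I2)
        fix x :: "real^2"
        show "(\<lambda>n. indicat_real {x. s n < norm x \<and> norm x < 3 * R} x *\<^sub>R ?E x) \<longlonglongrightarrow> indicat_real ?X x *\<^sub>R ?E x"
        proof (cases "R < norm x")
          case True
          have "\<forall>\<^sub>F n in sequentially. s n < norm x" using order_tendstoD(2)[OF s(4) True] .
          then have "\<forall>\<^sub>F n in sequentially. indicat_real ?X x *\<^sub>R ?E x = indicat_real {x. s n < norm x \<and> norm x < 3 * R} x *\<^sub>R ?E x"
            by eventually_elim (use True E0[of x] in \<open>auto simp: indicator_def\<close>)
          then show ?thesis by (rule Lim_transform_eventually[OF tendsto_const])
        next
          case False
          then have "\<not> s n < norm x" for n using s(1)[of n] by linarith
          with False show ?thesis by simp
        qed
      qed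
      show "AE x in lborel. norm (indicat_real {x. s n < norm x \<and> norm x < 3 * R} x *\<^sub>R ?E x) \<le> norm (indicat_real ?X x *\<^sub>R ?E x)" for n
        using s(1)[of n] by (intro AE_I2) (auto simp: indicator_def)
    qed (rule mX)
    ultimately have "(\<lambda>n. - (?w (s n) * mode m H (s n))) \<longlonglongrightarrow> (LINT x:?X|lborel. ?E x)" by simp
    from tendsto_minus[OF this] split inside
    show "(\<lambda>n. ?w (s n) * mode m H (s n)) \<longlonglongrightarrow> ?w R * mode m g R" by (simp add: add_eq_0_iff)
  qed (use R in simp)
  \<comment> \<open>The weight is continuous and nonzero at R, so it can be divided out.\<close>
  have "(?w \<longlongrightarrow> ?w R) (at_right R)"
    using cutoff_weight_isCont[where r=R and R=R and m=m] unfolding isCont_def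
    by (intro tendsto_of_real tendsto_mult tendsto_power tendsto_ident_at) (auto intro: filterlim_mono at_le)
  moreover have "?w R \<noteq> 0" using R cutoff_weight_pos[of R R m] by simp
  ultimately have "((\<lambda>r. (?w r * mode m H r) / ?w r) \<longlongrightarrow> (?w R * mode m g R) / ?w R) (at_right R)"
    by (intro tendsto_divide lim)
  then have "((\<lambda>r. (?w r * mode m H r) / ?w r) \<longlongrightarrow> mode m g R) (at_right R)"
    using \<open>?w R \<noteq> 0\<close> by simp
  then show ?thesis
  proof (rule Lim_transform_eventually)
    show "\<forall>\<^sub>F r in at_right R. (?w r * mode m H r) / ?w r = mode m H r"
    proof (rule eventually_mono[OF eventually_at_right_real[of R "2 * R"]])
      fix r assume "r \<in> {R<..<2 * R}"
      then have "?w r \<noteq> 0" using R cutoff_weight_pos[of R r m] by simp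
      then show "(?w r * mode m H r) / ?w r = mode m H r" by simp
    qed (use R in simp)
  qed
qed

section \<open>Radiating solutions of the radial equation\<close>

lemma has_real_derivative_inner:
  fixes f g :: "real \<Rightarrow> complex"
  assumes "(f has_vector_derivative f') (at r)" "(g has_vector_derivative g') (at r)"
  shows "((\<lambda>r. f r \<bullet> g r) has_real_derivative (f r \<bullet> g' + f' \<bullet> g r)) (at r)"
  using bounded_bilinear.has_vector_derivative[OF bounded_bilinear_inner assms]
  by (simp add: has_real_derivative_iff_has_vector_derivative)

lemma inner_i_self: "(z::complex) \<bullet> (\<i> * z) = 0"
  by (simp add: inner_complex_def)

lemma nondecreasing_tendsto_le:
  fixes f :: "real \<Rightarrow> real"
  assumes "\<And>x. x \<ge> a \<Longrightarrow> (f has_real_derivative f' x) (at x)" "\<And>x. x \<ge> a \<Longrightarrow> f' x \<ge> 0"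
    and "(f \<longlongrightarrow> L) at_top"
  shows "f a \<le> L"
proof (rule tendsto_lowerbound[OF assms(3)])
  show "\<forall>\<^sub>F x in at_top. f a \<le> f x"
    using eventually_ge_at_top[of a]
  proof eventually_elim
    case (elim x)
    show ?case
      by (rule DERIV_nonneg_imp_nondecreasing[OF elim]) (use assms(1,2) in blast)
  qed
qed simp

text \<open>Here \<open>B\<close> is the derivative of \<open>A\<close>, and \<open>n\<close> is the
  square of the mode number. The value c = k^2 gives the modified Bessel equation and c = - k^2 the
  Bessel equation. At R a limit is assumed for \<open>A\<close> but not for
  \<open>B\<close>.\<close>

locale radial_ode =
  fixes A B :: "real \<Rightarrow> complex" and R k n c :: real
  assumes R: "R > 0" and k: "k > 0" and n: "n \<ge> 0"
    and A': "\<And>r. r > R \<Longrightarrow> (A has_vector_derivative B r) (at r)"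
    and B': "\<And>r. r > R \<Longrightarrow> ((\<lambda>r. r *\<^sub>R B r) has_vector_derivative (n / r + c * r) *\<^sub>R A r) (at r)"
    and lim_R: "(A \<longlongrightarrow> 0) (at_right R)"
    and radiation: "((\<lambda>r. of_real (sqrt r) * (B r - \<i> * of_real k * A r)) \<longlongrightarrow> 0) at_top"
begin

definition V :: "real \<Rightarrow> complex" where "V r = r *\<^sub>R B r"

lemma V': "r > R \<Longrightarrow> (V has_vector_derivative (n / r + c * r) *\<^sub>R A r) (at r)"
  unfolding V_def [abs_def] by (rule B')

text \<open>Since \<open>A\<close> is bounded near R, the equation bounds the derivative of
  \<open>V\<close>, so \<open>V\<close> is Lipschitz there.\<close>

lemma V_bounded: "\<exists>M \<delta>. \<delta> > 0 \<and> (\<forall>r. R < r \<and> r < R + \<delta> \<longrightarrow> cmod (V r) \<le> M)"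
proof -
  have "\<forall>\<^sub>F r in at_right R. cmod (A r) < 1"
    using tendstoD[OF lim_R, of 1] by simp
  then obtain b where b: "b > R" "\<And>r. R < r \<Longrightarrow> r < b \<Longrightarrow> cmod (A r) < 1"
    unfolding eventually_at_right_field by blast
  define K where "K = n / R + \<bar>c\<bar> * b"
  define s where "s = (R + b) / 2"
  have s: "R < s" "s < b" using b(1) by (auto simp: s_def)
  have "cmod (V r) \<le> cmod (V s) + K * (b - R)" if r: "R < r" "r < b" for r
  proof -
    have "norm (V r - V s) \<le> K * norm (r - s)"
    proof (rule differentiable_bound[of "{R<..<b}"])
      fix x assume x: "x \<in> {R<..<b}"
      then have "R < x" by simp
      from V'[OF this] show "(V has_derivative (\<lambda>h. h *\<^sub>R ((n / x + c * x) *\<^sub>R A x))) (at x within {R<..<b})"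
        unfolding has_vector_derivative_def by (rule has_derivative_at_withinI)
      have "\<bar>n / x + c * x\<bar> \<le> n / x + \<bar>c\<bar> * x"
        using n x R abs_triangle_ineq[of "n / x" "c * x"] by (simp add: abs_mult)
      also have "\<dots> \<le> K"
        unfolding K_def using n x R by (intro add_mono mult_left_mono divide_left_mono) auto
      finally have "norm ((n / x + c * x) *\<^sub>R A x) \<le> K * 1"
        unfolding norm_scaleR using b(2)[of x] x by (intro mult_mono) auto
      then have w: "norm ((n / x + c * x) *\<^sub>R A x) \<le> K" by simp
      show "onorm (\<lambda>h. h *\<^sub>R ((n / x + c * x) *\<^sub>R A x)) \<le> K"
      proof (rule onorm_le)
        fix h :: real
        show "norm (h *\<^sub>R ((n / x + c * x) *\<^sub>R A x)) \<le> K * norm h"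
          unfolding norm_scaleR[of h] using mult_left_mono[OF w, of "\<bar>h\<bar>"] by (simp only: mult.commute real_norm_def)
      qed
    qed (use r s in auto)
    moreover have "K * norm (r - s) \<le> K * (b - R)"
      using r s n R b(1) by (intro mult_left_mono) (auto simp: K_def)
    moreover have "cmod (V r) \<le> cmod (V s) + norm (V r - V s)"
      by (metis add.commute diff_add_cancel norm_triangle_ineq)
    ultimately show ?thesis by linarith
  qed
  then show ?thesis using b(1) by (intro exI[of _ "cmod (V s) + K * (b - R)"] exI[of _ "b - R"]) auto
qed

text \<open>Used with \<open>L\<close> as multiplication by i for the Wronskian and as the identity
  for the energy argument.\<close>

lemma inner_lim_R:
  assumes "bounded_linear L"
  shows "((\<lambda>r. V r \<bullet> L (A r)) \<longlongrightarrow> 0) (at_right R)"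
proof -
  obtain M \<delta> where M: "\<delta> > 0" "\<And>r. R < r \<Longrightarrow> r < R + \<delta> \<Longrightarrow> cmod (V r) \<le> M"
    using V_bounded by blast
  have L: "((\<lambda>r. L (A r)) \<longlongrightarrow> 0) (at_right R)"
    using bounded_linear.tendsto_zero[OF assms lim_R] .
  show ?thesis
  proof (rule Lim_null_comparison)
    show "((\<lambda>r. M * cmod (L (A r))) \<longlongrightarrow> 0) (at_right R)"
      by (intro tendsto_mult_right_zero tendsto_norm_zero L)
    show "\<forall>\<^sub>F r in at_right R. norm (V r \<bullet> L (A r)) \<le> M * cmod (L (A r))"
    proof (rule eventually_mono[OF eventually_at_right_real[of R "R + \<delta>"]])
      fix r assume "r \<in> {R<..<R + \<delta>}"
      then have "cmod (V r) \<le> M" using M(2) by auto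
      then show "norm (V r \<bullet> L (A r)) \<le> M * cmod (L (A r))"
        using Cauchy_Schwarz_ineq2[of "V r" "L (A r)"] mult_right_mono[of "cmod (V r)" M "cmod (L (A r))"] by auto
    qed (use M in simp)
  qed
qed

text \<open>The equation is real: V' is a real multiple of A, and V one of A'. Both terms of the
  derivative therefore have the form z \<bullet> (i z) = 0 up to a real factor, and the limit at R
  fixes the constant.\<close>

lemma wronskian: 
  assumes "r > R"
  shows "V r \<bullet> (\<i> * A r) = 0"
proof -
  have iA: "((\<lambda>r. \<i> * A r) has_vector_derivative \<i> * B r) (at r)" if "r > R" for r
    using bounded_linear.has_vector_derivative[OF bounded_linear_mult_right A'[OF that]] .
  have d: "((\<lambda>r. V r \<bullet> (\<i> * A r)) has_real_derivative 0) (at r)" if "r > R" for r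
    using has_real_derivative_inner[OF V'[OF that] iA[OF that]]
    by (simp add: V_def inner_i_self)
  have const: "V s \<bullet> (\<i> * A s) = V r \<bullet> (\<i> * A r)" if "R < s" for s
  proof -
    have "\<exists>C. \<forall>x\<in>{R<..}. V x \<bullet> (\<i> * A x) = C"
    proof (rule has_field_derivative_zero_constant)
      show "convex {R<..}" by (rule convex_real_interval)
      fix x assume "x \<in> {R<..}"
      then have "R < x" by simp
      then show "((\<lambda>r. V r \<bullet> (\<i> * A r)) has_real_derivative 0) (at x within {R<..})"
        by (rule has_field_derivative_at_within[OF d])
    qed
    then obtain C where "\<forall>x\<in>{R<..}. V x \<bullet> (\<i> * A x) = C" ..
    then show ?thesis using that assms by simp
  qed
  have "((\<lambda>s. V s \<bullet> (\<i> * A s)) \<longlongrightarrow> V r \<bullet> (\<i> * A r)) (at_right R)"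
    by (rule Lim_transform_eventually[OF tendsto_const])
       (use const in \<open>auto simp: eventually_at_filter\<close>)
  then show ?thesis
    using tendsto_unique[OF _ _ inner_lim_R[OF bounded_linear_mult_right]] by (simp add: trivial_limit_at_right_real)
qed

definition D :: "real \<Rightarrow> real" where
  "D r = (cmod (B r))\<^sup>2 + k\<^sup>2 * (cmod (A r))\<^sup>2"

lemma D_nonneg: "D r \<ge> 0" by (simp add: D_def)

lemma inner_AB_le: "\<bar>B r \<bullet> A r\<bar> \<le> D r / (2 * k)"
proof -
  have "2 * k * (cmod (B r) * cmod (A r)) \<le> D r"
    using zero_le_power2[of "cmod (B r) - k * cmod (A r)"]
    by (simp add: D_def power2_diff power_mult_distrib algebra_simps)
  then have "cmod (B r) * cmod (A r) \<le> D r / (2 * k)" using k by (simp add: field_simps)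
  then show ?thesis using Cauchy_Schwarz_ineq2[of "B r" "A r"] by linarith
qed

text \<open>The vanishing Wronskian removes the mixed term of |B - i k A|^2, so the radiation
  condition controls \<open>B\<close> and \<open>A\<close> separately.\<close>

lemma energy_tendsto_0: "((\<lambda>r. r * D r) \<longlongrightarrow> 0) at_top"
proof (rule Lim_transform_eventually)
  show "((\<lambda>r. (cmod (of_real (sqrt r) * (B r - \<i> * of_real k * A r)))\<^sup>2) \<longlongrightarrow> 0) at_top"
    using tendsto_power[OF tendsto_norm_zero[OF radiation], of 2] by simp
  show "\<forall>\<^sub>F r in at_top. (cmod (of_real (sqrt r) * (B r - \<i> * of_real k * A r)))\<^sup>2 = r * D r"
    using eventually_gt_at_top[of R]
  proof eventually_elim
    case (elim r)
    have r: "r > 0" using elim R by simp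
    have "B r \<bullet> (\<i> * A r) = 0" using wronskian[OF elim] r by (simp add: V_def)
    then have "(cmod (B r - \<i> * of_real k * A r))\<^sup>2 = D r"
      unfolding D_def cmod_power2 by (simp add: inner_complex_def power2_eq_square algebra_simps)
    then show ?case using r by (simp add: norm_mult power_mult_distrib)
  qed
qed

lemma inner_tendsto_0: "((\<lambda>r. V r \<bullet> A r) \<longlongrightarrow> 0) at_top"
proof (rule Lim_null_comparison)
  show "((\<lambda>r. r * D r / (2 * k)) \<longlongrightarrow> 0) at_top"
    using tendsto_divide[OF energy_tendsto_0 tendsto_const[of "2 * k"]] k by simp
  show "\<forall>\<^sub>F r in at_top. norm (V r \<bullet> A r) \<le> r * D r / (2 * k)"
    using eventually_gt_at_top[of 0]
  proof eventually_elim
    case (elim r)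
    then show ?case
      using mult_left_mono[OF inner_AB_le[of r], of r] by (simp add: V_def abs_mult)
  qed
qed

lemma inner_derivative:
  assumes "r > R"
  shows "((\<lambda>r. V r \<bullet> A r) has_real_derivative (r * (cmod (B r))\<^sup>2 + (n / r + c * r) * (cmod (A r))\<^sup>2)) (at r)"
  using has_real_derivative_inner[OF V'[OF assms] A'[OF assms]]
  by (simp add: V_def power2_norm_eq_inner)

text \<open>V \<bullet> A has a derivative made of nonnegative terms and tends to 0 both at R and at
  infinity, so it is constantly 0. Its derivative then vanishes, and there |A|^2 has a strictly
  positive coefficient.\<close>

lemma zero_if_positive:
  assumes "c > 0" "r > R"
  shows "A r = 0"
proof -
  let ?P = "\<lambda>r. V r \<bullet> A r" and ?P' = "\<lambda>r. r * (cmod (B r))\<^sup>2 + (n / r + c * r) * (cmod (A r))\<^sup>2"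
  have P'0: "?P' x \<ge> 0" if "x > R" for x
    using that R n assms(1) by (intro add_nonneg_nonneg mult_nonneg_nonneg divide_nonneg_nonneg) auto
  have mono: "?P x \<le> ?P y" if "R < x" "x \<le> y" for x y
    by (rule DERIV_nonneg_imp_nondecreasing[OF that(2)]) (use that inner_derivative P'0 in \<open>meson less_le_trans\<close>)
  have "?P x = 0" if "x > R" for x
  proof (rule antisym)
    show "?P x \<le> 0"
      using mono[OF that]
      by (intro tendsto_lowerbound[OF inner_tendsto_0] eventually_mono[OF eventually_ge_at_top[of x]]) auto
    show "0 \<le> ?P x"
    proof (rule tendsto_upperbound[OF inner_lim_R[OF bounded_linear_ident]])
      show "\<forall>\<^sub>F s in at_right R. ?P s \<le> ?P x"
        by (rule eventually_mono[OF eventually_at_right_real[OF that]]) (use mono in auto)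
    qed (simp add: trivial_limit_at_right_real)
  qed
  then have "(?P has_real_derivative 0) (at r)"
    by (intro has_field_derivative_transform_within_open[of "\<lambda>_. 0" 0 r "{R<..}" ?P]) (use assms in auto)
  then have "?P' r = 0" using DERIV_unique inner_derivative[OF assms(2)] by blast
  moreover have "(n / r + c * r) > 0" using assms R n by (intro add_nonneg_pos) auto
  moreover have "r * (cmod (B r))\<^sup>2 \<ge> 0" using assms R by simp
  ultimately have "(cmod (A r))\<^sup>2 \<le> 0"
    by (metis add_nonneg_eq_0_iff less_eq_real_def mult_eq_0_iff zero_le_power2 order_refl mult_nonneg_nonneg not_less_iff_gr_or_eq)
  then show ?thesis by simp
qed

lemma B_derivative:
  assumes "r > R"
  shows "(B has_vector_derivative (n / r\<^sup>2 + c) *\<^sub>R A r - (1 / r) *\<^sub>R B r) (at r)"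
proof -
  have r: "r > 0" using assms R by simp
  have "((\<lambda>r. (1 / r) *\<^sub>R V r) has_vector_derivative
      ((1 / r) *\<^sub>R ((n / r + c * r) *\<^sub>R A r) + (- 1 / r\<^sup>2) *\<^sub>R V r)) (at r)"
    by (rule has_vector_derivative_scaleR[OF _ V'[OF assms]])
       (use r in \<open>auto intro!: derivative_eq_intros simp: power2_eq_square field_simps\<close>)
  moreover have "(1 / r) *\<^sub>R ((n / r + c * r) *\<^sub>R A r) + (- 1 / r\<^sup>2) *\<^sub>R V r = (n / r\<^sup>2 + c) *\<^sub>R A r - (1 / r) *\<^sub>R B r"
    using r by (simp add: V_def power2_eq_square field_simps)
  ultimately show ?thesis
    by (simp only:) (rule has_vector_derivative_transform_within_open[of "\<lambda>r. (1 / r) *\<^sub>R V r" _ _ "{R<..}"]; use assms R in \<open>auto simp: V_def\<close>)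
qed

text \<open>In the oscillatory case V \<bullet> A need not be monotone. A corrected energy times a
  bounded integrating factor is nondecreasing with limit 0 at infinity, hence nonpositive, although
  it dominates r D / 2.\<close>

lemma zero_if_far:
  assumes c: "c = - k\<^sup>2"
  shows "\<exists>r0\<ge>s. D r0 = 0"
proof -
  \<comment> \<open>For r >= 1 / k one has |B \<bullet> A| <= r D / 2, so \<open>G\<close> is
    comparable to r D; R + 1 keeps \<open>r0\<close> strictly outside the circle.\<close>
  define r0 where "r0 = max s (max (R + 1) (1 / k))"
  have r0: "r0 \<ge> s" "r0 > R" "r0 \<ge> 1 / k" "r0 > 0" using R by (auto simp: r0_def)
  \<comment> \<open>Arises from |2 n - 1| <= 2 n + 1, |B \<bullet> A| <= D / (2 k) and D <= 2 G / r
    in the first term of \<open>G'\<close>.\<close>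
  define K where "K = (2 * n + 1) / k"
  \<comment> \<open>Adding \<open>B r \<bullet> A r\<close> to the energy \<open>r * D r\<close> cancels the terms of order \<open>1 / r\<close> in its logarithmic derivative,
    so that \<open>G' \<ge> - (K / r\<^sup>2) * G\<close> with an integrable coefficient.\<close>
  define G where "G r = r * (B r \<bullet> B r) + k\<^sup>2 * (r * (A r \<bullet> A r)) + B r \<bullet> A r" for r
  define G' where "G' r = (2 * n - 1) / r * (B r \<bullet> A r) + n / r\<^sup>2 * (A r \<bullet> A r)" for r
  have GD: "G r = r * D r + B r \<bullet> A r" for r
    by (simp add: G_def D_def power2_norm_eq_inner algebra_simps)
  have dG: "(G has_real_derivative G' r) (at r)" if "r > R" for r
  proof -
    note b = B_derivative[OF that] and a = A'[OF that]
    have r: "r > 0" using that R by simp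
    have "(G has_real_derivative
      (B r \<bullet> B r + r * (B r \<bullet> ((n / r\<^sup>2 + c) *\<^sub>R A r - (1 / r) *\<^sub>R B r) + ((n / r\<^sup>2 + c) *\<^sub>R A r - (1 / r) *\<^sub>R B r) \<bullet> B r))
       + k\<^sup>2 * (A r \<bullet> A r + r * (A r \<bullet> B r + B r \<bullet> A r))
       + (B r \<bullet> B r + ((n / r\<^sup>2 + c) *\<^sub>R A r - (1 / r) *\<^sub>R B r) \<bullet> A r)) (at r)"
      unfolding G_def [abs_def]
      by (auto intro!: derivative_eq_intros has_real_derivative_inner[OF b b] has_real_derivative_inner[OF a a] has_real_derivative_inner[OF b a])
    moreover have "(B r \<bullet> B r + r * (B r \<bullet> ((n / r\<^sup>2 + c) *\<^sub>R A r - (1 / r) *\<^sub>R B r) + ((n / r\<^sup>2 + c) *\<^sub>R A r - (1 / r) *\<^sub>R B r) \<bullet> B r))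
       + k\<^sup>2 * (A r \<bullet> A r + r * (A r \<bullet> B r + B r \<bullet> A r))
       + (B r \<bullet> B r + ((n / r\<^sup>2 + c) *\<^sub>R A r - (1 / r) *\<^sub>R B r) \<bullet> A r) = G' r"
      unfolding G'_def c inner_diff_left inner_diff_right inner_scaleR_left inner_scaleR_right inner_commute[of "A r" "B r"]
      using r by (simp add: field_simps power2_eq_square)
    ultimately show ?thesis by simp
  qed
  have lower: "r * D r / 2 \<le> G r" and upper: "G r \<le> 2 * (r * D r)" if "r \<ge> r0" for r
  proof -
    have "1 / k \<le> r" using that r0 by linarith
    then have "D r * (1 / k) \<le> D r * r" using D_nonneg by (rule mult_left_mono)
    then have "D r / (2 * k) \<le> r * D r / 2" by (simp add: mult.commute)
    moreover have "0 \<le> r * D r" using that r0 D_nonneg by simp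
    ultimately show "r * D r / 2 \<le> G r" "G r \<le> 2 * (r * D r)" 
      unfolding GD using inner_AB_le[of r] by linarith+
  qed
  have G'_lower: "G' r \<ge> - (K / r\<^sup>2) * G r" if "r \<ge> r0" for r
  proof -
    have r: "r > 0" using that r0 by simp
    have "D r \<le> 2 * G r / r" using lower[OF that] r by (simp add: field_simps)
    have "\<bar>(2 * n - 1) / r * (B r \<bullet> A r)\<bar> \<le> (2 * n + 1) / r * (D r / (2 * k))"
      unfolding abs_mult using n r inner_AB_le by (intro mult_mono) (auto simp: field_simps)
    also have "\<dots> \<le> (2 * n + 1) / r * ((2 * G r / r) / (2 * k))"
      using n r k \<open>D r \<le> _\<close> by (intro mult_left_mono divide_right_mono) auto
    also have "\<dots> = K / r\<^sup>2 * G r" using r k by (simp add: K_def field_simps power2_eq_square)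
    finally have "(2 * n - 1) / r * (B r \<bullet> A r) \<ge> - (K / r\<^sup>2 * G r)" 
      unfolding abs_le_iff minus_le_iff[of _ "K / r\<^sup>2 * G r"] by (rule conjunct2)
    moreover have "n / r\<^sup>2 * (A r \<bullet> A r) \<ge> 0" using n by simp
    ultimately show ?thesis unfolding G'_def by (metis (no_types) add.right_neutral add_mono mult_minus_left)
  qed
  \<comment> \<open>The logarithmic derivative of exp(- K / r) is K / r^2, which compensates the
    lower bound for \<open>G'\<close>; the factor stays bounded at infinity.\<close>
  have "G r0 * exp (- K / r0) \<le> 0"
  proof (rule nondecreasing_tendsto_le[where f="\<lambda>r. G r * exp (- K / r)" and f'="\<lambda>r. (G' r + K / r\<^sup>2 * G r) * exp (- K / r)"])
    fix r assume r: "r \<ge> r0"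
    then have r': "r > R" "r > 0" using r0 by auto
    show "((\<lambda>r. G r * exp (- K / r)) has_real_derivative (G' r + K / r\<^sup>2 * G r) * exp (- K / r)) (at r)"
      using r' by (auto intro!: derivative_eq_intros dG simp: field_simps power2_eq_square)
    show "(G' r + K / r\<^sup>2 * G r) * exp (- K / r) \<ge> 0"
      using G'_lower[OF r] by simp
  next
    show "((\<lambda>r. G r * exp (- K / r)) \<longlongrightarrow> 0) at_top"
    proof (rule Lim_null_comparison)
      show "((\<lambda>r. 2 * (r * D r)) \<longlongrightarrow> 0) at_top"
        by (intro tendsto_mult_right_zero energy_tendsto_0)
      show "\<forall>\<^sub>F r in at_top. norm (G r * exp (- K / r)) \<le> 2 * (r * D r)"
        using eventually_ge_at_top[of r0]
      proof eventually_elim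
        case (elim r)
        have "0 \<le> r * D r" using elim r0 D_nonneg by simp
        then have "0 \<le> G r" using lower[OF elim] by linarith
        moreover have "exp (- K / r) \<le> 1" using elim r0 n k by (simp add: K_def)
        ultimately have "norm (G r * exp (- K / r)) \<le> G r" by (simp add: mult_left_le)
        then show ?case using upper[OF elim] by linarith
      qed
    qed
  qed
  then have "G r0 \<le> 0" by (simp add: mult_le_0_iff not_le[symmetric])
  then have "r0 * D r0 \<le> 0" using lower[of r0] by simp
  then have "D r0 = 0" using r0(4) D_nonneg[of r0] by (simp add: mult_le_0_iff)
  with r0 show ?thesis by blast
qed

text \<open>Backward uniqueness for the linear system in A and V: E = |A|^2 + |V|^2 satisfies |E'|
  <= M E, so E exp(M r) is nondecreasing and its zero at \<open>r0\<close> passes down to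
  \<open>r1\<close>.\<close>

lemma zero_below:
  assumes "R < r1" "r1 \<le> r0" "A r0 = 0" "B r0 = 0"
  shows "A r1 = 0"
proof -
  \<comment> \<open>Bounds |1 / r + n / r + c r| between \<open>r1\<close> and \<open>r0\<close>:
    the decreasing terms are taken at the left end, the increasing one at the right end.\<close>
  define M where "M = (1 + n) / r1 + \<bar>c\<bar> * r0"
  define E where "E r = A r \<bullet> A r + V r \<bullet> V r" for r
  define E' where "E' r = 2 * (1 / r + (n / r + c * r)) * (V r \<bullet> A r)" for r
  have pos: "r > 0" if "r1 \<le> r" for r using that assms R by simp
  have dE: "(E has_real_derivative E' r) (at r)" if "r1 \<le> r" for r
  proof -
    have rR: "r > R" using that assms by simp
    have "(E has_real_derivative (A r \<bullet> B r + B r \<bullet> A r + (V r \<bullet> ((n / r + c * r) *\<^sub>R A r) + ((n / r + c * r) *\<^sub>R A r) \<bullet> V r))) (at r)"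
      unfolding E_def [abs_def]
      by (intro DERIV_add has_real_derivative_inner V' A' rR)
    moreover have "B r = (1 / r) *\<^sub>R V r" using pos[OF that] by (simp add: V_def)
    ultimately show ?thesis
      by (simp add: E'_def inner_commute[of "A r"] algebra_simps)
  qed
  have lower: "E' r \<ge> - M * E r" if "r1 \<le> r" "r \<le> r0" for r
  proof -
    have "\<bar>1 / r + (n / r + c * r)\<bar> \<le> (1 + n) / r + \<bar>c\<bar> * r"
      using pos[OF that(1)] n abs_triangle_ineq[of "(1 + n) / r" "c * r"]
      by (simp add: abs_mult add_divide_distrib add.assoc)
    also have "\<dots> \<le> M"
      unfolding M_def using that pos[OF that(1)] pos[of r1] n by (intro add_mono divide_left_mono mult_left_mono) auto
    finally have m: "\<bar>1 / r + (n / r + c * r)\<bar> \<le> M" .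
    have "2 * \<bar>V r \<bullet> A r\<bar> \<le> E r"
    proof -
      have "2 * (cmod (V r) * cmod (A r)) \<le> E r"
        using zero_le_power2[of "cmod (V r) - cmod (A r)"]
        by (simp add: E_def power2_diff power2_norm_eq_inner)
      then show ?thesis using Cauchy_Schwarz_ineq2[of "V r" "A r"] by linarith
    qed
    then have "\<bar>1 / r + (n / r + c * r)\<bar> * (2 * \<bar>V r \<bullet> A r\<bar>) \<le> M * E r"
      using m by (intro mult_mono) auto
    moreover have "\<bar>E' r\<bar> = \<bar>1 / r + (n / r + c * r)\<bar> * (2 * \<bar>V r \<bullet> A r\<bar>)"
      unfolding E'_def abs_mult by simp
    ultimately have "\<bar>E' r\<bar> \<le> M * E r" by simp
    then show ?thesis by (simp add: abs_le_iff minus_le_iff)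
  qed
  have "E r1 * exp (M * r1) \<le> E r0 * exp (M * r0)"
  proof (rule DERIV_nonneg_imp_nondecreasing[OF assms(2)])
    fix r assume r: "r1 \<le> r" "r \<le> r0"
    have "((\<lambda>r. E r * exp (M * r)) has_real_derivative (E' r + M * E r) * exp (M * r)) (at r)"
      using dE[OF r(1)] by (auto intro!: derivative_eq_intros simp: algebra_simps)
    moreover have "(E' r + M * E r) * exp (M * r) \<ge> 0" using lower[OF r] by simp
    ultimately show "\<exists>y. ((\<lambda>r. E r * exp (M * r)) has_real_derivative y) (at r) \<and> y \<ge> 0" by blast
  qed
  moreover have "E r0 = 0" using assms by (simp add: E_def V_def)
  ultimately have "E r1 * exp (M * r1) \<le> 0" by simp
  then have "E r1 \<le> 0" by (simp add: mult_le_0_iff not_le[symmetric])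
  then have "A r1 \<bullet> A r1 \<le> 0" unfolding E_def using inner_ge_zero[of "V r1"] by linarith
  then have "A r1 \<bullet> A r1 = 0" using inner_ge_zero[of "A r1"] by linarith
  then show ?thesis by (simp only: inner_eq_zero_iff)
qed

lemma zero_if_helmholtz:
  assumes "c = - k\<^sup>2" "r > R"
  shows "A r = 0"
proof -
  obtain r0 where r0: "r0 \<ge> r" "D r0 = 0" using zero_if_far[OF assms(1)] by blast
  have "A r0 = 0" "B r0 = 0" using r0(2) k by (auto simp: D_def add_nonneg_eq_0_iff)
  then show ?thesis using zero_below[OF assms(2) r0(1)] by blast
qed

end

section \<open>Polar form of the Laplacian\<close>

definition radial_deriv :: "(real^2 \<Rightarrow> complex) \<Rightarrow> real \<Rightarrow> real \<Rightarrow> complex" where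
  "radial_deriv F r t = cos t *\<^sub>R partial_deriv 1 F (circle_pt r t) + sin t *\<^sub>R partial_deriv 2 F (circle_pt r t)"

definition angular_deriv :: "(real^2 \<Rightarrow> complex) \<Rightarrow> real \<Rightarrow> real \<Rightarrow> complex" where
  "angular_deriv F r t = (- r * sin t) *\<^sub>R partial_deriv 1 F (circle_pt r t) + (r * cos t) *\<^sub>R partial_deriv 2 F (circle_pt r t)"

lemma radial_deriv_has_vector_derivative:
  assumes "smooth_on \<Omega> F" "open \<Omega>" "circle_pt r t \<in> \<Omega>"
  shows "((\<lambda>r. F (circle_pt r t)) has_vector_derivative radial_deriv F r t) (at r within T)"
  using circle_pt_radial_derivative[OF assms] by (simp add: radial_deriv_def)

lemma angular_deriv_has_vector_derivative:
  assumes F: "smooth_on \<Omega> F" "open \<Omega>" "circle_pt r t \<in> \<Omega>"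
  shows "((\<lambda>t. F (circle_pt r t)) has_vector_derivative angular_deriv F r t) (at t within T)"
proof -
  have "((\<lambda>t. circle_pt r t) has_derivative (\<lambda>h. vector [- r * sin t * h, r * cos t * h])) (at t within T)"
    unfolding circle_pt_def vector2_eq by (auto intro!: derivative_eq_intros simp: mult_ac)
  from has_derivative_compose[OF this smooth_on_has_derivative[OF F]]
  show ?thesis
    by (simp add: has_vector_derivative_def sum_2 scaleR_diff_right angular_deriv_def mult_ac)
qed

context
  fixes F :: "real^2 \<Rightarrow> complex" and R :: real
  assumes F: "smooth_on {x. R < norm x} F" and R: "R > 0"
begin

lemma circle_pt_in: "R < r \<Longrightarrow> circle_pt r t \<in> {x. R < norm x}"
  using R by simp

lemma smooth_circle_continuous:
  assumes "smooth_on {x. R < norm x} H"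
  shows "continuous_on ({R<..} \<times> T) (\<lambda>(r, t). H (circle_pt r t))"
  unfolding case_prod_beta
  by (rule continuous_on_compose2[OF smooth_on_continuous_on[OF assms]])
     (use R in \<open>auto intro!: continuous_intros\<close>)

lemma smooth_circle_continuous_t:
  assumes "smooth_on {x. R < norm x} H" "R < r"
  shows "continuous_on T (\<lambda>t. H (circle_pt r t))"
  by (rule continuous_on_compose2[OF smooth_on_continuous_on[OF assms(1)]])
     (use R assms(2) in \<open>auto intro!: continuous_intros\<close>)

lemma mode_eq_integral:
  assumes "smooth_on {x. R < norm x} H" "R < r"
  shows "mode m H r = integral (cbox 0 (2*pi)) (\<lambda>t. H (circle_pt r t) * cis (of_int m * t))"
proof -
  have "set_integrable lborel {0..2*pi} (\<lambda>t. H (circle_pt r t) * cis (of_int m * t))"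
    unfolding set_integrable_def
    by (intro borel_integrable_compact compact_Icc continuous_intros smooth_circle_continuous_t assms)
  from set_borel_integral_eq_integral(2)[OF this] show ?thesis by (simp add: mode_def)
qed

lemma smooth_partials: "smooth_on {x. R < norm x} (partial_deriv i F)" "smooth_on {x. R < norm x} (partial_deriv i (partial_deriv j F))"
  by (intro smooth_on_partial_deriv F)+

definition mode_deriv :: "int \<Rightarrow> real \<Rightarrow> complex" where
  "mode_deriv m r = integral (cbox 0 (2*pi)) (\<lambda>t. radial_deriv F r t * cis (of_int m * t))"

lemma radial_deriv_continuous: "continuous_on ({R<..} \<times> T) (\<lambda>(r, t). radial_deriv F r t)"
  unfolding radial_deriv_def case_prod_beta
  using smooth_circle_continuous[OF smooth_partials(1), unfolded case_prod_beta]
  by (intro continuous_intros)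

lemma radial_deriv_continuous_t: "R < r \<Longrightarrow> continuous_on T (\<lambda>t. radial_deriv F r t)"
  unfolding radial_deriv_def
  by (intro continuous_intros smooth_circle_continuous_t smooth_partials)

lemma mode_has_derivative:
  assumes "R < r"
  shows "(mode m F has_vector_derivative mode_deriv m r) (at r)"
proof -
  have "((\<lambda>r. integral (cbox 0 (2*pi)) (\<lambda>t. F (circle_pt r t) * cis (of_int m * t))) has_vector_derivative mode_deriv m r) (at r within {R<..})"
    unfolding mode_deriv_def
  proof (rule leibniz_rule_vector_derivative)
    fix s t assume "s \<in> {R<..}"
    then show "((\<lambda>r. F (circle_pt r t) * cis (of_int m * t)) has_vector_derivative radial_deriv F s t * cis (of_int m * t)) (at s within {R<..})"
      by (intro bounded_linear.has_vector_derivative[OF bounded_linear_mult_left]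
          radial_deriv_has_vector_derivative[OF F open_norm_greater] circle_pt_in) simp
  next
    fix s assume "s \<in> {R<..}"
    then show "(\<lambda>t. F (circle_pt s t) * cis (of_int m * t)) integrable_on cbox 0 (2*pi)"
      by (intro integrable_continuous continuous_intros smooth_circle_continuous_t F) simp
  next
    show "continuous_on ({R<..} \<times> cbox 0 (2*pi)) (\<lambda>(x, t). radial_deriv F x t * cis (of_int m * t))"
      unfolding case_prod_beta
      by (intro continuous_intros radial_deriv_continuous[unfolded case_prod_beta])
  qed (use assms in auto)
  then have "((\<lambda>r. integral (cbox 0 (2*pi)) (\<lambda>t. F (circle_pt r t) * cis (of_int m * t))) has_vector_derivative mode_deriv m r) (at r)"
    using assms by (simp add: at_within_open[of r "{R<..}"])
  then show ?thesis
    by (rule has_vector_derivative_transform_within_open[of _ _ _ "{R<..}"])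
       (use assms mode_eq_integral[OF F] in auto)
qed

definition radial_deriv2 :: "real \<Rightarrow> real \<Rightarrow> complex" where
  "radial_deriv2 r t = cos t *\<^sub>R radial_deriv (partial_deriv 1 F) r t + sin t *\<^sub>R radial_deriv (partial_deriv 2 F) r t"

definition angular_deriv2 :: "real \<Rightarrow> real \<Rightarrow> complex" where
  "angular_deriv2 r t = (- r * cos t) *\<^sub>R partial_deriv 1 F (circle_pt r t) + (- r * sin t) *\<^sub>R angular_deriv (partial_deriv 1 F) r t
     + (- r * sin t) *\<^sub>R partial_deriv 2 F (circle_pt r t) + (r * cos t) *\<^sub>R angular_deriv (partial_deriv 2 F) r t"

text \<open>In subscript notation, (r F_r)_r = r \<Delta>F - (1 / r) F_tt; the product form suits
  the derivative of r times \<open>mode_deriv\<close>.\<close>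

lemma polar_laplacian:
  assumes "r > 0"
  shows "radial_deriv F r t + r *\<^sub>R radial_deriv2 r t = r *\<^sub>R laplacian F (circle_pt r t) - (1 / r) *\<^sub>R angular_deriv2 r t"
proof -
  define a b c d where "a = partial_deriv 1 (partial_deriv 1 F) (circle_pt r t)"
    and "b = partial_deriv 2 (partial_deriv 1 F) (circle_pt r t)"
    and "c = partial_deriv 1 (partial_deriv 2 F) (circle_pt r t)"
    and "d = partial_deriv 2 (partial_deriv 2 F) (circle_pt r t)"
  define p q where "p = partial_deriv 1 F (circle_pt r t)" and "q = partial_deriv 2 F (circle_pt r t)"
  define C S \<rho> where "C = complex_of_real (cos t)" and "S = complex_of_real (sin t)" and "\<rho> = complex_of_real r"
  have cs: "C * C + S * S = 1"
  proof -
    have "C * C + S * S = of_real (cos t * cos t + sin t * sin t)" by (simp only: C_def S_def of_real_add of_real_mult)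
    then show ?thesis by (simp only: sin_cos_squared_add3 of_real_1)
  qed
  have \<rho>: "\<rho> \<noteq> 0" using assms by (simp add: \<rho>_def)
  let ?X = "- (C * p) + \<rho> * S * S * a - \<rho> * S * C * b - S * q - \<rho> * C * S * c + \<rho> * C * C * d"
  have "angular_deriv2 r t = \<rho> * ?X"
    unfolding angular_deriv2_def angular_deriv_def a_def[symmetric] b_def[symmetric] c_def[symmetric] d_def[symmetric]
      p_def[symmetric] q_def[symmetric] scaleR_conv_of_real of_real_mult of_real_minus
      C_def[symmetric] S_def[symmetric] \<rho>_def[symmetric]
    by (simp add: algebra_simps)
  then have "(1 / r) *\<^sub>R angular_deriv2 r t = ?X"
    using assms by (simp add: scaleR_conv_of_real \<rho>_def)
  \<comment> \<open>Inserting cos^2 + sin^2 = 1 turns the claim into a polynomial identity in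
    \<open>C\<close> and \<open>S\<close>.\<close>
  moreover have "r *\<^sub>R laplacian F (circle_pt r t) = \<rho> * ((C * C + S * S) * (a + d))"
    unfolding cs by (simp add: laplacian_def sum_2 a_def d_def scaleR_conv_of_real \<rho>_def)
  moreover have "radial_deriv F r t + r *\<^sub>R radial_deriv2 r t = C * p + S * q + \<rho> * (C * (C * a + S * b) + S * (C * c + S * d))"
    unfolding radial_deriv_def radial_deriv2_def a_def[symmetric] b_def[symmetric] c_def[symmetric] d_def[symmetric]
      p_def[symmetric] q_def[symmetric] scaleR_conv_of_real of_real_mult of_real_minus
      C_def[symmetric] S_def[symmetric] \<rho>_def[symmetric] ..
  ultimately show ?thesis by (simp only:) (simp add: algebra_simps)
qed

text \<open>Two integrations by parts in the angle: with e = cis(m t), the integrand is the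
  derivative of F_t e - F e', whose boundary values cancel by periodicity.\<close>

lemma angular_integral:
  assumes "R < r"
  shows "integral (cbox 0 (2*pi)) (\<lambda>t. (angular_deriv2 r t + of_int (m\<^sup>2) * F (circle_pt r t)) * cis (of_int m * t)) = 0"
proof -
  let ?f = "\<lambda>t. angular_deriv F r t * cis (of_int m * t) - F (circle_pt r t) * (\<i> * of_int m * cis (of_int m * t))"
  have cis': "((\<lambda>t. cis (of_int m * t)) has_vector_derivative (\<i> * of_int m * cis (of_int m * t))) (at t within T)" for t T
  proof -
    have "((\<lambda>z. exp (z * (\<i> * of_int m))) has_field_derivative (\<i> * of_int m * exp (of_real t * (\<i> * of_int m)))) (at (of_real t))"
      by (auto intro!: derivative_eq_intros simp: mult_ac)
    then have "((\<lambda>t. exp (of_real t * (\<i> * of_int m))) has_vector_derivative (\<i> * of_int m * exp (of_real t * (\<i> * of_int m)))) (at t within T)"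
      by (rule has_vector_derivative_real_field)
    then show ?thesis by (simp add: cis_conv_exp mult_ac)
  qed
  have "((\<lambda>t. (angular_deriv2 r t + of_int (m\<^sup>2) * F (circle_pt r t)) * cis (of_int m * t)) has_integral (?f (2*pi) - ?f 0)) {0..2*pi}"
  proof (rule fundamental_theorem_of_calculus)
    fix t assume "t \<in> {0..2*pi}"
    have 1: "((\<lambda>t. angular_deriv F r t) has_vector_derivative angular_deriv2 r t) (at t within {0..2*pi})"
    proof -
      have s: "((\<lambda>t. - r * sin t) has_real_derivative - r * cos t) (at t within {0..2*pi})"
         "((\<lambda>t. r * cos t) has_real_derivative - r * sin t) (at t within {0..2*pi})"
        by (auto intro!: derivative_eq_intros)
      have d: "((\<lambda>t. partial_deriv i F (circle_pt r t)) has_vector_derivative angular_deriv (partial_deriv i F) r t) (at t within {0..2*pi})" for i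
        by (rule angular_deriv_has_vector_derivative[OF smooth_partials(1) open_norm_greater circle_pt_in[OF assms]])
      show ?thesis
        unfolding angular_deriv_def[of F]
        using has_vector_derivative_add[OF has_vector_derivative_scaleR[OF s(1) d[of 1]] has_vector_derivative_scaleR[OF s(2) d[of 2]]]
        by (simp add: angular_deriv2_def algebra_simps)
    qed
    have 2: "((\<lambda>t. F (circle_pt r t)) has_vector_derivative angular_deriv F r t) (at t within {0..2*pi})"
      by (rule angular_deriv_has_vector_derivative[OF F open_norm_greater circle_pt_in[OF assms]])
    have 3: "((\<lambda>t. \<i> * of_int m * cis (of_int m * t)) has_vector_derivative \<i> * of_int m * (\<i> * of_int m * cis (of_int m * t))) (at t within {0..2*pi})"
      by (rule bounded_linear.has_vector_derivative[OF bounded_linear_mult_right cis'])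
    have "(?f has_vector_derivative (angular_deriv F r t * (\<i> * of_int m * cis (of_int m * t)) + angular_deriv2 r t * cis (of_int m * t)
       - (F (circle_pt r t) * (\<i> * of_int m * (\<i> * of_int m * cis (of_int m * t))) + angular_deriv F r t * (\<i> * of_int m * cis (of_int m * t)))))
       (at t within {0..2*pi})"
      by (intro has_vector_derivative_diff has_vector_derivative_mult 1 2 3 cis')
    moreover have "(angular_deriv F r t * (\<i> * of_int m * cis (of_int m * t)) + angular_deriv2 r t * cis (of_int m * t)
       - (F (circle_pt r t) * (\<i> * of_int m * (\<i> * of_int m * cis (of_int m * t))) + angular_deriv F r t * (\<i> * of_int m * cis (of_int m * t))))
      = (angular_deriv2 r t + of_int (m\<^sup>2) * F (circle_pt r t)) * cis (of_int m * t)"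
      by (simp add: algebra_simps power2_eq_square)
    ultimately show "(?f has_vector_derivative (angular_deriv2 r t + of_int (m\<^sup>2) * F (circle_pt r t)) * cis (of_int m * t)) (at t within {0..2*pi})"
      by simp
  qed simp
  moreover have "?f (2*pi) = ?f 0"
  proof -
    have "circle_pt r (2*pi) = circle_pt r 0" by (simp add: circle_pt_def)
    moreover have "cis (of_int m * (2*pi)) = 1"
      using cis_multiple_2pi[of "of_int m"] by (simp add: mult_ac)
    ultimately show ?thesis by (simp add: angular_deriv_def)
  qed
  ultimately show ?thesis by (simp add: integral_unique)
qed

text \<open>The polar Laplacian is integrated against cis(m t), and \<open>angular_integral\<close>
  replaces - F_tt by m^2 F. The radial equation follows once the mode of the Laplacian is expressed
  by the mode itself.\<close>

lemma mode_deriv_has_derivative: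
  assumes "R < r"
  shows "((\<lambda>r. r *\<^sub>R mode_deriv m r) has_vector_derivative (of_int (m\<^sup>2) / r) *\<^sub>R mode m F r + r *\<^sub>R mode m (laplacian F) r) (at r)"
proof -
  let ?c = "\<lambda>t. cis (of_int m * t)"
  have r: "r > 0" using assms R by simp
  have rd: "radial_deriv (partial_deriv i F) = (\<lambda>r t. cos t *\<^sub>R partial_deriv 1 (partial_deriv i F) (circle_pt r t) + sin t *\<^sub>R partial_deriv 2 (partial_deriv i F) (circle_pt r t))" for i
    by (intro ext) (rule radial_deriv_def)
  note cp = smooth_circle_continuous[OF smooth_partials(1), unfolded case_prod_beta] smooth_circle_continuous[OF smooth_partials(2), unfolded case_prod_beta]
  have "((\<lambda>r. integral (cbox 0 (2*pi)) (\<lambda>t. r *\<^sub>R (radial_deriv F r t * ?c t))) has_vector_derivative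
      integral (cbox 0 (2*pi)) (\<lambda>t. (radial_deriv F r t + r *\<^sub>R radial_deriv2 r t) * ?c t)) (at r within {R<..})"
  proof (rule leibniz_rule_vector_derivative)
    fix s t assume s: "s \<in> {R<..}"
    have "((\<lambda>r. partial_deriv i F (circle_pt r t)) has_vector_derivative radial_deriv (partial_deriv i F) s t) (at s within {R<..})" for i
      using s by (intro radial_deriv_has_vector_derivative[OF smooth_partials(1) open_norm_greater] circle_pt_in) simp
    then have "((\<lambda>r. radial_deriv F r t) has_vector_derivative radial_deriv2 s t) (at s within {R<..})"
      unfolding radial_deriv_def[of F] radial_deriv2_def
      by (intro has_vector_derivative_add bounded_linear.has_vector_derivative[OF bounded_linear_scaleR_right])
    then have "((\<lambda>r. radial_deriv F r t * ?c t) has_vector_derivative radial_deriv2 s t * ?c t) (at s within {R<..})"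
      by (rule bounded_linear.has_vector_derivative[OF bounded_linear_mult_left])
    from has_vector_derivative_scaleR[OF DERIV_ident this]
    show "((\<lambda>r. r *\<^sub>R (radial_deriv F r t * ?c t)) has_vector_derivative (radial_deriv F s t + s *\<^sub>R radial_deriv2 s t) * ?c t) (at s within {R<..})"
      by (simp add: algebra_simps)
  next
    fix s assume "s \<in> {R<..}"
    then show "(\<lambda>t. s *\<^sub>R (radial_deriv F s t * ?c t)) integrable_on cbox 0 (2*pi)"
      by (intro integrable_continuous continuous_intros radial_deriv_continuous_t) simp
  next
    show "continuous_on ({R<..} \<times> cbox 0 (2*pi)) (\<lambda>(x, t). (radial_deriv F x t + x *\<^sub>R radial_deriv2 x t) * ?c t)"
      unfolding case_prod_beta radial_deriv2_def rd
      by (intro continuous_intros radial_deriv_continuous[unfolded case_prod_beta] cp)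
  qed (use assms in auto)
  also have "integral (cbox 0 (2*pi)) (\<lambda>t. (radial_deriv F r t + r *\<^sub>R radial_deriv2 r t) * ?c t)
     = integral (cbox 0 (2*pi)) (\<lambda>t. (r *\<^sub>R (laplacian F (circle_pt r t) * ?c t) + (of_int (m\<^sup>2) / r) *\<^sub>R (F (circle_pt r t) * ?c t))
        - (1 / r) *\<^sub>R ((angular_deriv2 r t + of_int (m\<^sup>2) * F (circle_pt r t)) * ?c t))"
    unfolding polar_laplacian[OF r]
    by (intro Henstock_Kurzweil_Integration.integral_cong) (simp add: scaleR_conv_of_real algebra_simps)
  also have "\<dots> = integral (cbox 0 (2*pi)) (\<lambda>t. r *\<^sub>R (laplacian F (circle_pt r t) * ?c t) + (of_int (m\<^sup>2) / r) *\<^sub>R (F (circle_pt r t) * ?c t))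
       - integral (cbox 0 (2*pi)) (\<lambda>t. (1 / r) *\<^sub>R ((angular_deriv2 r t + of_int (m\<^sup>2) * F (circle_pt r t)) * ?c t))"
  proof (intro Henstock_Kurzweil_Integration.integral_diff integrable_continuous)
    show "continuous_on (cbox 0 (2*pi)) (\<lambda>t. r *\<^sub>R (laplacian F (circle_pt r t) * ?c t) + (of_int (m\<^sup>2) / r) *\<^sub>R (F (circle_pt r t) * ?c t))"
      by (intro continuous_intros smooth_circle_continuous_t assms F smooth_on_laplacian open_norm_greater)
    show "continuous_on (cbox 0 (2*pi)) (\<lambda>t. (1 / r) *\<^sub>R ((angular_deriv2 r t + of_int (m\<^sup>2) * F (circle_pt r t)) * ?c t))"
      unfolding angular_deriv2_def angular_deriv_def
      by (intro continuous_intros smooth_circle_continuous_t assms F smooth_partials)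
  qed
  also have "\<dots> = integral (cbox 0 (2*pi)) (\<lambda>t. r *\<^sub>R (laplacian F (circle_pt r t) * ?c t) + (of_int (m\<^sup>2) / r) *\<^sub>R (F (circle_pt r t) * ?c t))"
    using angular_integral[OF assms, of m] by (simp only: Henstock_Kurzweil_Integration.integral_cmul) simp
  also have "\<dots> = integral (cbox 0 (2*pi)) (\<lambda>t. r *\<^sub>R (laplacian F (circle_pt r t) * ?c t)) + integral (cbox 0 (2*pi)) (\<lambda>t. (of_int (m\<^sup>2) / r) *\<^sub>R (F (circle_pt r t) * ?c t))"
    by (intro Henstock_Kurzweil_Integration.integral_add integrable_continuous continuous_intros smooth_circle_continuous_t assms F smooth_on_laplacian open_norm_greater)
  also have "\<dots> = (of_int (m\<^sup>2) / r) *\<^sub>R mode m F r + r *\<^sub>R mode m (laplacian F) r"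
    unfolding mode_eq_integral[OF F assms] mode_eq_integral[OF smooth_on_laplacian[OF open_norm_greater F] assms]
    by (simp only: Henstock_Kurzweil_Integration.integral_cmul add.commute)
  finally have "((\<lambda>r. integral (cbox 0 (2*pi)) (\<lambda>t. r *\<^sub>R (radial_deriv F r t * ?c t))) has_vector_derivative
      (of_int (m\<^sup>2) / r) *\<^sub>R mode m F r + r *\<^sub>R mode m (laplacian F) r) (at r within {R<..})" .
  then show ?thesis
    using assms by (simp only: Henstock_Kurzweil_Integration.integral_cmul mode_deriv_def[symmetric] at_within_open[of r "{R<..}"] greaterThan_iff open_greaterThan)
qed

text \<open>The radiation condition is uniform in the direction, so it survives integration over the
  circle.\<close>

lemma mode_radiation:
  assumes "sommerfeld k F"
  shows "((\<lambda>r. of_real (sqrt r) * (mode_deriv m r - \<i> * of_real k * mode m F r)) \<longlongrightarrow> 0) at_top"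
proof (rule tendstoI)
  fix e :: real assume e: "e > 0"
  \<comment> \<open>The summand 1 beyond the interval length 2 pi makes the final inequality
    strict.\<close>
  define e' where "e' = e / (2 * pi + 1)"
  have e': "e' > 0" using e pi_gt_zero by (simp add: e'_def add_pos_pos)
  have "\<forall>\<^sub>F r in at_top. \<forall>x\<in>sphere 0 1. dist (of_real (sqrt r) * (vector_derivative (\<lambda>s. F (s *\<^sub>R x)) (at r) - \<i> * of_real k * F (r *\<^sub>R x))) 0 < e'"
    using assms e' unfolding sommerfeld_def uniform_limit_iff by blast
  then show "\<forall>\<^sub>F r in at_top. dist (of_real (sqrt r) * (mode_deriv m r - \<i> * of_real k * mode m F r)) 0 < e"
    using eventually_gt_at_top[of R]
  proof eventually_elim
    case (elim r)
    let ?g = "\<lambda>t. (of_real (sqrt r) * (radial_deriv F r t - \<i> * of_real k * F (circle_pt r t))) * cis (of_int m * t)"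
    have b: "norm (?g t) \<le> e'" for t
    proof -
      have sc: "s *\<^sub>R circle_pt 1 t = circle_pt s t" for s
        by (simp add: circle_pt_def vector2_scaleR)
      have vd: "vector_derivative (\<lambda>s. F (circle_pt s t)) (at r) = radial_deriv F r t"
        using radial_deriv_has_vector_derivative[OF F open_norm_greater circle_pt_in[OF elim(2)]] by (rule vector_derivative_at)
      have "circle_pt 1 t \<in> sphere 0 1" by simp
      with elim(1) have "dist (of_real (sqrt r) * (vector_derivative (\<lambda>s. F (s *\<^sub>R circle_pt 1 t)) (at r) - \<i> * of_real k * F (r *\<^sub>R circle_pt 1 t))) 0 < e'"
        by blast
      then show ?thesis unfolding sc vd by (simp add: norm_mult)
    qed
    have c1: "continuous_on (cbox 0 (2*pi)) (\<lambda>t. radial_deriv F r t * cis (of_int m * t))"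
      by (intro continuous_intros radial_deriv_continuous_t elim)
    have c2: "continuous_on (cbox 0 (2*pi)) (\<lambda>t. F (circle_pt r t) * cis (of_int m * t))"
      by (intro continuous_intros smooth_circle_continuous_t F elim)
    have "of_real (sqrt r) * (mode_deriv m r - \<i> * of_real k * mode m F r) = integral (cbox 0 (2*pi)) ?g"
    proof -
      have "integral (cbox 0 (2*pi)) ?g = integral (cbox 0 (2*pi)) (\<lambda>t. of_real (sqrt r) * (radial_deriv F r t * cis (of_int m * t))
          - (of_real (sqrt r) * \<i> * of_real k) * (F (circle_pt r t) * cis (of_int m * t)))"
        by (simp add: algebra_simps)
      also have "\<dots> = integral (cbox 0 (2*pi)) (\<lambda>t. of_real (sqrt r) * (radial_deriv F r t * cis (of_int m * t)))
          - integral (cbox 0 (2*pi)) (\<lambda>t. (of_real (sqrt r) * \<i> * of_real k) * (F (circle_pt r t) * cis (of_int m * t)))"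
        by (intro Henstock_Kurzweil_Integration.integral_diff integrable_continuous continuous_on_mult continuous_on_const c1 c2)
      also have "\<dots> = of_real (sqrt r) * mode_deriv m r - (of_real (sqrt r) * \<i> * of_real k) * mode m F r"
        unfolding mode_deriv_def mode_eq_integral[OF F elim(2)] by (simp only: integral_mult_right)
      finally show ?thesis by (simp add: algebra_simps)
    qed
    also have "norm \<dots> \<le> e' * (2*pi - 0)"
      unfolding cbox_interval
    proof (rule integral_bound)
      show "continuous_on {0..2*pi} ?g"
        by (intro continuous_intros radial_deriv_continuous_t smooth_circle_continuous_t F elim)
    qed (use b in auto)
    also have "\<dots> < e"
      using e by (simp add: e'_def field_simps add_pos_pos)
    finally show ?case by simp
  qed
qed

end

section \<open>Uniqueness outside the ball\<close>

inductive_set trig_polys :: "(real \<Rightarrow> complex) set" where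
  cis: "(\<lambda>t. cis (of_int m * t)) \<in> trig_polys"
| add: "f \<in> trig_polys \<Longrightarrow> g \<in> trig_polys \<Longrightarrow> (\<lambda>t. f t + g t) \<in> trig_polys"
| scale: "f \<in> trig_polys \<Longrightarrow> (\<lambda>t. c * f t) \<in> trig_polys"

lemma trig_polys_const: "(\<lambda>t. c) \<in> trig_polys"
  using trig_polys.scale[OF trig_polys.cis[of 0], of c] by simp

lemma trig_polys_mult_cis: "f \<in> trig_polys \<Longrightarrow> (\<lambda>t. cis (of_int m * t) * f t) \<in> trig_polys"
proof (induction rule: trig_polys.induct)
  case (cis l)
  have "(\<lambda>t. cis (of_int m * t) * cis (of_int l * t)) = (\<lambda>t. cis (of_int (m + l) * t))"
    by (simp add: cis_mult algebra_simps)
  then show ?case by (simp only: trig_polys.cis)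
next
  case (add f g)
  then show ?case using trig_polys.add by (simp add: distrib_left)
next
  case (scale f c)
  then show ?case using trig_polys.scale[of "\<lambda>t. cis (of_int m * t) * f t" c] by (simp add: mult_ac)
qed

text \<open>Closure under products is what turns restrictions of polynomials to a circle into
  trigonometric polynomials.\<close>

lemma trig_polys_mult: "f \<in> trig_polys \<Longrightarrow> g \<in> trig_polys \<Longrightarrow> (\<lambda>t. f t * g t) \<in> trig_polys"
proof (induction rule: trig_polys.induct)
  case (cis l)
  then show ?case by (rule trig_polys_mult_cis)
next
  case (add f h)
  then show ?case using trig_polys.add by (simp add: distrib_right)
next
  case (scale f c)
  then show ?case using trig_polys.scale[of "\<lambda>t. f t * g t" c] by (simp add: mult_ac)
qed

lemma trig_polys_cos: "(\<lambda>t. of_real (cos t)) \<in> trig_polys" and trig_polys_sin: "(\<lambda>t. of_real (sin t)) \<in> trig_polys"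
proof -
  note c = trig_polys.cis[of 1] trig_polys.cis[of "-1"]
  have "(\<lambda>t. (1 / 2) * (cis (of_int 1 * t) + cis (of_int (- 1) * t))) = (\<lambda>t. of_real (cos t))"
    by (simp add: fun_eq_iff complex_eq_iff)
  then show "(\<lambda>t. of_real (cos t)) \<in> trig_polys"
    using trig_polys.scale[OF trig_polys.add[OF c], of "1 / 2"] by simp
  have "(\<lambda>t. (- \<i> / 2) * (cis (of_int 1 * t) + (- 1) * cis (of_int (- 1) * t))) = (\<lambda>t. of_real (sin t))"
    by (simp add: fun_eq_iff complex_eq_iff)
  then show "(\<lambda>t. of_real (sin t)) \<in> trig_polys"
    using trig_polys.scale[OF trig_polys.add[OF c(1) trig_polys.scale[OF c(2), of "- 1"]], of "- \<i> / 2"] by simp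
qed

lemma trig_polys_real_polynomial:
  "real_polynomial_function p \<Longrightarrow> (\<lambda>t. of_real (p (circle_pt r t))) \<in> trig_polys"
proof (induction rule: real_polynomial_function.induct)
  case (linear f)
  then interpret bounded_linear f .
  have "f (circle_pt r t) = r * f (axis 1 1) * cos t + r * f (axis 2 1) * sin t" for t
    by (simp add: circle_pt_def vector2_eq add scale)
  then have e: "(\<lambda>t. complex_of_real (f (circle_pt r t))) = 
      (\<lambda>t. of_real (r * f (axis 1 1)) * of_real (cos t) + of_real (r * f (axis 2 1)) * of_real (sin t))"
    by simp
  show ?case unfolding e by (intro trig_polys.add trig_polys.scale trig_polys_cos trig_polys_sin)
next
  case (const c)
  show ?case by (rule trig_polys_const)
next
  case (add f g)
  then show ?case using trig_polys.add by simp
next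
  case (mult f g)
  then show ?case using trig_polys_mult by simp
qed

lemma trig_polys_polynomial:
  assumes "polynomial_function (q :: real^2 \<Rightarrow> complex)"
  shows "(\<lambda>t. q (circle_pt r t)) \<in> trig_polys"
proof -
  have "real_polynomial_function (Re \<circ> q)" "real_polynomial_function (Im \<circ> q)"
    using assms bounded_linear_Re bounded_linear_Im unfolding polynomial_function_def by blast+
  from this[THEN trig_polys_real_polynomial[where r=r]]
  have "(\<lambda>t. of_real (Re (q (circle_pt r t))) + \<i> * of_real (Im (q (circle_pt r t)))) \<in> trig_polys"
    unfolding o_def by (intro trig_polys.add trig_polys.scale)
  then show ?thesis by (simp flip: complex_eq)
qed

lemma trig_polys_continuous: "f \<in> trig_polys \<Longrightarrow> continuous_on S f"
  by (induction rule: trig_polys.induct) (auto intro!: continuous_intros)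

lemma trig_polys_orthogonal:
  assumes h: "continuous_on {0..2*pi} h" and z: "\<And>m::int. (LINT t:{0..2*pi}|lborel. h t * cis (of_int m * t)) = 0"
    and f: "f \<in> trig_polys"
  shows "(LINT t:{0..2*pi}|lborel. h t * f t) = 0"
  using f
proof (induction rule: trig_polys.induct)
  case (cis m)
  show ?case by (rule z)
next
  case (add f g)
  have "set_integrable lborel {0..2*pi} (\<lambda>t. h t * f t)" "set_integrable lborel {0..2*pi} (\<lambda>t. h t * g t)"
    unfolding set_integrable_def
    by (intro borel_integrable_compact compact_Icc continuous_intros h trig_polys_continuous add)+
  with add show ?case by (simp add: distrib_left set_integral_add)
next
  case (scale f c)
  have "(LINT t:{0..2*pi}|lborel. h t * (c * f t)) = (LINT t:{0..2*pi}|lborel. c * (h t * f t))"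
    by (simp add: mult_ac)
  with scale show ?case by simp
qed

text \<open>On the circle the conjugate of \<open>g\<close> is a uniform limit of polynomials, whose
  restrictions integrate to 0 against \<open>g\<close>. So the integral of |g|^2 is 0, and
  continuity gives the claim pointwise.\<close>

lemma zero_if_modes_zero:
  assumes g: "continuous_on (sphere 0 r) g" and r: "r > 0" and z: "\<And>m. mode m g r = 0" and x: "norm x = r"
  shows "g x = 0"
proof -
  let ?I = "{0..2*pi}"
  define h where "h t = g (circle_pt r t)" for t
  have h: "continuous_on S h" for S
    unfolding h_def by (rule continuous_on_compose2[OF g]) (use r in \<open>auto intro!: continuous_intros\<close>)
  have hi: "set_integrable lborel ?I (\<lambda>t. cmod (h t))" "set_integrable lborel ?I (\<lambda>t. h t * cnj (h t))"
    unfolding set_integrable_def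
    by (intro borel_integrable_compact compact_Icc continuous_intros h)+
  define N where "N = (LINT t:?I|lborel. cmod (h t))"
  define Q where "Q = (LINT t:?I|lborel. h t * cnj (h t))"
  have N: "N \<ge> 0" by (simp add: N_def set_lebesgue_integral_def)
  have "cmod Q \<le> e" if e: "e > 0" for e
  proof -
    have e': "e / (N + 1) > 0" using e N by simp
    have "continuous_on (sphere 0 r) (\<lambda>x. cnj (g x))" by (intro continuous_intros g)
    from Stone_Weierstrass_polynomial_function[OF compact_sphere this e']
    obtain q where q: "polynomial_function q" "\<And>x. x \<in> sphere 0 r \<Longrightarrow> cmod (cnj (g x) - q x) < e / (N + 1)" by blast
    define f where "f t = q (circle_pt r t)" for t
    have f: "f \<in> trig_polys" unfolding f_def by (rule trig_polys_polynomial[OF q(1)])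
    have "(LINT t:?I|lborel. h t * f t) = 0"
      by (rule trig_polys_orthogonal[OF h _ f]) (use z in \<open>simp add: mode_def h_def\<close>)
    moreover have fi: "set_integrable lborel ?I (\<lambda>t. h t * f t)"
      unfolding set_integrable_def
      by (intro borel_integrable_compact compact_Icc continuous_intros h trig_polys_continuous[OF f])
    ultimately have "Q = (LINT t:?I|lborel. h t * (cnj (h t) - f t))"
      using set_integral_diff(2)[OF hi(2) fi] by (simp add: Q_def right_diff_distrib)
    also have "cmod \<dots> \<le> (LINT t|lborel. norm (indicat_real ?I t *\<^sub>R (h t * (cnj (h t) - f t))))"
      unfolding set_lebesgue_integral_def by (rule integral_norm_bound)
    also have "\<dots> \<le> (LINT t|lborel. (e / (N + 1)) * (indicat_real ?I t *\<^sub>R cmod (h t)))"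
    proof (rule integral_mono)
      have "set_integrable lborel ?I (\<lambda>t. h t * (cnj (h t) - f t))"
        unfolding set_integrable_def
        by (intro borel_integrable_compact compact_Icc continuous_intros h trig_polys_continuous[OF f])
      then show "integrable lborel (\<lambda>t. norm (indicat_real ?I t *\<^sub>R (h t * (cnj (h t) - f t))))"
        unfolding set_integrable_def by (rule integrable_norm)
      show "integrable lborel (\<lambda>t. (e / (N + 1)) * (indicat_real ?I t *\<^sub>R cmod (h t)))"
        using hi(1) by (simp add: set_integrable_def)
      fix t
      have "cmod (cnj (h t) - f t) \<le> e / (N + 1)"
        using q(2)[of "circle_pt r t"] r by (simp add: h_def f_def)
      from mult_right_mono[OF this norm_ge_zero[of "h t"]]
      show "norm (indicat_real ?I t *\<^sub>R (h t * (cnj (h t) - f t))) \<le> (e / (N + 1)) * (indicat_real ?I t *\<^sub>R cmod (h t))"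
        by (auto simp: indicator_def norm_mult mult.commute)
    qed
    also have "\<dots> = e / (N + 1) * N" by (simp add: N_def set_lebesgue_integral_def)
    also have "\<dots> = (N / (N + 1)) * e" by simp
    also have "\<dots> \<le> 1 * e" using N e by (intro mult_right_mono) auto
    finally show ?thesis by simp
  qed
  then have "cmod Q \<le> 0" using field_le_epsilon[of "cmod Q" 0] by simp
  moreover have "Q = of_real (LINT t:?I|lborel. (cmod (h t))\<^sup>2)"
    by (simp add: Q_def complex_norm_square[symmetric] set_lebesgue_integral_def scaleR_conv_of_real
        flip: of_real_power of_real_mult)
  ultimately have "(LINT t:?I|lborel. (cmod (h t))\<^sup>2) = 0" by simp
  moreover have c2: "continuous_on ?I (\<lambda>t. (cmod (h t))\<^sup>2)" by (intro continuous_intros h)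
  moreover have "set_integrable lborel ?I (\<lambda>t. (cmod (h t))\<^sup>2)"
    unfolding set_integrable_def by (intro borel_integrable_compact compact_Icc c2)
  note set_borel_integral_eq_integral[OF this]
  ultimately have hz: "((\<lambda>t. (cmod (h t))\<^sup>2) has_integral 0) (cbox 0 (2*pi))"
    by (simp add: has_integral_iff)
  obtain t where t: "0 \<le> t" "t < 2 * pi" "x = circle_pt (norm x) t" by (rule circle_pt_surj)
  have "(cmod (h t))\<^sup>2 = 0"
    by (rule has_integral_0_cbox_imp_0[OF _ _ hz]) (use c2 t in \<open>auto simp: box_real\<close>)
  with t(3) x show ?thesis by (simp add: h_def)
qed

section \<open>From radiating solutions to their exterior modes\<close>

lemma weak_partial_cong_AE:
  assumes "weak_partial \<Omega> i f g" "locally_integrable_on \<Omega> f'" "AE x in lborel. x \<in> \<Omega> \<longrightarrow> f' x = f x"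
  shows "weak_partial \<Omega> i f' g"
  using assms integral_cong_AE_test[OF assms(2) _ assms(3) test_functions_partial_deriv]
  unfolding weak_partial_alt by simp

text \<open>\<open>has_trace\<close> provides first derivatives of the Laplacian in the ball only,
  whereas \<open>trace_mode_limit\<close> asks for them across the circle; they come from the H^4
  regularity of \<open>u\<close> on a larger ball.\<close>

lemma sobolev_laplacian_weak_partial:
  assumes "open \<Omega>" "sobolev 4 \<Omega> u" "weak_laplacian \<Omega> u w"
  shows "\<exists>d. weak_partial \<Omega> i w d"
proof -
  have s: "sobolev (Suc (Suc (Suc (Suc 0)))) \<Omega> u" using assms(2) by (simp add: numeral_eq_Suc)
  then have "\<forall>i. \<exists>g. weak_partial \<Omega> i u g \<and> sobolev (Suc (Suc (Suc 0))) \<Omega> g"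
    by (subst (asm) sobolev.simps(2)) blast
  from choice[OF this] obtain G where G: "\<And>i. weak_partial \<Omega> i u (G i)" "\<And>i. sobolev (Suc (Suc (Suc 0))) \<Omega> (G i)" by blast
  have "\<forall>i. \<exists>g. weak_partial \<Omega> i (G i) g \<and> sobolev (Suc (Suc 0)) \<Omega> g"
    using G(2) by (subst (asm) sobolev.simps(2)) blast
  from choice[OF this] obtain K where K: "\<And>i. weak_partial \<Omega> i (G i) (K i)" "\<And>i. sobolev (Suc (Suc 0)) \<Omega> (K i)" by blast
  have "\<forall>j. \<exists>g. weak_partial \<Omega> i (K j) g"
    using K(2) by (subst (asm) sobolev.simps(2)) blast
  from choice[OF this] obtain L where L: "\<And>j. weak_partial \<Omega> i (K j) (L j)" by blast
  have "weak_laplacian \<Omega> u (\<lambda>x. \<Sum>i\<in>UNIV. K i x)"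
    by (rule weak_laplacian_of_partials[OF assms(1) G(1) K(1)])
  then have "AE x in lborel. x \<in> \<Omega> \<longrightarrow> w x = (\<Sum>i\<in>UNIV. K i x)"
    by (intro weak_laplacian_unique[OF assms(1,3)]) auto
  then have "weak_partial \<Omega> i w (\<lambda>x. \<Sum>j\<in>UNIV. L j x)"
    using assms(3) by (intro weak_partial_cong_AE[OF weak_partial_sum2[OF L]]) (auto simp: weak_laplacian_alt)
  then show ?thesis by blast
qed

text \<open>The set where the two functions differ is open, and a nonempty open set is not
  negligible.\<close>

lemma AE_eq_imp_eq_continuous:
  fixes f g :: "real^2 \<Rightarrow> complex"
  assumes "open \<Omega>" "continuous_on \<Omega> f" "continuous_on \<Omega> g" "AE x in lborel. x \<in> \<Omega> \<longrightarrow> f x = g x" "x \<in> \<Omega>"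
  shows "f x = g x"
proof (rule ccontr)
  assume "f x \<noteq> g x"
  let ?D = "{y \<in> \<Omega>. f y - g y \<in> - {0}}"
  have "open ?D"
    using continuous_open_preimage[OF continuous_on_diff[OF assms(2,3)] assms(1), of "- {0}"] 
    by (simp add: vimage_def Int_def open_Compl)
  moreover have "x \<in> ?D" using \<open>f x \<noteq> g x\<close> assms(5) by simp
  ultimately have "\<not> negligible ?D" using open_not_negligible by blast
  moreover have "AE x in lebesgue. x \<notin> ?D"
    unfolding AE_completion_iff using assms(4) by eventually_elim auto
  then have "negligible ?D"
    using \<open>open ?D\<close> by (simp add: negligible_iff_null_sets AE_iff_null_sets)
  ultimately show False by blast
qed

text \<open>Turns the traces, taken from inside, into limits of modes from outside. The weak
  Laplacian in the measurements and the one in the equation both agree with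
  \<open>laplacian u\<close> almost everywhere outside the ball.\<close>

lemma radiating_exterior:
  assumes R: "R > 0" and u: "radiating_solution k R (zero_extension (ball 0 R) S) u" and dd: "dirichlet_data R u f g"
  obtains w z where "weak_laplacian UNIV u w" "weak_laplacian UNIV w z"
    "AE x in lborel. z x - of_real (k^4) * u x = zero_extension (ball 0 R) S x"
    "\<And>x. R < norm x \<Longrightarrow> laplacian (laplacian u) x = of_real (k^4) * u x"
    "\<And>m. (mode m u \<longlongrightarrow> mode m f R) (at_right R)"
    "\<And>m. (mode m (laplacian u) \<longlongrightarrow> mode m g R) (at_right R)"
proof -
  let ?X = "{x. R < norm x} :: (real^2) set"
  have oX: "open ?X" by (rule open_norm_greater)
  from u obtain w z where w: "weak_laplacian UNIV u w" "weak_laplacian UNIV w z"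
    and eq: "AE x in lborel. z x - of_real (k^4) * u x = zero_extension (ball 0 R) S x"
    and sob: "\<And>\<rho>. \<rho> > 0 \<Longrightarrow> sobolev 4 (ball 0 \<rho>) u" and sm: "smooth_on ?X u"
    unfolding radiating_solution_def by blast
  have wX: "AE x in lborel. x \<in> ?X \<longrightarrow> w x = laplacian u x"
    by (rule weak_laplacian_unique[OF oX weak_laplacian_subset[OF w(1)] smooth_on_weak_laplacian[OF oX sm]]) auto
  have smL: "smooth_on ?X (laplacian u)" by (rule smooth_on_laplacian[OF oX sm])
  have zX: "AE x in lborel. x \<in> ?X \<longrightarrow> z x = laplacian (laplacian u) x"
    by (rule weak_laplacian_unique[OF oX weak_laplacian_subset[OF w(2)] smooth_on_weak_laplacian[OF oX smL] wX]) auto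
  \<comment> \<open>The extended source is 0 here, so the equation holds almost everywhere, and by
    continuity everywhere.\<close>
  have LL: "laplacian (laplacian u) x = of_real (k^4) * u x" if "R < norm x" for x
  proof (rule AE_eq_imp_eq_continuous[OF oX])
    show "continuous_on ?X (laplacian (laplacian u))"
      by (rule smooth_on_continuous_on[OF smooth_on_laplacian[OF oX smL]])
    show "continuous_on ?X (\<lambda>x. of_real (k^4) * u x)"
      by (intro continuous_intros smooth_on_continuous_on sm)
    show "AE x in lborel. x \<in> ?X \<longrightarrow> laplacian (laplacian u) x = of_real (k^4) * u x"
      using zX eq by eventually_elim (auto simp: zero_extension_def)
  qed (use that in simp)
  have \<rho>: "3 * R > 0" using R by simp
  have "\<forall>i. \<exists>d. weak_partial (ball 0 (3 * R)) i u d"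
    using sob[OF \<rho>] by (simp add: numeral_eq_Suc) blast
  from choice[OF this] obtain d where d: "\<And>i. weak_partial (ball 0 (3 * R)) i u (d i)" by blast
  have 1: "(mode m u \<longlongrightarrow> mode m f R) (at_right R)" for m
    by (rule trace_mode_limit[OF R _ d sm]) (use dd in \<open>auto simp: dirichlet_data_def\<close>)
  from dd obtain w' where w': "weak_laplacian UNIV u w'" "has_trace R w' g"
    unfolding dirichlet_data_def by blast
  have w'X: "AE x in lborel. R < norm x \<longrightarrow> w' x = laplacian u x"
    using weak_laplacian_unique[OF oX weak_laplacian_subset[OF w'(1)] smooth_on_weak_laplacian[OF oX sm]] by auto
  have "\<forall>i. \<exists>d. weak_partial (ball 0 (3 * R)) i w' d"
    using sobolev_laplacian_weak_partial[OF open_ball sob[OF \<rho>] weak_laplacian_subset[OF w'(1) subset_UNIV]] by blast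
  from choice[OF this] obtain d' where d': "\<And>i. weak_partial (ball 0 (3 * R)) i w' (d' i)" by blast
  have 2: "(mode m (laplacian u) \<longlongrightarrow> mode m g R) (at_right R)" for m
    by (rule trace_mode_limit[OF R w'(2) d' smL w'X])
  show ?thesis by (rule that[OF w eq LL 1 2])
qed

text \<open>For v = u 0 - u 1 and \<sigma> = 1 or -1, the mode of \<Delta>v + \<sigma> k^2 v solves
  the radial equation with c = \<sigma> k^2, because \<Delta>\<Delta>v = k^4 v = (\<sigma> k^2)^2 v.
  Both modes vanish, and their difference is 2 k^2 times the mode of v.\<close>

lemma radiating_modes_unique:
  assumes R: "R > 0" and k: "k > 0"
    and u: "\<And>j. j < (2::nat) \<Longrightarrow> smooth_on {x. R < norm x} (u j)" "\<And>j. j < 2 \<Longrightarrow> sommerfeld k (u j)" "\<And>j. j < 2 \<Longrightarrow> sommerfeld k (laplacian (u j))"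
      "\<And>j x. j < 2 \<Longrightarrow> R < norm x \<Longrightarrow> laplacian (laplacian (u j)) x = of_real (k^4) * u j x"
    and lim: "\<And>j. j < 2 \<Longrightarrow> (mode m (u j) \<longlongrightarrow> a) (at_right R)" "\<And>j. j < 2 \<Longrightarrow> (mode m (laplacian (u j)) \<longlongrightarrow> b) (at_right R)"
    and r: "r > R"
  shows "mode m (u 0) r = mode m (u 1) r"
proof -
  let ?L = "\<lambda>j. laplacian (u j)"
  have sL: "smooth_on {x. R < norm x} (?L j)" if "j < 2" for j
    by (rule smooth_on_laplacian[OF open_norm_greater u(1)[OF that]])
  have mLL: "mode m (laplacian (?L j)) s = of_real (k^4) * mode m (u j) s" if "j < 2" "s > R" for j s
  proof -
    have "mode m (laplacian (?L j)) s = (LINT t:{0..2*pi}|lborel. of_real (k^4) * (u j (circle_pt s t) * cis (of_int m * t)))"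
      unfolding mode_def using that R u(4)[OF that(1)] by (simp add: mult.assoc)
    then show ?thesis by (simp add: mode_def)
  qed
  \<comment> \<open>Differences are taken between modes rather than functions, so the smoothness and
    radiation conditions are used for each \<open>u j\<close> separately.\<close>
  define A where "A \<sigma> s = (mode m (?L 0) s - mode m (?L 1) s) + (\<sigma> * k\<^sup>2) *\<^sub>R (mode m (u 0) s - mode m (u 1) s)" for \<sigma> s :: real
  define B where "B \<sigma> s = (mode_deriv (?L 0) m s - mode_deriv (?L 1) m s) + (\<sigma> * k\<^sup>2) *\<^sub>R (mode_deriv (u 0) m s - mode_deriv (u 1) m s)" for \<sigma> s :: real
  have ode: "radial_ode (A \<sigma>) (B \<sigma>) R k (of_int (m\<^sup>2)) (\<sigma> * k\<^sup>2)" if \<sigma>: "\<sigma> * \<sigma> = 1" for \<sigma>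
  proof
    show "R > 0" "k > 0" "of_int (m\<^sup>2) \<ge> (0::real)" using R k by auto
    fix s assume s: "s > R"
    note dm = mode_has_derivative[OF u(1) R s, of _ m] mode_has_derivative[OF sL R s, of _ m]
    show "(A \<sigma> has_vector_derivative B \<sigma> s) (at s)"
      unfolding A_def [abs_def] B_def
      by (intro has_vector_derivative_add has_vector_derivative_diff bounded_linear.has_vector_derivative[OF bounded_linear_scaleR_right] dm) auto
    note dd = mode_deriv_has_derivative[OF u(1) R s, of _ m] mode_deriv_has_derivative[OF sL R s, of _ m]
    have "((\<lambda>s. (s *\<^sub>R mode_deriv (?L 0) m s - s *\<^sub>R mode_deriv (?L 1) m s) + (\<sigma> * k\<^sup>2) *\<^sub>R (s *\<^sub>R mode_deriv (u 0) m s - s *\<^sub>R mode_deriv (u 1) m s))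
      has_vector_derivative 
       (((of_int (m\<^sup>2) / s) *\<^sub>R mode m (?L 0) s + s *\<^sub>R mode m (laplacian (?L 0)) s) - ((of_int (m\<^sup>2) / s) *\<^sub>R mode m (?L 1) s + s *\<^sub>R mode m (laplacian (?L 1)) s))
       + (\<sigma> * k\<^sup>2) *\<^sub>R (((of_int (m\<^sup>2) / s) *\<^sub>R mode m (u 0) s + s *\<^sub>R mode m (?L 0) s) - ((of_int (m\<^sup>2) / s) *\<^sub>R mode m (u 1) s + s *\<^sub>R mode m (?L 1) s))) (at s)"
      by (intro has_vector_derivative_add has_vector_derivative_diff bounded_linear.has_vector_derivative[OF bounded_linear_scaleR_right] dd) auto
    moreover have "(\<lambda>s. (s *\<^sub>R mode_deriv (?L 0) m s - s *\<^sub>R mode_deriv (?L 1) m s) + (\<sigma> * k\<^sup>2) *\<^sub>R (s *\<^sub>R mode_deriv (u 0) m s - s *\<^sub>R mode_deriv (u 1) m s)) = (\<lambda>s. s *\<^sub>R B \<sigma> s)"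
      by (simp add: B_def scaleR_add_right scaleR_diff_right mult.commute)
    moreover have "(((of_int (m\<^sup>2) / s) *\<^sub>R mode m (?L 0) s + s *\<^sub>R mode m (laplacian (?L 0)) s) - ((of_int (m\<^sup>2) / s) *\<^sub>R mode m (?L 1) s + s *\<^sub>R mode m (laplacian (?L 1)) s))
       + (\<sigma> * k\<^sup>2) *\<^sub>R (((of_int (m\<^sup>2) / s) *\<^sub>R mode m (u 0) s + s *\<^sub>R mode m (?L 0) s) - ((of_int (m\<^sup>2) / s) *\<^sub>R mode m (u 1) s + s *\<^sub>R mode m (?L 1) s))
      = (of_int (m\<^sup>2) / s + \<sigma> * k\<^sup>2 * s) *\<^sub>R A \<sigma> s"
    proof -
      have k4: "complex_of_real (k^4) = of_real \<sigma> * of_real (k\<^sup>2) * (of_real \<sigma> * of_real (k\<^sup>2))"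
      proof -
        have "\<sigma> * k\<^sup>2 * (\<sigma> * k\<^sup>2) = (\<sigma> * \<sigma>) * k^4" by (simp add: power2_eq_square power4_eq_xxxx)
        then have "k^4 = \<sigma> * k\<^sup>2 * (\<sigma> * k\<^sup>2)" using \<sigma> by simp
        then have "complex_of_real (k^4) = of_real (\<sigma> * k\<^sup>2 * (\<sigma> * k\<^sup>2))" by (simp only:)
        then show ?thesis by (simp only: of_real_mult)
      qed
      have l: "(0::nat) < 2" "(1::nat) < 2" by auto
      show ?thesis
        unfolding mLL[OF l(1) s] mLL[OF l(2) s] A_def scaleR_conv_of_real of_real_add of_real_mult k4
        by (simp add: algebra_simps)
    qed
    ultimately show "((\<lambda>s. s *\<^sub>R B \<sigma> s) has_vector_derivative (of_int (m\<^sup>2) / s + \<sigma> * k\<^sup>2 * s) *\<^sub>R A \<sigma> s) (at s)"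
      by simp
  next
    have "(A \<sigma> \<longlongrightarrow> (b - b) + (\<sigma> * k\<^sup>2) *\<^sub>R (a - a)) (at_right R)"
      unfolding A_def [abs_def] by (intro tendsto_intros lim) auto
    then show "(A \<sigma> \<longlongrightarrow> 0) (at_right R)" by simp
  next
    let ?s = "\<lambda>F r. of_real (sqrt r) * (mode_deriv F m r - \<i> * of_real k * mode m F r)"
    note rad = mode_radiation[OF u(1) R u(2), of _ m] mode_radiation[OF sL R u(3), of _ m]
    have "((\<lambda>r. (?s (?L 0) r - ?s (?L 1) r) + (\<sigma> * k\<^sup>2) *\<^sub>R (?s (u 0) r - ?s (u 1) r)) \<longlongrightarrow> (0 - 0) + (\<sigma> * k\<^sup>2) *\<^sub>R (0 - 0)) at_top"
      by (intro tendsto_add tendsto_diff tendsto_scaleR tendsto_const rad) auto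
    moreover have "(\<lambda>r. (?s (?L 0) r - ?s (?L 1) r) + (\<sigma> * k\<^sup>2) *\<^sub>R (?s (u 0) r - ?s (u 1) r)) = (\<lambda>r. of_real (sqrt r) * (B \<sigma> r - \<i> * of_real k * A \<sigma> r))"
      by (simp add: A_def B_def scaleR_conv_of_real algebra_simps)
    ultimately show "((\<lambda>r. of_real (sqrt r) * (B \<sigma> r - \<i> * of_real k * A \<sigma> r)) \<longlongrightarrow> 0) at_top" by simp
  qed
  have "A 1 r = 0"
    by (rule radial_ode.zero_if_positive[OF ode _ r]) (use k in auto)
  moreover have "A (- 1) r = 0"
    by (rule radial_ode.zero_if_helmholtz[OF ode _ r]) auto
  moreover have "A 1 r - A (- 1) r = (2 * k\<^sup>2) *\<^sub>R (mode m (u 0) r - mode m (u 1) r)"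
    by (simp add: A_def scaleR_conv_of_real algebra_simps)
  ultimately show ?thesis using k by simp
qed

lemma radiating_exterior_unique:
  assumes R: "R > 0" and k: "k > 0"
    and u: "radiating_solution k R (zero_extension (ball 0 R) S1) u1" "radiating_solution k R (zero_extension (ball 0 R) S2) u2"
    and dd: "dirichlet_data R u1 f g" "dirichlet_data R u2 f g" and x: "R < norm x"
  shows "u1 x = u2 x"
proof -
  define v where "v j = (if j = (0::nat) then u1 else u2)" for j
  have sm: "smooth_on {x. R < norm x} (v j)" for j
    using u by (simp add: radiating_solution_def v_def)
  have som: "sommerfeld k (v j)" "sommerfeld k (laplacian (v j))" for j
    using u by (simp_all add: radiating_solution_def v_def)
  have ext: "(\<forall>x. R < norm x \<longrightarrow> laplacian (laplacian u) x = of_real (k^4) * u x) \<and>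
     (\<forall>m. (mode m u \<longlongrightarrow> mode m f R) (at_right R)) \<and> (\<forall>m. (mode m (laplacian u) \<longlongrightarrow> mode m g R) (at_right R))"
    if "radiating_solution k R (zero_extension (ball 0 R) S) u" "dirichlet_data R u f g" for S u
    by (rule radiating_exterior[OF R that]) blast
  have rest: "(\<forall>x. R < norm x \<longrightarrow> laplacian (laplacian (v j)) x = of_real (k^4) * v j x) \<and>
     (\<forall>m. (mode m (v j) \<longlongrightarrow> mode m f R) (at_right R)) \<and> (\<forall>m. (mode m (laplacian (v j)) \<longlongrightarrow> mode m g R) (at_right R))" for j
    using ext[OF u(1) dd(1)] ext[OF u(2) dd(2)] unfolding v_def by (cases "j = 0") simp_all
  have m: "mode m u1 r = mode m u2 r" if "R < r" for m r
    using radiating_modes_unique[OF R k, of v m "mode m f R" "mode m g R" r] sm som rest that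
    by (simp add: v_def)
  have cont: "continuous_on (sphere 0 (norm x)) u1" "continuous_on (sphere 0 (norm x)) u2"
    using sm[of 0] sm[of 1] x by (auto simp: v_def intro!: continuous_on_subset[OF smooth_on_continuous_on])
  have "u1 x - u2 x = 0"
  proof (rule zero_if_modes_zero[of "norm x" "\<lambda>x. u1 x - u2 x"])
    show "continuous_on (sphere 0 (norm x)) (\<lambda>x. u1 x - u2 x)" by (intro continuous_intros cont)
    show "mode l (\<lambda>x. u1 x - u2 x) (norm x) = 0" for l
    proof -
      have "set_integrable lborel {0..2*pi} (\<lambda>t. v (circle_pt (norm x) t) * cis (of_int l * t))"
        if "continuous_on (sphere 0 (norm x)) v" for v
        unfolding set_integrable_def
        by (intro borel_integrable_compact compact_Icc continuous_intros continuous_on_compose2[OF that]) auto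
      from this[OF cont(1)] this[OF cont(2)] show ?thesis
        using m[OF x, of l] by (simp add: mode_def left_diff_distrib set_integral_diff)
    qed
  qed (use x R in auto)
  then show ?thesis by simp
qed

section \<open>Approximation by mollifiers\<close>

text \<open>Radial truncation to the disc of radius \<open>M\<close>; the form with
  \<open>max\<close> is continuous without a case distinction.\<close>

definition clip :: "real \<Rightarrow> complex \<Rightarrow> complex" where
  "clip M z = (M / max M (cmod z)) *\<^sub>R z"

lemma clip_props:
  assumes "M > 0"
  shows "cmod (clip M z) \<le> M" "cmod (clip M z) \<le> cmod z" "cmod z \<le> M \<Longrightarrow> clip M z = z"
    "cmod (z - clip M z) \<le> cmod z" "continuous_on UNIV (clip M)"
proof -
  have "M * cmod z \<le> M * max M (cmod z)" using assms by (intro mult_left_mono) auto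
  then show "cmod (clip M z) \<le> M"
    using assms by (simp add: clip_def pos_divide_le_eq max.strict_coboundedI1)
  have f: "0 \<le> M / max M (cmod z)" "M / max M (cmod z) \<le> 1"
    using assms by (auto simp: divide_le_eq_1 less_max_iff_disj)
  then show "cmod (clip M z) \<le> cmod z"
    using mult_right_mono[OF f(2), of "cmod z"] by (simp only: clip_def norm_scaleR abs_of_nonneg[OF f(1)]) simp
  have "z - clip M z = (1 - M / max M (cmod z)) *\<^sub>R z" by (simp add: clip_def algebra_simps)
  then show "cmod (z - clip M z) \<le> cmod z"
    using f mult_right_mono[of "1 - M / max M (cmod z)" 1 "cmod z"] by simp
  show "clip M z = z" if "cmod z \<le> M"
    using that assms by (simp add: clip_def max_absorb1)
  have "max M (cmod z) \<noteq> 0" for z using assms by (metis less_max_iff_disj less_numeral_extra(3))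
  then show "continuous_on UNIV (clip M)"
    unfolding clip_def [abs_def] by (intro continuous_intros) auto
qed

text \<open>A truncation of \<open>h\<close> is approximated by truncations of continuous functions
  that converge almost everywhere; truncating gives the constant \<open>2 * M\<close> as a
  dominating function on a set of finite measure.\<close>

lemma L2_approx_continuous:
  fixes h :: "real^2 \<Rightarrow> complex"
  assumes h: "square_integrable_on B h" and B: "B \<in> sets borel" "emeasure lborel B < \<infinity>" and \<tau>: "\<tau> > 0"
  obtains g C where "continuous_on UNIV g" "\<And>x. cmod (g x) \<le> C" "(LINT x:B|lborel. (cmod (h x - g x))\<^sup>2) < \<tau>"
proof -
  define H where "H x = indicat_real B x *\<^sub>R h x" for x
  have Hm: "H \<in> borel_measurable borel"
    using h by (simp add: square_integrable_on_def set_borel_measurable_def H_def [abs_def])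
  have H2: "integrable lborel (\<lambda>x. (cmod (H x))\<^sup>2)"
  proof -
    have "(\<lambda>x. (cmod (H x))\<^sup>2) = (\<lambda>x. indicat_real B x *\<^sub>R (cmod (h x))\<^sup>2)" by (auto simp: H_def indicator_def)
    then show ?thesis using h by (simp add: square_integrable_on_def set_integrable_def)
  qed
  have "(\<lambda>n. LINT x|lborel. (cmod (H x - clip (real (Suc n)) (H x)))\<^sup>2) \<longlonglongrightarrow> (LINT x|(lborel :: (real^2) measure). 0)"
  proof (rule integral_dominated_convergence[where w="\<lambda>x. (cmod (H x))\<^sup>2"])
    have "clip (real (Suc n)) \<in> borel_measurable borel" for n
      using clip_props(5)[of "real (Suc n)"] by (intro borel_measurable_continuous_onI) simp
    then show "(\<lambda>x. (cmod (H x - clip (real (Suc n)) (H x)))\<^sup>2) \<in> borel_measurable lborel" for n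
      using Hm by measurable
    show "AE x in lborel. (\<lambda>n. (cmod (H x - clip (real (Suc n)) (H x)))\<^sup>2) \<longlonglongrightarrow> 0"
    proof (rule AE_I2)
      fix x
      obtain N where N: "cmod (H x) \<le> real N" using real_arch_simple by blast
      have "\<forall>\<^sub>F n in sequentially. 0 = (cmod (H x - clip (real (Suc n)) (H x)))\<^sup>2"
        using eventually_ge_at_top[of N]
      proof eventually_elim
        case (elim n)
        then have "cmod (H x) \<le> real (Suc n)" using N by linarith
        then show ?case using clip_props(3)[of "real (Suc n)"] by simp
      qed
      then show "(\<lambda>n. (cmod (H x - clip (real (Suc n)) (H x)))\<^sup>2) \<longlonglongrightarrow> 0"
        by (rule Lim_transform_eventually[OF tendsto_const])
    qed
    show "AE x in lborel. norm ((cmod (H x - clip (real (Suc n)) (H x)))\<^sup>2) \<le> (cmod (H x))\<^sup>2" for n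
      using clip_props(4)[of "real (Suc n)"] by (intro AE_I2) (simp add: power_mono)
  qed (use H2 in auto)
  then have "(\<lambda>n. LINT x|lborel. (cmod (H x - clip (real (Suc n)) (H x)))\<^sup>2) \<longlonglongrightarrow> 0" by simp
  \<comment> \<open>Two errors below \<tau> / 4 suffice, because |a + b|^2 <= 2 |a|^2 + 2
    |b|^2.\<close>
  from order_tendstoD(2)[OF this, of "\<tau> / 4"] \<tau> obtain n where
    n: "(LINT x|lborel. (cmod (H x - clip (real (Suc n)) (H x)))\<^sup>2) < \<tau> / 4"
    by (auto simp: eventually_sequentially)
  define M where "M = real (Suc n)"
  have M: "M > 0" by (simp add: M_def)
  note cl = clip_props[OF M]
  have clm: "clip M \<in> borel_measurable borel" using cl(5) by (rule borel_measurable_continuous_onI)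
  have "H \<in> borel_measurable lborel" using Hm by simp
  then have "H \<in> borel_measurable lebesgue" by (rule measurable_completion)
  \<comment> \<open>Lebesgue measurability yields continuous functions that converge to
    \<open>H\<close> off a negligible set.\<close>
  then have "H measurable_on UNIV" by (rule lebesgue_measurable_imp_measurable_on) simp
  then obtain N G where N: "negligible N" and G: "\<And>j. continuous_on UNIV (G j)" "\<And>x. x \<notin> N \<Longrightarrow> (\<lambda>j. G j x) \<longlonglongrightarrow> H x"
    unfolding measurable_on_def by auto
  have Gc: "continuous_on UNIV (\<lambda>x. clip M (G j x))" for j
    by (rule continuous_on_compose2[OF cl(5) G(1)]) auto
  have AEN: "AE x in lborel. x \<notin> N" by (rule AE_not_negligible[OF N])
  have "(\<lambda>j. LINT x|lborel. indicat_real B x * (cmod (clip M (H x) - clip M (G j x)))\<^sup>2) \<longlonglongrightarrow> (LINT x|(lborel :: (real^2) measure). 0)"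
  proof (rule integral_dominated_convergence[where w="\<lambda>x. indicat_real B x * (2 * M)\<^sup>2"])
    show "(\<lambda>x. indicat_real B x * (cmod (clip M (H x) - clip M (G j x)))\<^sup>2) \<in> borel_measurable lborel" for j
      using Hm clm borel_measurable_continuous_onI[OF Gc, of j] B(1) by measurable
    show "integrable lborel (\<lambda>x. indicat_real B x * (2 * M)\<^sup>2)"
      using B by (intro integrable_mult_left) auto
    show "AE x in lborel. (\<lambda>j. indicat_real B x * (cmod (clip M (H x) - clip M (G j x)))\<^sup>2) \<longlonglongrightarrow> 0"
      using AEN
    proof eventually_elim
      case (elim x)
      have "isCont (clip M) (H x)" using cl(5) by (simp add: continuous_on_eq_continuous_at)
      from isCont_tendsto_compose[OF this G(2)[OF elim]]
      have "(\<lambda>j. indicat_real B x * (cmod (clip M (H x) - clip M (G j x)))\<^sup>2) \<longlonglongrightarrow> indicat_real B x * (cmod (clip M (H x) - clip M (H x)))\<^sup>2"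
        by (intro tendsto_intros)
      then show ?case by simp
    qed
    show "AE x in lborel. norm (indicat_real B x * (cmod (clip M (H x) - clip M (G j x)))\<^sup>2) \<le> indicat_real B x * (2 * M)\<^sup>2" for j
    proof (rule AE_I2)
      fix x
      have "cmod (clip M (H x) - clip M (G j x)) \<le> 2 * M"
        using norm_triangle_ineq4[of "clip M (H x)" "clip M (G j x)"] cl(1)[of "H x"] cl(1)[of "G j x"] by linarith
      then have "(cmod (clip M (H x) - clip M (G j x)))\<^sup>2 \<le> (2 * M)\<^sup>2" by (rule power_mono) simp
      then show "norm (indicat_real B x * (cmod (clip M (H x) - clip M (G j x)))\<^sup>2) \<le> indicat_real B x * (2 * M)\<^sup>2"
        by (auto simp: indicator_def)
    qed
  qed auto
  then have "(\<lambda>j. LINT x|lborel. indicat_real B x * (cmod (clip M (H x) - clip M (G j x)))\<^sup>2) \<longlonglongrightarrow> 0" by simp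
  from order_tendstoD(2)[OF this, of "\<tau> / 4"] \<tau> obtain j where
    j: "(LINT x|lborel. indicat_real B x * (cmod (clip M (H x) - clip M (G j x)))\<^sup>2) < \<tau> / 4"
    by (auto simp: eventually_sequentially)
  define g where "g x = clip M (G j x)" for x
  have gm: "g \<in> borel_measurable borel" using borel_measurable_continuous_onI[OF Gc[of j]] by (simp add: g_def [abs_def])
  have i1: "integrable lborel (\<lambda>x. (cmod (H x - clip M (H x)))\<^sup>2)"
  proof (rule Bochner_Integration.integrable_bound[OF H2])
    show "(\<lambda>x. (cmod (H x - clip M (H x)))\<^sup>2) \<in> borel_measurable lborel" using Hm clm by measurable
    show "AE x in lborel. norm ((cmod (H x - clip M (H x)))\<^sup>2) \<le> norm ((cmod (H x))\<^sup>2)"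
      using cl(4) by (intro AE_I2) (simp add: power_mono)
  qed
  have i2: "integrable lborel (\<lambda>x. indicat_real B x * (cmod (clip M (H x) - g x))\<^sup>2)"
  proof (rule Bochner_Integration.integrable_bound)
    show "integrable lborel (\<lambda>x. indicat_real B x * (2 * M)\<^sup>2)"
      using B by (intro integrable_mult_left) auto
    show "(\<lambda>x. indicat_real B x * (cmod (clip M (H x) - g x))\<^sup>2) \<in> borel_measurable lborel"
      using Hm clm gm B(1) by measurable
    show "AE x in lborel. norm (indicat_real B x * (cmod (clip M (H x) - g x))\<^sup>2) \<le> norm (indicat_real B x * (2 * M)\<^sup>2)"
    proof (rule AE_I2)
      fix x
      have "cmod (clip M (H x) - g x) \<le> 2 * M"
        using norm_triangle_ineq4[of "clip M (H x)" "g x"] cl(1)[of "H x"] cl(1)[of "G j x"] unfolding g_def by linarith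
      then have "(cmod (clip M (H x) - g x))\<^sup>2 \<le> (2 * M)\<^sup>2" by (rule power_mono) simp
      then show "norm (indicat_real B x * (cmod (clip M (H x) - g x))\<^sup>2) \<le> norm (indicat_real B x * (2 * M)\<^sup>2)"
        by (auto simp: indicator_def)
    qed
  qed
  have "(LINT x:B|lborel. (cmod (h x - g x))\<^sup>2) \<le> (LINT x|lborel. 2 * (cmod (H x - clip M (H x)))\<^sup>2 + 2 * (indicat_real B x * (cmod (clip M (H x) - g x))\<^sup>2))"
    unfolding set_lebesgue_integral_def
  proof (rule integral_mono_AE')
    show "integrable lborel (\<lambda>x. 2 * (cmod (H x - clip M (H x)))\<^sup>2 + 2 * (indicat_real B x * (cmod (clip M (H x) - g x))\<^sup>2))"
      using i1 i2 by auto
    have "indicat_real B x *\<^sub>R (cmod (h x - g x))\<^sup>2 \<le> 2 * (cmod (H x - clip M (H x)))\<^sup>2 + 2 * (indicat_real B x * (cmod (clip M (H x) - g x))\<^sup>2)" for x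
      using cmod_add_sq[of "h x - clip M (h x)" "clip M (h x) - g x"] by (auto simp: indicator_def H_def)
    then show "AE x in lborel. indicat_real B x *\<^sub>R (cmod (h x - g x))\<^sup>2 \<le> 2 * (cmod (H x - clip M (H x)))\<^sup>2 + 2 * (indicat_real B x * (cmod (clip M (H x) - g x))\<^sup>2)"
      by simp
  qed auto
  also have "\<dots> = 2 * (LINT x|lborel. (cmod (H x - clip M (H x)))\<^sup>2) + 2 * (LINT x|lborel. indicat_real B x * (cmod (clip M (H x) - g x))\<^sup>2)"
    using i1 i2 by simp
  also have "\<dots> < \<tau>" using n j \<tau> by (simp add: M_def g_def)
  finally show ?thesis using that[of g M] Gc cl(1) by (simp add: g_def [abs_def])
qed

lemma integral_affine_vec2:
  fixes f :: "real^2 \<Rightarrow> real"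
  assumes "f \<in> borel_measurable borel" "c \<noteq> 0"
  shows "(LINT x|lborel. f (a + c *\<^sub>R x)) = (LINT x|lborel. f x) / c\<^sup>2"
proof -
  have "(LINT x|lborel. f x) = (LINT x|density (distr lborel borel (\<lambda>x. a + c *\<^sub>R x)) (\<lambda>_. ennreal (\<bar>c\<bar>^2)). f x)"
    using lborel_affine[OF assms(2), of a] by (simp add: ennreal_power)
  also have "\<dots> = \<bar>c\<bar>^2 * (LINT x|lborel. f (a + c *\<^sub>R x))"
    using assms by (subst integral_density) (auto simp: integral_distr)
  finally show ?thesis using assms(2) by simp
qed

text \<open>A box bump divided by its integral, which is positive because the bump is continuous and
  positive at 0.\<close>

lemma mollifier_exists:
  assumes "\<epsilon> > 0"
  shows "\<exists>e :: real^2 \<Rightarrow> real. (\<lambda>x. complex_of_real (e x)) \<in> test_functions UNIV \<and> (\<forall>x. 0 \<le> e x) \<and>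
     (\<forall>x. \<epsilon> < norm x \<longrightarrow> e x = 0) \<and> (LINT x|lborel. e x) = 1"
proof -
  let ?a = "\<chi> i. - (\<epsilon> / 2) :: real^2" and ?b = "\<chi> i. \<epsilon> / 2 :: real^2"
  define p where "p = box_bump ?a ?b 1"
  have pt: "(\<lambda>x. complex_of_real (p x)) \<in> test_functions UNIV"
    unfolding p_def by (rule box_bump_test) auto
  have pn: "p x \<ge> 0" for x unfolding p_def by (rule box_bump_nonneg)
  have p0: "p x = 0" if "\<epsilon> < norm x" for x
  proof -
    have "norm x \<le> (\<Sum>i\<in>UNIV. \<bar>x $ i\<bar>)" by (rule norm_le_l1_cart)
    \<comment> \<open>One coordinate then exceeds \<epsilon> / 2, the half width of the box, in
      absolute value.\<close>
    with that have "\<epsilon> < \<bar>x $ 1\<bar> + \<bar>x $ 2\<bar>" by (simp add: sum_2)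
    then have "x \<notin> box ?a ?b" by (auto simp: mem_box_cart forall_2)
    then show ?thesis unfolding p_def by (intro box_bump_eq_0) auto
  qed
  have pi: "integrable lborel p"
    using test_functions_integrable[OF pt] integrable_Re by fastforce
  have J: "(LINT x|lborel. p x) > 0"
  proof -
    have "(LINT x|lborel. p x) \<noteq> 0"
    proof
      assume "(LINT x|lborel. p x) = 0"
      then have "AE x in lborel. p x = 0" using pn pi by (subst (asm) integral_nonneg_eq_0_iff_AE) auto
      then have "complex_of_real (p 0) = 0"
        by (intro AE_eq_imp_eq_continuous[of UNIV "\<lambda>x. complex_of_real (p x)" "\<lambda>x. 0"] 
            smooth_on_continuous_on test_functions_smooth[OF pt]) (auto elim: eventually_mono)
      moreover have "p 0 > 0"
        unfolding p_def using assms by (intro box_bump_pos) (auto simp: mem_box_cart)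
      ultimately show False by simp
    qed
    moreover have "(LINT x|lborel. p x) \<ge> 0" using pn by simp
    ultimately show ?thesis by linarith
  qed
  let ?e = "\<lambda>x. p x / (LINT x|lborel. p x)"
  have "(\<lambda>x. complex_of_real (?e x)) \<in> test_functions UNIV"
    using test_functions_linear_compose[OF bounded_linear_mult_left[of "complex_of_real (1 / (LINT x|lborel. p x))"] pt]
    by simp
  with pn p0 J show ?thesis by (intro exI[of _ ?e]) auto
qed

text \<open>The factor \<open>c < 1\<close> in the kernel \<open>e (x - c *\<^sub>R y)\<close> shrinks the ball before mollifying, so that the
  result is supported inside the original ball.\<close>

locale mollifier_kernel =
  fixes e :: "real^2 \<Rightarrow> real" and \<epsilon> c R :: real
  assumes e_test: "(\<lambda>x. complex_of_real (e x)) \<in> test_functions UNIV"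
    and e_nonneg: "\<And>x. 0 \<le> e x" and e_supp: "\<And>x. \<epsilon> < norm x \<Longrightarrow> e x = 0" and e_int: "(LINT x|lborel. e x) = 1"
    and c: "1 / 2 \<le> c" "c \<le> 1" and R: "R > 0"
begin

lemma e_cont: "continuous_on UNIV e"
proof -
  have "continuous_on UNIV (\<lambda>x. Re (complex_of_real (e x)))"
    by (intro continuous_intros smooth_on_continuous_on test_functions_smooth[OF e_test])
  then show ?thesis by simp
qed

lemma e_meas: "e \<in> borel_measurable borel"
  by (rule borel_measurable_continuous_onI[OF e_cont])

lemma e_bound: obtains C where "C > 0" "\<And>x. e x \<le> C"
  using test_functions_bounded[OF e_test] e_nonneg by auto

lemma e_meas_y: "(\<lambda>y. e (x - c *\<^sub>R y)) \<in> borel_measurable borel"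
  by (intro borel_measurable_continuous_onI continuous_on_compose2[OF e_cont] continuous_intros) auto

lemma int_x: "(LINT x|lborel. e (x - c *\<^sub>R y)) = 1"
  using integral_affine_vec2[OF e_meas, of 1 "- (c *\<^sub>R y)"] e_int by simp

lemma int_y: "(LINT y|lborel. e (x - c *\<^sub>R y)) = 1 / c\<^sup>2"
  using integral_affine_vec2[OF e_meas, of "- c" x] e_int c by simp

lemma integrable_x: "integrable lborel (\<lambda>x. e (x - c *\<^sub>R y))"
  using int_x[of y] not_integrable_integral_eq by fastforce

lemma integrable_y: "integrable lborel (\<lambda>y. e (x - c *\<^sub>R y))"
  using int_y[of x] c not_integrable_integral_eq by fastforce

text \<open>The locale demands c >= 1 / 2 for the sake of bounds like this one, which are uniform
  along a sequence of kernels.\<close>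

lemma c_sq: "1 / c\<^sup>2 \<le> 4"
proof -
  have "(1 / 2)\<^sup>2 \<le> c\<^sup>2" using c by (intro power_mono) auto
  then show ?thesis using c by (simp add: power_divide field_simps)
qed

lemma integrable_kernel:
  assumes "integrable lborel (q :: real^2 \<Rightarrow> real)"
  shows "integrable lborel (\<lambda>y. e (x - c *\<^sub>R y) * q y)"
proof -
  obtain C where C: "C > 0" "\<And>x. e x \<le> C" using e_bound by blast
  show ?thesis
  proof (rule Bochner_Integration.integrable_bound)
    show "integrable lborel (\<lambda>y. C * \<bar>q y\<bar>)" using assms by auto
    show "(\<lambda>y. e (x - c *\<^sub>R y) * q y) \<in> borel_measurable lborel"
      using assms e_meas_y by auto
    show "AE y in lborel. norm (e (x - c *\<^sub>R y) * q y) \<le> norm (C * \<bar>q y\<bar>)"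
      using C e_nonneg by (intro AE_I2) (auto simp: abs_mult intro!: mult_right_mono)
  qed
qed

text \<open>Fubini, as the kernel has integral 1 in \<open>x\<close> for every
  \<open>y\<close>.\<close>

lemma kernel_L1:
  assumes q: "integrable lborel q" "\<And>y. 0 \<le> q y"
  shows "integrable lborel (\<lambda>x. LINT y|lborel. e (x - c *\<^sub>R y) * q y)"
    and "(LINT x|lborel. LINT y|lborel. e (x - c *\<^sub>R y) * q y) = (LINT y|lborel. q y)"
proof -
  let ?f = "\<lambda>y x. e (x - c *\<^sub>R y) * q y"
  have m: "case_prod ?f \<in> borel_measurable (lborel \<Otimes>\<^sub>M lborel)"
  proof -
    have "(\<lambda>p. e (snd p - c *\<^sub>R fst p)) \<in> borel_measurable (borel :: ((real^2) \<times> (real^2)) measure)"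
      by (intro borel_measurable_continuous_onI continuous_on_compose2[OF e_cont] continuous_intros) auto
    then have "(\<lambda>p. e (snd p - c *\<^sub>R fst p)) \<in> borel_measurable (lborel \<Otimes>\<^sub>M lborel)"
      by (simp add: lborel_prod)
    moreover have "(\<lambda>p. q (fst p)) \<in> borel_measurable (lborel \<Otimes>\<^sub>M lborel)"
      using q(1) by (intro measurable_compose[OF measurable_fst]) auto
    ultimately show ?thesis unfolding case_prod_beta' by (rule borel_measurable_times)
  qed
  have inner: "(LINT x|lborel. norm (?f y x)) = q y" for y
    using q(2)[of y] e_nonneg int_x[of y] by simp
  have i: "integrable (lborel \<Otimes>\<^sub>M lborel) (case_prod ?f)"
  proof (rule lborel_pair.Fubini_integrable[OF m])
    show "integrable lborel (\<lambda>y. LINT x|lborel. norm (case_prod ?f (y, x)))"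
      using inner q(1) by simp
    show "AE y in lborel. integrable lborel (\<lambda>x. case_prod ?f (y, x))"
      using integrable_x by simp
  qed
  show "integrable lborel (\<lambda>x. LINT y|lborel. e (x - c *\<^sub>R y) * q y)"
    using lborel_pair.integrable_snd[OF i] .
  have "(LINT x|lborel. LINT y|lborel. ?f y x) = (LINT y|lborel. LINT x|lborel. ?f y x)"
    using lborel_pair.Fubini_integral[OF i] .
  also have "\<dots> = (LINT y|lborel. q y)"
    using int_x by simp
  finally show "(LINT x|lborel. LINT y|lborel. e (x - c *\<^sub>R y) * q y) = (LINT y|lborel. q y)" .
qed

abbreviation B where "B \<equiv> ball (0::real^2) R"

lemma B_props: "B \<in> sets borel" "emeasure lborel B < \<infinity>"
  using emeasure_bounded_finite[OF bounded_ball] by auto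

text \<open>Only the values of \<open>h\<close> in the ball enter. Without a normalising factor c^2
  the kernel has mass 1 / c^2 in \<open>y\<close>, which tends to 1 with \<open>c\<close>.\<close>

definition K :: "(real^2 \<Rightarrow> complex) \<Rightarrow> real^2 \<Rightarrow> complex" where
  "K h x = (LINT y|lborel. of_real (e (x - c *\<^sub>R y)) * (indicat_real B y *\<^sub>R h y))"

lemma H_integrable: "square_integrable_on B h \<Longrightarrow> integrable lborel (\<lambda>y. indicat_real B y *\<^sub>R h y)"
  using square_integrable_imp_integrable[OF _ B_props] by (simp add: set_integrable_def)

lemma K_integrable:
  "square_integrable_on B h \<Longrightarrow> integrable lborel (\<lambda>y. of_real (e (x - c *\<^sub>R y)) * (indicat_real B y *\<^sub>R h y))"
  using mollify_integrable[OF e_test H_integrable] .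

lemma K_meas: "square_integrable_on B h \<Longrightarrow> K h \<in> borel_measurable borel"
  unfolding K_def [abs_def]
  by (rule smooth_on_UNIV_borel_measurable[OF mollify_smooth[OF e_test H_integrable]])

lemma K_diff:
  assumes "square_integrable_on B h" "square_integrable_on B g"
  shows "K (\<lambda>y. h y - g y) x = K h x - K g x"
  unfolding K_def using K_integrable[OF assms(1)] K_integrable[OF assms(2)]
  by (simp add: scaleR_diff_right right_diff_distrib)

text \<open>The inequality |T| |h| <= (\<alpha> / 2) |T|^2 + |h|^2 / (2 \<alpha>) is integrated
  against the kernel, whose mass is 1 / c^2 <= 4 in \<open>y\<close> and 1 in \<open>x\<close>. The
  bound is thus the same for all kernels, and \<alpha> remains free.\<close>

lemma K_bound:
  assumes T: "square_integrable_on B T" and h: "square_integrable_on B h" and \<alpha>: "\<alpha> > 0"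
  shows "set_integrable lborel B (\<lambda>x. T x * K h x)"
    and "cmod (LINT x:B|lborel. T x * K h x) \<le> 2 * \<alpha> * (LINT x:B|lborel. (cmod (T x))\<^sup>2) + (LINT x:B|lborel. (cmod (h x))\<^sup>2) / (2 * \<alpha>)"
proof -
  define q where "q y = indicat_real B y * (cmod (h y))\<^sup>2" for y
  have q: "integrable lborel q" "\<And>y. 0 \<le> q y"
    using h by (auto simp: square_integrable_on_def set_integrable_def q_def [abs_def])
  define t where "t x = indicat_real B x * (cmod (T x))\<^sup>2" for x
  have t: "integrable lborel t"
    using T by (simp add: square_integrable_on_def set_integrable_def t_def [abs_def])
  define Q where "Q x = (LINT y|lborel. e (x - c *\<^sub>R y) * q y)" for x
  have Q: "integrable lborel Q" "(LINT x|lborel. Q x) = (LINT y|lborel. q y)"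
    using kernel_L1[OF q] by (simp_all add: Q_def [abs_def])
  have pt: "cmod (indicat_real B x *\<^sub>R (T x * K h x)) \<le> 2 * \<alpha> * t x + Q x / (2 * \<alpha>)" for x
  proof (cases "x \<in> B")
    case True
    have "cmod (T x * K h x) = cmod (LINT y|lborel. T x * (of_real (e (x - c *\<^sub>R y)) * (indicat_real B y *\<^sub>R h y)))"
      by (simp only: K_def integral_mult_right_zero)
    also have "\<dots> \<le> (LINT y|lborel. cmod (T x * (of_real (e (x - c *\<^sub>R y)) * (indicat_real B y *\<^sub>R h y))))"
      by (rule integral_norm_bound)
    also have "\<dots> \<le> (LINT y|lborel. (\<alpha> / 2 * (cmod (T x))\<^sup>2) * e (x - c *\<^sub>R y) + (e (x - c *\<^sub>R y) * q y) / (2 * \<alpha>))"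
    proof (rule integral_mono)
      show "integrable lborel (\<lambda>y. cmod (T x * (of_real (e (x - c *\<^sub>R y)) * (indicat_real B y *\<^sub>R h y))))"
        by (intro integrable_norm integrable_mult_right K_integrable h)
      show "integrable lborel (\<lambda>y. (\<alpha> / 2 * (cmod (T x))\<^sup>2) * e (x - c *\<^sub>R y) + (e (x - c *\<^sub>R y) * q y) / (2 * \<alpha>))"
        using integrable_y integrable_kernel[OF q(1)] by auto
      fix y
      have "cmod (T x) * (indicat_real B y * cmod (h y)) \<le> \<alpha> / 2 * (cmod (T x))\<^sup>2 + q y / (2 * \<alpha>)"
      proof (cases "y \<in> B")
        case True
        have "2 * \<alpha> * (cmod (T x) * cmod (h y)) \<le> \<alpha>\<^sup>2 * (cmod (T x))\<^sup>2 + (cmod (h y))\<^sup>2"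
          using zero_le_power2[of "\<alpha> * cmod (T x) - cmod (h y)"] by (simp add: power2_diff power_mult_distrib mult_ac)
        then show ?thesis using True \<alpha> by (simp add: q_def field_simps power2_eq_square)
      next
        case False
        then show ?thesis using \<alpha> by (simp add: q_def)
      qed
      from mult_left_mono[OF this e_nonneg[of "x - c *\<^sub>R y"]]
      show "cmod (T x * (of_real (e (x - c *\<^sub>R y)) * (indicat_real B y *\<^sub>R h y))) \<le>
          (\<alpha> / 2 * (cmod (T x))\<^sup>2) * e (x - c *\<^sub>R y) + (e (x - c *\<^sub>R y) * q y) / (2 * \<alpha>)"
        using e_nonneg by (simp add: norm_mult algebra_simps)
    qed
    also have "\<dots> = \<alpha> / 2 * (cmod (T x))\<^sup>2 * (1 / c\<^sup>2) + Q x / (2 * \<alpha>)"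
      using integrable_y integrable_kernel[OF q(1)] by (simp add: int_y Q_def)
    also have "\<dots> \<le> \<alpha> / 2 * (cmod (T x))\<^sup>2 * 4 + Q x / (2 * \<alpha>)"
      using c_sq \<alpha> by (intro add_right_mono mult_left_mono) auto
    finally show ?thesis using True by (simp add: t_def)
  next
    case False
    have "Q x \<ge> 0" using e_nonneg q(2) by (simp add: Q_def)
    with False \<alpha> show ?thesis by (simp add: t_def)
  qed
  have bi: "integrable lborel (\<lambda>x. 2 * \<alpha> * t x + Q x / (2 * \<alpha>))" using t Q(1) by auto
  show si: "set_integrable lborel B (\<lambda>x. T x * K h x)"
    unfolding set_integrable_def
  proof (rule Bochner_Integration.integrable_bound[OF bi])
    have "(\<lambda>x. (indicat_real B x *\<^sub>R T x) * K h x) \<in> borel_measurable lborel"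
      using T K_meas[OF h] by (intro borel_measurable_times) (auto simp: square_integrable_on_def set_borel_measurable_def)
    then show "(\<lambda>x. indicat_real B x *\<^sub>R (T x * K h x)) \<in> borel_measurable lborel" by simp
    show "AE x in lborel. norm (indicat_real B x *\<^sub>R (T x * K h x)) \<le> norm (2 * \<alpha> * t x + Q x / (2 * \<alpha>))"
      using pt order_trans[OF _ abs_ge_self] by (intro AE_I2) auto
  qed
  have "cmod (LINT x:B|lborel. T x * K h x) \<le> (LINT x|lborel. cmod (indicat_real B x *\<^sub>R (T x * K h x)))"
    unfolding set_lebesgue_integral_def by (rule integral_norm_bound)
  also have "\<dots> \<le> (LINT x|lborel. 2 * \<alpha> * t x + Q x / (2 * \<alpha>))"
    using si bi pt by (intro integral_mono integrable_norm) (auto simp: set_integrable_def)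
  also have "\<dots> = 2 * \<alpha> * (LINT x|lborel. t x) + (LINT y|lborel. q y) / (2 * \<alpha>)"
    using t Q by simp
  finally show "cmod (LINT x:B|lborel. T x * K h x) \<le> 2 * \<alpha> * (LINT x:B|lborel. (cmod (T x))\<^sup>2) + (LINT x:B|lborel. (cmod (h x))\<^sup>2) / (2 * \<alpha>)"
    by (simp add: set_lebesgue_integral_def t_def q_def)
qed

text \<open>Since c (y - x) = - (x - c y) + (1 - c) x, dividing by c costs at most a factor
  2.\<close>

lemma supp_dist:
  assumes "norm x < R" "e (x - c *\<^sub>R y) \<noteq> 0"
  shows "dist y x \<le> 2 * (\<epsilon> + (1 - c) * R)"
proof -
  have "norm (x - c *\<^sub>R y) \<le> \<epsilon>" using e_supp assms(2) not_le by blast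
  moreover have "c * norm (y - x) \<le> norm (x - c *\<^sub>R y) + (1 - c) * norm x"
  proof -
    have "c *\<^sub>R (y - x) = - (x - c *\<^sub>R y) + (1 - c) *\<^sub>R x" by (simp add: algebra_simps)
    then have "norm (c *\<^sub>R (y - x)) \<le> norm (x - c *\<^sub>R y) + norm ((1 - c) *\<^sub>R x)"
      using norm_triangle_ineq[of "- (x - c *\<^sub>R y)" "(1 - c) *\<^sub>R x"] by (simp only: norm_minus_cancel)
    then show ?thesis using c by simp
  qed
  moreover have "(1 - c) * norm x \<le> (1 - c) * R" using c assms(1) by (intro mult_left_mono) auto
  moreover have "1 / 2 * norm (y - x) \<le> c * norm (y - x)" using c by (intro mult_right_mono) auto
  ultimately have "1 / 2 * norm (y - x) \<le> \<epsilon> + (1 - c) * R" by linarith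
  then show ?thesis by (simp add: dist_norm)
qed

text \<open>The factor 1 / c^2 is the mass of the kernel in \<open>y\<close>. The condition on
  \<delta> keeps every contributing \<open>y\<close> in the ball, so the truncation in
  \<open>K\<close> is not felt.\<close>

lemma K_close:
  assumes g: "square_integrable_on B g" and x: "norm x < R" and d: "2 * (\<epsilon> + (1 - c) * R) < \<delta>" "\<delta> \<le> R - norm x"
    and close: "\<And>y. dist y x < \<delta> \<Longrightarrow> cmod (g y - g x) \<le> \<tau>"
  shows "cmod (K g x - of_real (1 / c\<^sup>2) * g x) \<le> 4 * \<tau>"
proof -
  have i: "integrable lborel (\<lambda>y. of_real (e (x - c *\<^sub>R y)) * g x)"
    using integrable_y[of x] by (intro integrable_mult_left integrable_of_real)
  have "K g x - of_real (1 / c\<^sup>2) * g x = K g x - (LINT y|lborel. of_real (e (x - c *\<^sub>R y)) * g x)"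
    using int_y[of x] by simp
  also have "\<dots> = (LINT y|lborel. of_real (e (x - c *\<^sub>R y)) * (indicat_real B y *\<^sub>R g y) - of_real (e (x - c *\<^sub>R y)) * g x)"
    unfolding K_def using K_integrable[OF g] i by simp
  also have "cmod \<dots> \<le> (LINT y|lborel. cmod (of_real (e (x - c *\<^sub>R y)) * (indicat_real B y *\<^sub>R g y) - of_real (e (x - c *\<^sub>R y)) * g x))"
    by (rule integral_norm_bound)
  also have "\<dots> \<le> (LINT y|lborel. e (x - c *\<^sub>R y) * \<tau>)"
  proof (rule integral_mono)
    show "integrable lborel (\<lambda>y. cmod (of_real (e (x - c *\<^sub>R y)) * (indicat_real B y *\<^sub>R g y) - of_real (e (x - c *\<^sub>R y)) * g x))"
      by (intro integrable_norm Bochner_Integration.integrable_diff K_integrable g i)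
    show "integrable lborel (\<lambda>y. e (x - c *\<^sub>R y) * \<tau>)" using integrable_y by simp
    fix y
    show "cmod (of_real (e (x - c *\<^sub>R y)) * (indicat_real B y *\<^sub>R g y) - of_real (e (x - c *\<^sub>R y)) * g x) \<le> e (x - c *\<^sub>R y) * \<tau>"
    proof (cases "e (x - c *\<^sub>R y) = 0")
      case False
      from supp_dist[OF x this] d have y: "dist y x < \<delta>" by linarith
      have "norm y \<le> norm x + dist y x" by (metis dist_norm norm_triangle_sub)
      then have "y \<in> B" using y d by simp
      then have "cmod (of_real (e (x - c *\<^sub>R y)) * (indicat_real B y *\<^sub>R g y) - of_real (e (x - c *\<^sub>R y)) * g x) = e (x - c *\<^sub>R y) * cmod (g y - g x)"
        using e_nonneg by (simp add: norm_mult flip: right_diff_distrib)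
      then show ?thesis using close[OF y] e_nonneg by (simp add: mult_left_mono)
    qed simp
  qed
  also have "\<dots> = 1 / c\<^sup>2 * \<tau>" using int_y[of x] by simp
  also have "\<dots> \<le> 4 * \<tau>"
  proof (rule mult_right_mono[OF c_sq])
    have "cmod (g x - g x) \<le> \<tau>" 
    proof (rule close)
      \<comment> \<open>This gives \<delta> > 0, so that \<open>close\<close> applies at
        \<open>x\<close> itself; a negative \<epsilon> would make \<open>e\<close> vanish, against
        its integral 1.\<close>
      have "0 \<le> \<epsilon>"
      proof (rule ccontr)
        assume "\<not> 0 \<le> \<epsilon>"
        then have "e y = 0" for y using e_supp[of y] norm_ge_zero[of y] by linarith
        then show False using e_int by simp
      qed
      then show "dist x x < \<delta>" using d c R by (smt (verit) dist_self mult_nonneg_nonneg)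
    qed
    then show "0 \<le> \<tau>" by simp
  qed
  finally show ?thesis .
qed

lemma K_sup_bound:
  assumes "square_integrable_on B g" "\<And>y. cmod (g y) \<le> C"
  shows "cmod (K g x) \<le> 4 * C"
proof -
  have C: "C \<ge> 0" using assms(2)[of 0] norm_ge_zero order_trans by blast
  have "cmod (K g x) \<le> (LINT y|lborel. cmod (of_real (e (x - c *\<^sub>R y)) * (indicat_real B y *\<^sub>R g y)))"
    unfolding K_def by (rule integral_norm_bound)
  also have "\<dots> \<le> (LINT y|lborel. e (x - c *\<^sub>R y) * C)"
  proof (rule integral_mono)
    show "integrable lborel (\<lambda>y. cmod (of_real (e (x - c *\<^sub>R y)) * (indicat_real B y *\<^sub>R g y)))"
      by (intro integrable_norm K_integrable assms)
    show "integrable lborel (\<lambda>y. e (x - c *\<^sub>R y) * C)" using integrable_y by simp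
    show "cmod (of_real (e (x - c *\<^sub>R y)) * (indicat_real B y *\<^sub>R g y)) \<le> e (x - c *\<^sub>R y) * C" for y
      using assms(2)[of y] e_nonneg C by (auto simp: norm_mult indicator_def intro!: mult_left_mono)
  qed
  also have "\<dots> = 1 / c\<^sup>2 * C" using int_y[of x] by simp
  also have "\<dots> \<le> 4 * C" by (rule mult_right_mono[OF c_sq C])
  finally show ?thesis .
qed

end

section \<open>Very weak solutions and the uniqueness theorem\<close>

text \<open>The counterpart of \<open>K_bound\<close> without a kernel, in the same weighted form so
  that one \<alpha> serves both.\<close>

lemma product_bound:
  assumes T: "square_integrable_on B T" and h: "square_integrable_on B h" and \<alpha>: "\<alpha> > 0"
  shows "set_integrable lborel B (\<lambda>x. T x * h x)"
    and "cmod (LINT x:B|lborel. T x * h x) \<le> \<alpha> * (LINT x:B|lborel. (cmod (T x))\<^sup>2) + (LINT x:B|lborel. (cmod (h x))\<^sup>2) / \<alpha>"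
proof -
  have t: "integrable lborel (\<lambda>x. indicat_real B x *\<^sub>R (cmod (T x))\<^sup>2)" and q: "integrable lborel (\<lambda>x. indicat_real B x *\<^sub>R (cmod (h x))\<^sup>2)"
    using T h by (simp_all add: square_integrable_on_def set_integrable_def)
  have bi: "integrable lborel (\<lambda>x. \<alpha> * (indicat_real B x *\<^sub>R (cmod (T x))\<^sup>2) + (indicat_real B x *\<^sub>R (cmod (h x))\<^sup>2) / \<alpha>)"
    using t q by auto
  have pt: "cmod (indicat_real B x *\<^sub>R (T x * h x)) \<le> \<alpha> * (indicat_real B x *\<^sub>R (cmod (T x))\<^sup>2) + (indicat_real B x *\<^sub>R (cmod (h x))\<^sup>2) / \<alpha>" for x
  proof -
    have "\<alpha> * (cmod (T x) * cmod (h x)) \<le> \<alpha>\<^sup>2 * (cmod (T x))\<^sup>2 + (cmod (h x))\<^sup>2"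
    proof -
      have "0 \<le> (\<alpha> * cmod (T x) - cmod (h x))\<^sup>2" "0 \<le> \<alpha> * (cmod (T x) * cmod (h x))" using \<alpha> by auto
      then show ?thesis by (simp add: power2_diff power_mult_distrib mult_ac)
    qed
    then have "cmod (T x) * cmod (h x) \<le> \<alpha> * (cmod (T x))\<^sup>2 + (cmod (h x))\<^sup>2 / \<alpha>"
      using \<alpha> by (simp add: field_simps power2_eq_square)
    then show ?thesis by (auto simp: indicator_def norm_mult)
  qed
  show si: "set_integrable lborel B (\<lambda>x. T x * h x)"
    unfolding set_integrable_def
  proof (rule Bochner_Integration.integrable_bound[OF bi])
    have "(\<lambda>x. (indicat_real B x *\<^sub>R T x) * (indicat_real B x *\<^sub>R h x)) \<in> borel_measurable lborel"
      using T h by (intro borel_measurable_times) (auto simp: square_integrable_on_def set_borel_measurable_def)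
    moreover have "(\<lambda>x. (indicat_real B x *\<^sub>R T x) * (indicat_real B x *\<^sub>R h x)) = (\<lambda>x. indicat_real B x *\<^sub>R (T x * h x))"
      by (intro ext) (auto simp: indicator_def)
    ultimately show "(\<lambda>x. indicat_real B x *\<^sub>R (T x * h x)) \<in> borel_measurable lborel" by simp
    show "AE x in lborel. norm (indicat_real B x *\<^sub>R (T x * h x)) \<le> norm (\<alpha> * (indicat_real B x *\<^sub>R (cmod (T x))\<^sup>2) + (indicat_real B x *\<^sub>R (cmod (h x))\<^sup>2) / \<alpha>)"
    proof (rule AE_I2)
      fix x
      show "norm (indicat_real B x *\<^sub>R (T x * h x)) \<le> norm (\<alpha> * (indicat_real B x *\<^sub>R (cmod (T x))\<^sup>2) + (indicat_real B x *\<^sub>R (cmod (h x))\<^sup>2) / \<alpha>)"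
        using order_trans[OF pt[of x] abs_ge_self] by (simp only: real_norm_def)
    qed
  qed
  have "cmod (LINT x:B|lborel. T x * h x) \<le> (LINT x|lborel. cmod (indicat_real B x *\<^sub>R (T x * h x)))"
    unfolding set_lebesgue_integral_def by (rule integral_norm_bound)
  also have "\<dots> \<le> (LINT x|lborel. \<alpha> * (indicat_real B x *\<^sub>R (cmod (T x))\<^sup>2) + (indicat_real B x *\<^sub>R (cmod (h x))\<^sup>2) / \<alpha>)"
    by (rule integral_mono[OF integrable_norm[OF si[unfolded set_integrable_def]] bi pt])
  also have "\<dots> = \<alpha> * (LINT x:B|lborel. (cmod (T x))\<^sup>2) + (LINT x:B|lborel. (cmod (h x))\<^sup>2) / \<alpha>"
    using t q by (simp add: set_lebesgue_integral_def)
  finally show "cmod (LINT x:B|lborel. T x * h x) \<le> \<alpha> * (LINT x:B|lborel. (cmod (T x))\<^sup>2) + (LINT x:B|lborel. (cmod (h x))\<^sup>2) / \<alpha>" .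
qed

text \<open>The mollifications of \<open>g\<close> converge pointwise in the ball and are bounded by
  \<open>4 * C\<close>, so dominated convergence applies with the integrable
  \<open>T\<close>.\<close>

lemma mollified_pairing_limit_continuous:
  assumes ker: "\<And>j. mollifier_kernel (e j) (\<epsilon> j) (c j) R" and lim: "\<epsilon> \<longlonglongrightarrow> 0" "c \<longlonglongrightarrow> 1"
    and T: "square_integrable_on (ball 0 R) T" and g: "continuous_on UNIV g" "\<And>x. cmod (g x) \<le> C"
  shows "(\<lambda>j. LINT x:ball 0 R|lborel. T x * mollifier_kernel.K (e j) (c j) R g x) \<longlonglongrightarrow> (LINT x:ball 0 R|lborel. T x * g x)"
proof -
  let ?B = "ball (0::real^2) R"
  let ?K = "\<lambda>j. mollifier_kernel.K (e j) (c j) R g"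
  have gs: "square_integrable_on ?B g"
    by (rule square_integrable_on_continuous[of "cball 0 R"]) (use continuous_on_subset[OF g(1)] in auto)
  note Bp = mollifier_kernel.B_props[OF ker]
  have Ti: "integrable lborel (\<lambda>x. indicat_real ?B x *\<^sub>R T x)"
    using square_integrable_imp_integrable[OF T Bp] by (simp add: set_integrable_def)
  have Kpt: "(\<lambda>j. ?K j x) \<longlonglongrightarrow> g x" if x: "norm x < R" for x
  proof -
    have d0: "(\<lambda>j. ?K j x - of_real (1 / (c j)\<^sup>2) * g x) \<longlonglongrightarrow> 0"
      unfolding tendsto_iff
    proof (intro allI impI)
      fix \<tau> :: real assume \<tau>: "\<tau> > 0"
      then have "\<tau> / 8 > 0" by simp
      moreover have "isCont g x" using g(1) by (simp add: continuous_on_eq_continuous_at)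
      ultimately obtain d where d: "d > 0" "\<And>y. dist y x < d \<Longrightarrow> cmod (g y - g x) < \<tau> / 8"
        unfolding continuous_at_eps_delta dist_norm by blast
      define \<delta> where "\<delta> = min d (R - norm x)"
      have \<delta>: "\<delta> > 0" using d x by (simp add: \<delta>_def)
      have "(\<lambda>j. 2 * (\<epsilon> j + (1 - c j) * R)) \<longlonglongrightarrow> 2 * (0 + (1 - 1) * R)"
        by (intro tendsto_intros lim)
      then have "\<forall>\<^sub>F j in sequentially. 2 * (\<epsilon> j + (1 - c j) * R) < \<delta>"
        using \<delta> order_tendstoD(2) by fastforce
      then show "\<forall>\<^sub>F j in sequentially. dist (?K j x - of_real (1 / (c j)\<^sup>2) * g x) 0 < \<tau>"
      proof eventually_elim
        case (elim j)
        have "cmod (?K j x - of_real (1 / (c j)\<^sup>2) * g x) \<le> 4 * (\<tau> / 8)"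
        proof (rule mollifier_kernel.K_close[OF ker gs x elim])
          show "\<delta> \<le> R - norm x" by (simp add: \<delta>_def)
          fix y assume "dist y x < \<delta>"
          then have "dist y x < d" by (simp add: \<delta>_def)
          then show "cmod (g y - g x) \<le> \<tau> / 8" using d(2) less_imp_le by blast
        qed
        then show ?case using \<tau> by simp
      qed
    qed
    have "(\<lambda>j. complex_of_real (1 / (c j)\<^sup>2) * g x) \<longlonglongrightarrow> of_real (1 / 1\<^sup>2) * g x"
      by (intro tendsto_intros lim) simp
    from tendsto_add[OF d0 this] show ?thesis by simp
  qed
  show ?thesis
    unfolding set_lebesgue_integral_def
  proof (rule integral_dominated_convergence[where w="\<lambda>x. 4 * C * cmod (indicat_real ?B x *\<^sub>R T x)"])
    show "integrable lborel (\<lambda>x. 4 * C * cmod (indicat_real ?B x *\<^sub>R T x))"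
      using Ti by (intro integrable_mult_right integrable_norm)
    have e: "(\<lambda>x. indicat_real ?B x *\<^sub>R (T x * f x)) = (\<lambda>x. (indicat_real ?B x *\<^sub>R T x) * f x)" for f by simp
    show "(\<lambda>x. indicat_real ?B x *\<^sub>R (T x * g x)) \<in> borel_measurable lborel"
      unfolding e using Ti borel_measurable_continuous_onI[OF g(1)] by (intro borel_measurable_times) auto
    show "(\<lambda>x. indicat_real ?B x *\<^sub>R (T x * ?K j x)) \<in> borel_measurable lborel" for j
      unfolding e using Ti mollifier_kernel.K_meas[OF ker gs, of j] by (intro borel_measurable_times) auto
    show "AE x in lborel. (\<lambda>j. indicat_real ?B x *\<^sub>R (T x * ?K j x)) \<longlonglongrightarrow> indicat_real ?B x *\<^sub>R (T x * g x)"
    proof (rule AE_I2)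
      fix x
      show "(\<lambda>j. indicat_real ?B x *\<^sub>R (T x * ?K j x)) \<longlonglongrightarrow> indicat_real ?B x *\<^sub>R (T x * g x)"
      proof (cases "x \<in> ?B")
        case True
        then show ?thesis by (intro tendsto_intros Kpt) simp
      qed simp
    qed
    show "AE x in lborel. norm (indicat_real ?B x *\<^sub>R (T x * ?K j x)) \<le> 4 * C * cmod (indicat_real ?B x *\<^sub>R T x)" for j
    proof (rule AE_I2)
      fix x
      have "cmod (?K j x) \<le> 4 * C" by (rule mollifier_kernel.K_sup_bound[OF ker gs g(2)])
      from mult_left_mono[OF this norm_ge_zero[of "T x"]]
      show "norm (indicat_real ?B x *\<^sub>R (T x * ?K j x)) \<le> 4 * C * cmod (indicat_real ?B x *\<^sub>R T x)"
        by (auto simp: indicator_def norm_mult mult_ac)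
    qed
  qed
qed

text \<open>\<open>h\<close> is replaced by a bounded continuous \<open>g\<close> close to it in L2;
  by \<open>K_bound\<close> the error is small uniformly in \<open>j\<close>.\<close>

lemma mollified_pairing_limit:
  assumes ker: "\<And>j. mollifier_kernel (e j) (\<epsilon> j) (c j) R" and lim: "\<epsilon> \<longlonglongrightarrow> 0" "c \<longlonglongrightarrow> 1"
    and T: "square_integrable_on (ball 0 R) T" and h: "square_integrable_on (ball 0 R) h"
  shows "(\<lambda>j. LINT x:ball 0 R|lborel. T x * mollifier_kernel.K (e j) (c j) R h x) \<longlonglongrightarrow> (LINT x:ball 0 R|lborel. T x * h x)"
  unfolding tendsto_iff
proof (intro allI impI)
  let ?B = "ball (0::real^2) R"
  let ?K = "\<lambda>j. mollifier_kernel.K (e j) (c j) R"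
  fix \<eta> :: real assume \<eta>: "\<eta> > 0"
  define N where "N = (LINT x:?B|lborel. (cmod (T x))\<^sup>2)"
  have N: "N \<ge> 0" by (simp add: N_def set_lebesgue_integral_def)
  \<comment> \<open>Chosen with \<tau> so that \<alpha> N <= \<eta> / 16 and \<tau> / \<alpha> =
    \<eta> / 8. Both replacement errors are then at most \<eta> / 4, which leaves \<eta> / 2 for the
    continuous part.\<close>
  define \<alpha> where "\<alpha> = \<eta> / (16 * (N + 1))"
  have \<alpha>: "\<alpha> > 0" using \<eta> N by (simp add: \<alpha>_def)
  define \<tau> where "\<tau> = \<alpha> * \<eta> / 8"
  have \<tau>: "\<tau> > 0" using \<alpha> \<eta> by (simp add: \<tau>_def)
  note Bp = mollifier_kernel.B_props[OF ker]
  obtain g C where g: "continuous_on UNIV g" "\<And>x. cmod (g x) \<le> C" "(LINT x:?B|lborel. (cmod (h x - g x))\<^sup>2) < \<tau>"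
    using L2_approx_continuous[OF h Bp \<tau>] by metis
  have gs: "square_integrable_on ?B g"
    by (rule square_integrable_on_continuous[of "cball 0 R"]) (use continuous_on_subset[OF g(1)] in auto)
  have hg: "square_integrable_on ?B (\<lambda>x. h x - g x)" by (rule square_integrable_on_diff[OF h gs])
  have \<alpha>N: "\<alpha> * N \<le> \<eta> / 16"
  proof -
    have "\<alpha> * N = \<eta> / 16 * (N / (N + 1))" using N by (simp add: \<alpha>_def field_simps)
    also have "\<dots> \<le> \<eta> / 16 * 1" using N \<eta> by (intro mult_left_mono) auto
    finally show ?thesis by simp
  qed
  have \<tau>\<alpha>: "(LINT x:?B|lborel. (cmod (h x - g x))\<^sup>2) / \<alpha> \<le> \<eta> / 8"
    using g(3) \<alpha> \<eta> by (simp add: \<tau>_def field_simps)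
  have 1: "cmod (LINT x:?B|lborel. T x * ?K j (\<lambda>y. h y - g y) x) \<le> \<eta> / 4" for j
  proof -
    have "cmod (LINT x:?B|lborel. T x * ?K j (\<lambda>y. h y - g y) x) \<le> 2 * \<alpha> * N + (LINT x:?B|lborel. (cmod (h x - g x))\<^sup>2) / (2 * \<alpha>)"
      unfolding N_def by (rule mollifier_kernel.K_bound(2)[OF ker T hg \<alpha>])
    moreover have "(LINT x:?B|lborel. (cmod (h x - g x))\<^sup>2) / (2 * \<alpha>) = ((LINT x:?B|lborel. (cmod (h x - g x))\<^sup>2) / \<alpha>) / 2" by simp
    ultimately show ?thesis using \<alpha>N \<tau>\<alpha> \<eta> by linarith
  qed
  have 2: "cmod (LINT x:?B|lborel. T x * (h x - g x)) \<le> \<eta> / 4"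
    using product_bound(2)[OF T hg \<alpha>] \<alpha>N \<tau>\<alpha> \<eta> by (simp add: N_def)
  have "\<forall>\<^sub>F j in sequentially. dist (LINT x:?B|lborel. T x * ?K j g x) (LINT x:?B|lborel. T x * g x) < \<eta> / 2"
    using tendstoD[OF mollified_pairing_limit_continuous[OF ker lim T g(1,2)], of "\<eta> / 2"] \<eta> by simp
  then show "\<forall>\<^sub>F j in sequentially. dist (LINT x:?B|lborel. T x * ?K j h x) (LINT x:?B|lborel. T x * h x) < \<eta>"
  proof eventually_elim
    case (elim j)
    have a: "(LINT x:?B|lborel. T x * ?K j (\<lambda>y. h y - g y) x) = (LINT x:?B|lborel. T x * ?K j h x) - (LINT x:?B|lborel. T x * ?K j g x)"
      using mollifier_kernel.K_bound(1)[OF ker T h \<alpha>] mollifier_kernel.K_bound(1)[OF ker T gs \<alpha>]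
      by (simp add: mollifier_kernel.K_diff[OF ker h gs] right_diff_distrib set_integral_diff)
    have b: "(LINT x:?B|lborel. T x * (h x - g x)) = (LINT x:?B|lborel. T x * h x) - (LINT x:?B|lborel. T x * g x)"
      using product_bound(1)[OF T h \<alpha>] product_bound(1)[OF T gs \<alpha>] by (simp add: right_diff_distrib set_integral_diff)
    have "(LINT x:?B|lborel. T x * ?K j h x) - (LINT x:?B|lborel. T x * h x) =
       (LINT x:?B|lborel. T x * ?K j (\<lambda>y. h y - g y) x) + ((LINT x:?B|lborel. T x * ?K j g x) - (LINT x:?B|lborel. T x * g x)) - (LINT x:?B|lborel. T x * (h x - g x))"
      unfolding a b by simp
    then have "dist (LINT x:?B|lborel. T x * ?K j h x) (LINT x:?B|lborel. T x * h x) \<le>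
      cmod (LINT x:?B|lborel. T x * ?K j (\<lambda>y. h y - g y) x) + dist (LINT x:?B|lborel. T x * ?K j g x) (LINT x:?B|lborel. T x * g x) + cmod (LINT x:?B|lborel. T x * (h x - g x))"
      unfolding dist_norm by (simp only:) (rule order_trans[OF norm_triangle_ineq4 add_right_mono[OF norm_triangle_ineq]])
    then show ?case using 1[of j] 2 elim by linarith
  qed
qed

lemma test_functions_affine:
  assumes "\<eta> \<in> test_functions UNIV" "c \<noteq> 0"
  shows "(\<lambda>y. \<eta> (a + c *\<^sub>R y)) \<in> test_functions UNIV"
proof -
  obtain K where K: "smooth_on UNIV \<eta>" "compact K" "\<And>x. x \<notin> K \<Longrightarrow> \<eta> x = 0"
    using assms(1) unfolding test_functions_def by blast
  let ?K = "(\<lambda>v. (1 / c) *\<^sub>R (v - a)) ` K"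
  show ?thesis
  proof (rule test_functionsI[of _ ?K])
    show "smooth_on UNIV (\<lambda>y. \<eta> (a + c *\<^sub>R y))" by (rule smooth_on_affine_compose[OF K(1)])
    show "compact ?K" by (intro compact_continuous_image K(2) continuous_intros)
    fix y assume y: "y \<notin> ?K"
    have "y = (1 / c) *\<^sub>R (a + c *\<^sub>R y - a)" using assms(2) by simp
    with y have "a + c *\<^sub>R y \<notin> K" by blast
    then show "\<eta> (a + c *\<^sub>R y) = 0" by (rule K(3))
  qed simp
qed

lemma laplacian_affine:
  assumes "smooth_on UNIV \<eta>"
  shows "laplacian (\<lambda>y. \<eta> (a + c *\<^sub>R y)) y = of_real (c\<^sup>2) * laplacian \<eta> (a + c *\<^sub>R y)"
proof -
  have d: "\<eta> differentiable at x" "partial_deriv i \<eta> differentiable at x" for i x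
    using smooth_on_differentiable[OF assms] smooth_on_differentiable[OF smooth_on_partial_deriv[OF assms]] by auto
  have 1: "partial_deriv i (\<lambda>y. \<eta> (a + c *\<^sub>R y)) = (\<lambda>y. of_real c * partial_deriv i \<eta> (a + c *\<^sub>R y))" for i
    by (rule ext, rule partial_deriv_affine[OF d(1)])
  have da: "(\<lambda>y. partial_deriv i \<eta> (a + c *\<^sub>R y)) differentiable at y" for i y
    by (rule smooth_on_differentiable[OF smooth_on_affine_compose[OF smooth_on_partial_deriv[OF assms]]]) auto
  have "partial_deriv i (\<lambda>y. of_real c * partial_deriv i \<eta> (a + c *\<^sub>R y)) y = of_real c * (of_real c * partial_deriv i (partial_deriv i \<eta>) (a + c *\<^sub>R y))" for i
    by (subst partial_deriv_linear_compose[OF bounded_linear_mult_right da]) (simp add: partial_deriv_affine[OF d(2)])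
  then show ?thesis
    by (simp add: laplacian_def 1 sum_distrib_left power2_eq_square mult.assoc)
qed

text \<open>Each y-derivative of \<eta>(x - c y) produces a factor -c, so the y-Laplacian of the
  shifted kernel is c^2 times the shifted \<open>laplacian \<eta>\<close>.\<close>

lemma mollify_weak_laplacian:
  assumes "weak_laplacian UNIV f g" "\<eta> \<in> test_functions UNIV" "c \<noteq> 0"
  shows "(LINT y|lborel. laplacian \<eta> (x - c *\<^sub>R y) * f y) = of_real (1 / c\<^sup>2) * (LINT y|lborel. \<eta> (x - c *\<^sub>R y) * g y)"
proof -
  let ?\<phi> = "\<lambda>y. \<eta> (x + (- c) *\<^sub>R y)"
  have "?\<phi> \<in> test_functions UNIV" using assms(2,3) by (intro test_functions_affine) auto
  then have "(LINT y|lborel. f y * laplacian ?\<phi> y) = (LINT y|lborel. g y * ?\<phi> y)"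
    using assms(1) by (simp add: weak_laplacian_alt)
  also have "(\<lambda>y. f y * laplacian ?\<phi> y) = (\<lambda>y. of_real (c\<^sup>2) * (laplacian \<eta> (x - c *\<^sub>R y) * f y))"
    unfolding laplacian_affine[OF test_functions_smooth[OF assms(2)]] by (simp add: mult_ac)
  finally have "of_real (c\<^sup>2) * (LINT y|lborel. laplacian \<eta> (x - c *\<^sub>R y) * f y) = (LINT y|lborel. \<eta> (x - c *\<^sub>R y) * g y)"
    by (simp only: integral_mult_right_zero mult.commute[of "g _"]) simp
  then show ?thesis using assms(3) by (simp add: field_simps)
qed

lemma locally_integrable_measurable:
  assumes "locally_integrable_on UNIV f"
  shows "f \<in> borel_measurable borel"
proof (rule borel_measurable_LIMSEQ_metric)
  have "integrable lborel (\<lambda>x. indicat_real (cball 0 (real n)) x *\<^sub>R f x)" for n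
    using assms by (auto simp: locally_integrable_on_def set_integrable_def)
  then show "(\<lambda>x. indicat_real (cball 0 (real n)) x *\<^sub>R f x) \<in> borel_measurable borel" for n
    using borel_measurable_integrable by fastforce
  fix x :: "real^2"
  obtain n where n: "norm x \<le> real n" using real_arch_simple by blast
  have "\<forall>\<^sub>F m in sequentially. f x = indicat_real (cball 0 (real m)) x *\<^sub>R f x"
    using eventually_ge_at_top[of n] by eventually_elim (use n in \<open>auto simp: indicator_def\<close>)
  then show "(\<lambda>n. indicat_real (cball 0 (real n)) x *\<^sub>R f x) \<longlonglongrightarrow> f x"
    by (rule Lim_transform_eventually[OF tendsto_const])
qed

lemma integrable_of_locally_integrable:
  assumes "locally_integrable_on UNIV f" "AE x in lborel. R < norm x \<longrightarrow> f x = 0"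
  shows "integrable lborel f"
proof (rule integrable_cong_AE_imp)
  show "integrable lborel (\<lambda>x. indicat_real (cball 0 R) x *\<^sub>R f x)"
    using assms(1) by (auto simp: locally_integrable_on_def set_integrable_def)
  show "f \<in> borel_measurable lborel" using locally_integrable_measurable[OF assms(1)] by simp
  show "AE x in lborel. indicat_real (cball 0 R) x *\<^sub>R f x = f x"
    using assms(2) by eventually_elim (auto simp: indicator_def)
qed

text \<open>Outside the disc \<open>f\<close> agrees with the zero function, and weak Laplacians are
  unique up to null sets.\<close>

lemma weak_laplacian_vanishing:
  assumes "weak_laplacian UNIV f g" "AE x in lborel. R < norm x \<longrightarrow> f x = 0"
  shows "AE x in lborel. R < norm x \<longrightarrow> g x = 0"
proof -
  have "weak_laplacian {x. R < norm x} (\<lambda>x. 0) (\<lambda>x. 0)"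
    by (simp add: weak_laplacian_alt locally_integrable_on_def set_integrable_def)
  from weak_laplacian_unique[OF open_norm_greater weak_laplacian_subset[OF assms(1) subset_UNIV] this]
  show ?thesis using assms(2) by simp
qed

section \<open>Orthogonality of sources to the range of the operator\<close>

definition very_weak_op :: "real \<Rightarrow> (real^2 \<Rightarrow> complex) \<Rightarrow> real^2 \<Rightarrow> complex" where
  "very_weak_op k \<phi> x = laplacian (laplacian \<phi>) x - of_real (k^4) * \<phi> x"

lemma very_weak_op_test:
  assumes "\<phi> \<in> test_functions \<Omega>"
  shows "very_weak_op k \<phi> \<in> test_functions \<Omega>"
proof -
  have "(\<lambda>x. laplacian (laplacian \<phi>) x + - of_real (k^4) * \<phi> x) \<in> test_functions \<Omega>"
    by (intro test_functions_add test_functions_laplacian test_functions_linear_compose[OF bounded_linear_mult_right] assms)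
  then show ?thesis by (simp add: very_weak_op_def [abs_def])
qed

text \<open>Moving both Laplacians onto \<phi> turns the weak equation into a pairing that is
  continuous in L2 and therefore survives the closure in \<open>source_space\<close>.\<close>

lemma source_space_very_weak:
  assumes S: "S \<in> source_space k R" and \<phi>: "\<phi> \<in> test_functions (ball 0 R)"
  shows "(LINT x:ball 0 R|lborel. S x * very_weak_op k \<phi> x) = 0"
proof -
  let ?B = "ball (0::real^2) R" and ?\<psi> = "very_weak_op k \<phi>"
  have Bp: "?B \<in> sets borel" "emeasure lborel ?B < \<infinity>"
    using emeasure_bounded_finite[OF bounded_ball] by auto
  note \<psi> = very_weak_op_test[OF \<phi>, of k]
  have \<psi>m: "?\<psi> \<in> borel_measurable borel" by (rule smooth_on_UNIV_borel_measurable[OF test_functions_smooth[OF \<psi>]])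
  obtain C where C: "C > 0" "\<And>x. cmod (?\<psi> x) \<le> C" using test_functions_bounded[OF \<psi>] by metis
  have sS: "square_integrable_on ?B S" using S by (simp add: source_space_def L2_on_iff)
  let ?M = "C * sqrt (measure lborel ?B)"
  have M: "?M \<ge> 0" using C by simp
  have "cmod (LINT x:?B|lborel. S x * ?\<psi> x) \<le> 0 + \<delta>" if \<delta>: "\<delta> > 0" for \<delta>
  proof -
    have "\<delta> / (?M + 1) > 0" using \<delta> M by simp
    then obtain v where v: "v \<in> weak_solutions k R" "L2_norm_on ?B (\<lambda>x. S x - v x) < \<delta> / (?M + 1)"
      using S unfolding source_space_def by blast
    from v(1) obtain w where w: "sobolev 2 ?B v" "weak_laplacian ?B v w"
        "\<And>\<phi>. \<phi> \<in> test_functions ?B \<Longrightarrow> (LINT x:?B|lborel. w x * laplacian \<phi> x - of_real (k^4) * v x * \<phi> x) = 0"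
      unfolding weak_solutions_def by blast
    have sv: "square_integrable_on ?B v" using w(1) by (simp add: numeral_2_eq_2 L2_on_iff)
    have lv: "locally_integrable_on ?B v" "locally_integrable_on ?B w" using w(2) by (auto simp: weak_laplacian_alt)
    have i: "integrable lborel (\<lambda>x. v x * \<phi> x)" "integrable lborel (\<lambda>x. w x * laplacian \<phi> x)" "integrable lborel (\<lambda>x. v x * laplacian (laplacian \<phi>) x)"
      using lv \<phi> by (auto intro: integrable_mult_test test_functions_laplacian)
    have "(LINT x:?B|lborel. w x * laplacian \<phi> x - of_real (k^4) * v x * \<phi> x) = (LINT x|lborel. w x * laplacian \<phi> x - of_real (k^4) * (v x * \<phi> x))"
      unfolding set_lebesgue_integral_def
      using test_functions_outside[OF \<phi>] test_functions_outside[OF test_functions_laplacian[OF \<phi>]]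
      by (intro Bochner_Integration.integral_cong refl) (auto simp: indicator_def)
    then have a: "(LINT x|lborel. w x * laplacian \<phi> x) = of_real (k^4) * (LINT x|lborel. v x * \<phi> x)"
      using w(3)[OF \<phi>] i by simp
    \<comment> \<open>The Laplacian of \<phi> is again a test function, so the weak Laplacian
      \<open>w\<close> of \<open>v\<close> may be tested with it.\<close>
    have b: "(LINT x|lborel. v x * laplacian (laplacian \<phi>) x) = (LINT x|lborel. w x * laplacian \<phi> x)"
      using w(2) test_functions_laplacian[OF \<phi>] by (simp add: weak_laplacian_alt)
    have "(LINT x:?B|lborel. v x * ?\<psi> x) = (LINT x|lborel. v x * laplacian (laplacian \<phi>) x - of_real (k^4) * (v x * \<phi> x))"
      unfolding set_integral_test[OF \<psi>] by (intro Bochner_Integration.integral_cong refl) (simp add: very_weak_op_def algebra_simps)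
    also have "\<dots> = 0" using i a b by simp
    finally have v0: "(LINT x:?B|lborel. v x * ?\<psi> x) = 0" .
    have "(LINT x:?B|lborel. S x * ?\<psi> x) = (LINT x:?B|lborel. S x * ?\<psi> x) - (LINT x:?B|lborel. v x * ?\<psi> x)"
      unfolding v0 by simp
    also have "\<dots> = (LINT x:?B|lborel. (S x - v x) * ?\<psi> x)"
      using set_integral_mult_bound(1)[OF sS Bp \<psi>m, of C] set_integral_mult_bound(1)[OF sv Bp \<psi>m, of C] C
      by (simp add: left_diff_distrib set_integral_diff)
    also have "cmod \<dots> \<le> C * (sqrt (measure lborel ?B) * sqrt (LINT x:?B|lborel. (cmod (S x - v x))\<^sup>2))"
      by (rule set_integral_mult_bound(2)[OF square_integrable_on_diff[OF sS sv] Bp \<psi>m]) (use C in auto)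
    also have "\<dots> = ?M * L2_norm_on ?B (\<lambda>x. S x - v x)" by (simp add: L2_norm_on_def)
    also have "\<dots> \<le> ?M * (\<delta> / (?M + 1))" using v(2) M by (intro mult_left_mono) auto
    also have "\<dots> = ?M / (?M + 1) * \<delta>" by simp
    also have "\<dots> \<le> 1 * \<delta>" using M \<delta> by (intro mult_right_mono) auto
    finally show ?thesis by simp
  qed
  then have "cmod (LINT x:?B|lborel. S x * ?\<psi> x) \<le> 0" by (rule field_le_epsilon)
  then show ?thesis by simp
qed

lemma laplacian_cnj:
  assumes "smooth_on UNIV \<phi>"
  shows "laplacian (\<lambda>x. cnj (\<phi> x)) = (\<lambda>x. cnj (laplacian \<phi> x))"
proof
  fix x
  have p: "partial_deriv i (\<lambda>x. cnj (f x)) = (\<lambda>x. cnj (partial_deriv i f x))" if "smooth_on UNIV f" for f i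
    using smooth_on_differentiable[OF that] by (intro ext partial_deriv_linear_compose[OF bounded_linear_cnj]) auto
  show "laplacian (\<lambda>x. cnj (\<phi> x)) x = cnj (laplacian \<phi> x)"
    unfolding laplacian_def p[OF assms] p[OF smooth_on_partial_deriv[OF assms]] by simp
qed

text \<open>The operator has real coefficients.\<close>

lemma very_weak_op_cnj:
  assumes "\<phi> \<in> test_functions \<Omega>"
  shows "very_weak_op k (\<lambda>x. cnj (\<phi> x)) x = cnj (very_weak_op k \<phi> x)"
  using test_functions_smooth[OF assms] test_functions_smooth[OF test_functions_laplacian[OF assms]]
  by (simp add: very_weak_op_def laplacian_cnj)

lemma set_integral_cnj: "(LINT x:B|lborel. cnj (f x)) = cnj (LINT x:B|lborel. f x)"
proof -
  have "(LINT x:B|lborel. cnj (f x)) = (LINT x|lborel. cnj (indicat_real B x *\<^sub>R f x))"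
    unfolding set_lebesgue_integral_def by (intro Bochner_Integration.integral_cong refl) simp
  then show ?thesis unfolding set_lebesgue_integral_def by (simp only: Bochner_Integration.integral_cnj)
qed

lemma mollifier_sequence:
  assumes R: "R > 0"
  obtains e :: "nat \<Rightarrow> real^2 \<Rightarrow> real" and \<epsilon> c :: "nat \<Rightarrow> real"
  where "\<And>j. mollifier_kernel (e j) (\<epsilon> j) (c j) R" "\<epsilon> \<longlonglongrightarrow> 0" "c \<longlonglongrightarrow> 1" "\<And>j. c j * R + \<epsilon> j < R"
proof -
  \<comment> \<open>d <= 1 / 2 ensures c = 1 - d >= 1 / 2, and \<epsilon> = d R / 4 is smaller than
    the gap d R that the shrinking opens.\<close>
  define d where "d j = inverse (real (Suc (Suc j)))" for j
  have d: "d j > 0" "d j \<le> 1 / 2" for j by (simp_all add: d_def field_simps)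
  have dl: "d \<longlonglongrightarrow> 0" unfolding d_def using LIMSEQ_inverse_real_of_nat LIMSEQ_Suc by blast
  have "\<forall>j. \<exists>e :: real^2 \<Rightarrow> real. (\<lambda>x. complex_of_real (e x)) \<in> test_functions UNIV \<and> (\<forall>x. 0 \<le> e x) \<and>
     (\<forall>x. d j * R / 4 < norm x \<longrightarrow> e x = 0) \<and> (LINT x|lborel. e x) = 1"
    using R d by (intro allI mollifier_exists) simp
  from choice[OF this] obtain e :: "nat \<Rightarrow> real^2 \<Rightarrow> real" where e: "\<forall>j. (\<lambda>x. complex_of_real (e j x)) \<in> test_functions UNIV \<and> (\<forall>x. 0 \<le> e j x) \<and>
     (\<forall>x. d j * R / 4 < norm x \<longrightarrow> e j x = 0) \<and> (LINT x|lborel. e j x) = 1" ..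
  show ?thesis
  proof (rule that[of e "\<lambda>j. d j * R / 4" "\<lambda>j. 1 - d j"])
    show "mollifier_kernel (e j) (d j * R / 4) (1 - d j) R" for j
      using e[rule_format, of j] d[of j] R by unfold_locales auto
    show "(\<lambda>j. d j * R / 4) \<longlonglongrightarrow> 0"
      using tendsto_mult[OF dl tendsto_const[of "R / 4"]] by simp
    show "(\<lambda>j. 1 - d j) \<longlonglongrightarrow> 1" using tendsto_diff[OF tendsto_const dl, of 1] by simp
    show "(1 - d j) * R + d j * R / 4 < R" for j
      using mult_pos_pos[OF d(1)[of j] R] by (simp add: algebra_simps)
  qed
qed

text \<open>Contributing points satisfy |c y| <= c R and |x - c y| <= \<epsilon>, so the support
  lies in the closed ball of radius c R + \<epsilon>, which is inside the open one.\<close>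

lemma mollified_is_test:
  assumes ker: "mollifier_kernel e \<epsilon> c R" and supp: "c * R + \<epsilon> < R" and u: "square_integrable_on (ball 0 R) u"
  shows "mollifier_kernel.K e c R u \<in> test_functions (ball 0 R)"
proof -
  interpret mollifier_kernel e \<epsilon> c R by (rule ker)
  show ?thesis
  proof (rule test_functionsI[of _ "cball 0 (c * R + \<epsilon>)"])
    show "smooth_on UNIV (K u)"
      unfolding K_def [abs_def] by (rule mollify_smooth[OF e_test H_integrable[OF u]])
    show "cball 0 (c * R + \<epsilon>) \<subseteq> ball (0::real^2) R" using supp by auto
    fix x :: "real^2" assume "x \<notin> cball 0 (c * R + \<epsilon>)"
    then have x: "c * R + \<epsilon> < norm x" by simp
    have z: "of_real (e (x - c *\<^sub>R y)) * (indicat_real B y *\<^sub>R u y) = 0" for y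
    proof (cases "norm y < R")
      case True
      have "norm x \<le> norm (x - c *\<^sub>R y) + norm (c *\<^sub>R y)" using norm_triangle_ineq[of "x - c *\<^sub>R y" "c *\<^sub>R y"] by simp
      moreover have "norm (c *\<^sub>R y) \<le> c * R" using True c by (simp add: mult_left_mono)
      ultimately have "\<epsilon> < norm (x - c *\<^sub>R y)" using x by linarith
      then show ?thesis using e_supp by simp
    qed simp
    show "K u x = 0" unfolding K_def z by simp
  qed simp
qed

text \<open>With \<open>Z\<close> representing \<Delta>^2 u in the ball, the conclusion says that
  \<open>T\<close> is orthogonal to \<Delta>^2 u - k^4 u. Since \<open>u\<close> vanishes outside,
  its shrunken mollifications are test functions whose bilaplacian is a multiple of a mollification
  of \<open>z\<close>, and the orthogonality passes to the limit.\<close>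

lemma source_orthogonal:
  assumes R: "R > 0"
    and wl: "weak_laplacian UNIV u w" "weak_laplacian UNIV w z"
    and zero: "AE x in lborel. R < norm x \<longrightarrow> u x = 0"
    and u: "square_integrable_on (ball 0 R) u" and Z: "square_integrable_on (ball 0 R) Z"
    and zZ: "AE x in lborel. x \<in> ball 0 R \<longrightarrow> z x = Z x"
    and T: "square_integrable_on (ball 0 R) T"
    and orth: "\<And>\<phi>. \<phi> \<in> test_functions (ball 0 R) \<Longrightarrow> (LINT x:ball 0 R|lborel. T x * very_weak_op k \<phi> x) = 0"
  shows "(LINT x:ball 0 R|lborel. T x * Z x) = of_real (k^4) * (LINT x:ball 0 R|lborel. T x * u x)"
proof -
  let ?B = "ball (0::real^2) R"
  obtain e :: "nat \<Rightarrow> real^2 \<Rightarrow> real" and \<epsilon> c :: "nat \<Rightarrow> real"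
    where ker: "\<And>j. mollifier_kernel (e j) (\<epsilon> j) (c j) R" and lim: "\<epsilon> \<longlonglongrightarrow> 0" "c \<longlonglongrightarrow> 1" and supp: "\<And>j. c j * R + \<epsilon> j < R"
    by (rule mollifier_sequence[OF R]) blast
  let ?K = "\<lambda>j. mollifier_kernel.K (e j) (c j) R"
  have wz: "AE x in lborel. R < norm x \<longrightarrow> w x = 0" by (rule weak_laplacian_vanishing[OF wl(1) zero])
  have zz: "AE x in lborel. R < norm x \<longrightarrow> z x = 0" by (rule weak_laplacian_vanishing[OF wl(2) wz])
  have lu: "locally_integrable_on UNIV u" "locally_integrable_on UNIV w" "locally_integrable_on UNIV z"
    using wl by (auto simp: weak_laplacian_alt)
  have iu: "integrable lborel u" and iw: "integrable lborel w" and iz: "integrable lborel z"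
    using integrable_of_locally_integrable[OF lu(1) zero] integrable_of_locally_integrable[OF lu(2) wz]
      integrable_of_locally_integrable[OF lu(3) zz] by auto
  \<comment> \<open>Because \<open>f\<close> vanishes outside and the circle is a null set, the
    truncation in \<open>K\<close> loses nothing; this is where vanishing in the exterior
    enters.\<close>
  have Keq: "?K j h x = (LINT y|lborel. of_real (e j (x - c j *\<^sub>R y)) * f y)"
    if h: "square_integrable_on ?B h" and f: "integrable lborel f" "AE y in lborel. y \<in> ?B \<longrightarrow> f y = h y" "AE y in lborel. R < norm y \<longrightarrow> f y = 0"
    for j h f x
  proof -
    interpret mollifier_kernel "e j" "\<epsilon> j" "c j" R by (rule ker)
    show ?thesis
      unfolding K_def
    proof (rule integral_cong_AE)
      show "AE y in lborel. of_real (e j (x - c j *\<^sub>R y)) * (indicat_real ?B y *\<^sub>R h y) = of_real (e j (x - c j *\<^sub>R y)) * f y"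
        using f(2,3) AE_not_sphere[of R]
      proof eventually_elim
        case (elim y)
        then show ?case by (cases "norm y < R") (auto simp: indicator_def)
      qed
    qed (use K_integrable[OF h] mollify_integrable[OF e_test f(1)] in auto)
  qed
  have id: "?K j u = (\<lambda>x. LINT y|lborel. of_real (e j (x - c j *\<^sub>R y)) * u y)" for j
    by (rule ext, rule Keq[OF u iu _ zero]) simp
  \<comment> \<open>The two Laplacians produce 1 / c^4 and the zeroth-order term no factor; the
    mismatch disappears as c tends to 1.\<close>
  have op: "very_weak_op k (?K j u) x = of_real (1 / (c j)\<^sup>2) * (of_real (1 / (c j)\<^sup>2) * ?K j Z x) - of_real (k^4) * ?K j u x" for j x
  proof -
    let ?\<eta> = "\<lambda>x. complex_of_real (e j x)"
    have \<eta>: "?\<eta> \<in> test_functions UNIV" by (rule mollifier_kernel.e_test[OF ker])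
    have c: "c j \<noteq> 0" using mollifier_kernel.c[OF ker, of j] by auto
    have "laplacian (laplacian (?K j u)) x = (LINT y|lborel. laplacian (laplacian ?\<eta>) (x - c j *\<^sub>R y) * u y)"
      unfolding id mollify_laplacian[OF \<eta> iu] mollify_laplacian[OF test_functions_laplacian[OF \<eta>] iu] ..
    also have "\<dots> = of_real (1 / (c j)\<^sup>2) * (LINT y|lborel. laplacian ?\<eta> (x - c j *\<^sub>R y) * w y)"
      by (rule mollify_weak_laplacian[OF wl(1) test_functions_laplacian[OF \<eta>] c])
    also have "\<dots> = of_real (1 / (c j)\<^sup>2) * (of_real (1 / (c j)\<^sup>2) * (LINT y|lborel. ?\<eta> (x - c j *\<^sub>R y) * z y))"
      by (simp only: mollify_weak_laplacian[OF wl(2) \<eta> c])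
    also have "(LINT y|lborel. ?\<eta> (x - c j *\<^sub>R y) * z y) = ?K j Z x"
      by (rule Keq[OF Z iz zZ zz, symmetric])
    finally show ?thesis by (simp add: very_weak_op_def)
  qed
  have eq0: "of_real (1 / (c j)\<^sup>2) * (of_real (1 / (c j)\<^sup>2) * (LINT x:?B|lborel. T x * ?K j Z x)) - of_real (k^4) * (LINT x:?B|lborel. T x * ?K j u x) = 0" for j
  proof -
    note i = mollifier_kernel.K_bound(1)[OF ker T Z zero_less_one, of j] mollifier_kernel.K_bound(1)[OF ker T u zero_less_one, of j]
    have "0 = (LINT x:?B|lborel. T x * very_weak_op k (?K j u) x)"
      by (rule orth[OF mollified_is_test[OF ker supp u], symmetric])
    also have "\<dots> = (LINT x:?B|lborel. of_real (1 / (c j)\<^sup>2) * (of_real (1 / (c j)\<^sup>2) * (T x * ?K j Z x)) - of_real (k^4) * (T x * ?K j u x))"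
      unfolding op by (simp only: right_diff_distrib mult.left_commute)
    also have "\<dots> = of_real (1 / (c j)\<^sup>2) * (of_real (1 / (c j)\<^sup>2) * (LINT x:?B|lborel. T x * ?K j Z x)) - of_real (k^4) * (LINT x:?B|lborel. T x * ?K j u x)"
      using i by (subst set_integral_diff(2)) (auto intro!: set_integrable_mult_right)
    finally show ?thesis by simp
  qed
  have "(\<lambda>j. of_real (1 / (c j)\<^sup>2) * (of_real (1 / (c j)\<^sup>2) * (LINT x:?B|lborel. T x * ?K j Z x)) - of_real (k^4) * (LINT x:?B|lborel. T x * ?K j u x))
    \<longlonglongrightarrow> of_real (1 / 1\<^sup>2) * (of_real (1 / 1\<^sup>2) * (LINT x:?B|lborel. T x * Z x)) - of_real (k^4) * (LINT x:?B|lborel. T x * u x)"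
    by (intro tendsto_diff tendsto_mult tendsto_const tendsto_of_real tendsto_divide tendsto_power lim
        mollified_pairing_limit[OF ker lim T Z] mollified_pairing_limit[OF ker lim T u]) auto
  then show ?thesis unfolding eq0 by (simp add: LIMSEQ_const_iff)
qed

theorem theorem2p1:
  fixes R k :: real and S1 S2 u1 u2 f g :: "real^2 \<Rightarrow> complex"
  assumes "R > 0" and "k > 0"
    and "S1 \<in> source_space k R" and "S2 \<in> source_space k R"
    and "radiating_solution k R (zero_extension (ball 0 R) S1) u1"
    and "radiating_solution k R (zero_extension (ball 0 R) S2) u2"
    and "dirichlet_data R u1 f g" and "dirichlet_data R u2 f g"
  shows "AE x in lborel. x \<in> ball 0 R \<longrightarrow> S1 x = S2 x"
proof -
  let ?B = "ball (0::real^2) R"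
  define S where "S x = S1 x - S2 x" for x
  define u where "u x = u1 x - u2 x" for x
  obtain w1 z1 where 1: "weak_laplacian UNIV u1 w1" "weak_laplacian UNIV w1 z1"
    "AE x in lborel. z1 x - of_real (k^4) * u1 x = zero_extension ?B S1 x"
    by (rule radiating_exterior[OF assms(1,5,7)]) blast
  obtain w2 z2 where 2: "weak_laplacian UNIV u2 w2" "weak_laplacian UNIV w2 z2"
    "AE x in lborel. z2 x - of_real (k^4) * u2 x = zero_extension ?B S2 x"
    by (rule radiating_exterior[OF assms(1,6,8)]) blast
  have wl: "weak_laplacian UNIV u (\<lambda>x. w1 x - w2 x)" "weak_laplacian UNIV (\<lambda>x. w1 x - w2 x) (\<lambda>x. z1 x - z2 x)"
    unfolding u_def [abs_def] using weak_laplacian_diff 1(1,2) 2(1,2) by blast+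
  have u0: "AE x in lborel. R < norm x \<longrightarrow> u x = 0"
    using radiating_exterior_unique[OF assms(1,2,5-8)] by (simp add: u_def)
  have sS: "square_integrable_on ?B S1" "square_integrable_on ?B S2"
    using assms(3,4) by (simp_all add: source_space_def L2_on_iff)
  then have S: "square_integrable_on ?B S" unfolding S_def [abs_def] by (rule square_integrable_on_diff)
  have "L2_on ?B u1" "L2_on ?B u2"
    using assms(1,5,6) by (auto simp: radiating_solution_def numeral_eq_Suc)
  then have u: "square_integrable_on ?B u"
    unfolding u_def [abs_def] by (intro square_integrable_on_diff) (simp_all add: L2_on_iff)
  have ku: "square_integrable_on ?B (\<lambda>x. of_real (k^4) * u x)"
  proof -
    have e: "(\<lambda>x. indicat_real ?B x *\<^sub>R (of_real (k^4) * u x)) = (\<lambda>x. of_real (k^4) * (indicat_real ?B x *\<^sub>R u x))"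
      by simp
    have "(\<lambda>x. indicat_real ?B x *\<^sub>R (of_real (k^4) * u x)) \<in> borel_measurable lborel"
      unfolding e using u unfolding square_integrable_on_def set_borel_measurable_def
      by (intro borel_measurable_times) auto
    then show ?thesis
      using u unfolding square_integrable_on_def set_borel_measurable_def
      by (simp add: norm_mult power_mult_distrib)
  qed
  \<comment> \<open>The value of the bilaplacian of \<open>u\<close> in the ball according to the
    equation.\<close>
  define Z where "Z x = S x + of_real (k^4) * u x" for x
  have Z: "square_integrable_on ?B Z" unfolding Z_def [abs_def] by (rule square_integrable_on_add[OF S ku])
  have zZ: "AE x in lborel. x \<in> ?B \<longrightarrow> z1 x - z2 x = Z x"
    using 1(3) 2(3) by eventually_elim (auto simp: Z_def S_def u_def zero_extension_def algebra_simps)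
  \<comment> \<open>The pairings contain no conjugation, so the conjugate is taken here to obtain T
    S = |S|^2.\<close>
  define T where "T x = cnj (S x)" for x
  have T: "square_integrable_on ?B T"
  proof -
    have "(\<lambda>x. cnj (indicat_real ?B x *\<^sub>R S x)) \<in> borel_measurable lborel"
      using S unfolding square_integrable_on_def set_borel_measurable_def
      by (intro borel_measurable_continuous_on[of cnj] continuous_intros) auto
    then show ?thesis
      using S unfolding square_integrable_on_def set_borel_measurable_def T_def by simp
  qed
  \<comment> \<open>Pairing \<open>T\<close> with the operator applied to \<phi> is the conjugate of
    pairing \<open>S\<close> with the operator applied to the conjugate of \<phi>.\<close>
  have orth: "(LINT x:?B|lborel. T x * very_weak_op k \<phi> x) = 0" if \<phi>: "\<phi> \<in> test_functions ?B" for \<phi>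
  proof -
    have c: "(\<lambda>x. cnj (\<phi> x)) \<in> test_functions ?B" by (rule test_functions_linear_compose[OF bounded_linear_cnj \<phi>])
    note \<psi> = very_weak_op_test[OF c, of k]
    obtain C where C: "C > 0" "\<And>x. cmod (very_weak_op k (\<lambda>x. cnj (\<phi> x)) x) \<le> C" using test_functions_bounded[OF \<psi>] by metis
    have Bp: "?B \<in> sets borel" "emeasure lborel ?B < \<infinity>" using emeasure_bounded_finite[OF bounded_ball] by auto
    have i: "set_integrable lborel ?B (\<lambda>x. s x * very_weak_op k (\<lambda>x. cnj (\<phi> x)) x)" if "square_integrable_on ?B s" for s
      by (rule set_integral_mult_bound(1)[OF that Bp smooth_on_UNIV_borel_measurable[OF test_functions_smooth[OF \<psi>]] C(2)]) (use C in auto)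
    have "(LINT x:?B|lborel. S x * very_weak_op k (\<lambda>x. cnj (\<phi> x)) x) = 0"
      using i[OF sS(1)] i[OF sS(2)] source_space_very_weak[OF assms(3) c] source_space_very_weak[OF assms(4) c]
      by (simp add: S_def left_diff_distrib set_integral_diff)
    moreover have "(LINT x:?B|lborel. T x * very_weak_op k \<phi> x) = (LINT x:?B|lborel. cnj (S x * very_weak_op k (\<lambda>x. cnj (\<phi> x)) x))"
      by (simp add: T_def very_weak_op_cnj[OF \<phi>])
    ultimately show ?thesis by (simp only: set_integral_cnj complex_cnj_zero)
  qed
  have "(LINT x:?B|lborel. T x * Z x) = of_real (k^4) * (LINT x:?B|lborel. T x * u x)"
    by (rule source_orthogonal[OF assms(1) wl u0 u Z zZ T orth])
  moreover have "(LINT x:?B|lborel. T x * Z x) = (LINT x:?B|lborel. T x * S x) + of_real (k^4) * (LINT x:?B|lborel. T x * u x)"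
  proof -
    have "(LINT x:?B|lborel. T x * Z x) = (LINT x:?B|lborel. T x * S x + of_real (k^4) * (T x * u x))"
      by (simp add: Z_def algebra_simps)
    also have "\<dots> = (LINT x:?B|lborel. T x * S x) + of_real (k^4) * (LINT x:?B|lborel. T x * u x)"
      using product_bound(1)[OF T S zero_less_one] product_bound(1)[OF T u zero_less_one]
      by (subst set_integral_add(2)) (auto intro!: set_integrable_mult_right)
    finally show ?thesis .
  qed
  \<comment> \<open>The terms with \<open>u\<close> cancel, whatever \<open>u\<close> is inside the
    ball.\<close>
  ultimately have "(LINT x:?B|lborel. T x * S x) = 0" by simp
  moreover have "(LINT x:?B|lborel. T x * S x) = of_real (LINT x:?B|lborel. (cmod (S x))\<^sup>2)"
  proof -
    have "T x * S x = of_real ((cmod (S x))\<^sup>2)" for x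
      unfolding T_def complex_norm_square by (rule mult.commute)
    then show ?thesis
      unfolding set_lebesgue_integral_def by (simp add: scaleR_conv_of_real flip: of_real_mult del: of_real_power)
  qed
  ultimately have "(LINT x|lborel. indicat_real ?B x *\<^sub>R (cmod (S x))\<^sup>2) = 0"
    by (simp add: set_lebesgue_integral_def)
  moreover have "integrable lborel (\<lambda>x. indicat_real ?B x *\<^sub>R (cmod (S x))\<^sup>2)"
    using S by (simp add: square_integrable_on_def set_integrable_def)
  ultimately have "AE x in lborel. indicat_real ?B x *\<^sub>R (cmod (S x))\<^sup>2 = 0"
    by (subst (asm) integral_nonneg_eq_0_iff_AE) auto
  then show ?thesis
    by eventually_elim (auto simp: indicator_def S_def)
qed

end
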